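(* Let $\mathcal{A},\mathcal{B}$ be unital $C^*$-algebras and let $\phi:\mathcal{A}_{+}^{-1}\to \mathcal{B}_{+}^{-1}$ be a surjective map (not assumed additive or positively homogeneous). Let $\mathfrak{m}$ denote either the arithmetic mean or the geometric mean. Then $$\|\phi(A)\,\mathfrak{m}\,\phi(B)\|=\|A\,\mathfrak{m}\,B\|\quad\text{for all } A,B\in \mathcal{A}_{+}^{-1}$$ holds if and only if there is a Jordan $*$-isomorphism $J:\mathcal{A}\to\mathcal{B}$ with $\phi(A)=J(A)$ for all $A\in\mathcal{A}_{+}^{-1}$. The same equivalence holds when $\mathfrak{m}$ is the harmonic mean, provided that $\mathcal{A}$ and $\mathcal{B}$ are both $AW^*$-algebras, or $\mathcal{A}$ and $\mathcal{B}$ are both commutative unital $C^*$-algebras.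
   Context: For a unital $C^*$-algebra $\mathcal{A}$, $\mathcal{A}_+$ is the set of positive elements (self-adjoint with nonnegative spectrum) and $\mathcal{A}_{+}^{-1}$ is the set of invertible elements of $\mathcal{A}_+$ (positive definite cone). For $A,B\in\mathcal{A}_+^{-1}$: arithmetic mean $A\nabla B=(A+B)/2$; geometric mean $A\#B=A^{1/2}(A^{-1/2}BA^{-1/2})^{1/2}A^{1/2}$; harmonic mean $A!B=2(A^{-1}+B^{-1})^{-1}$. A Jordan $*$-isomorphism $J:\mathcal{A}\to\mathcal{B}$ is a bijective linear map with $J(A^* )=J(A)^*$ and $J(A^2)=J(A)^2$ for all $A\in\mathcal{A}$. An $AW^*$-algebra is a $C^*$-algebra in which every set of orthogonal projections has a least upper bound and every maximal commutative $C^*$-subalgebra is generated by its projections (equivalently, for every nonempty $S\subset\mathcal{M}$ there is a projection $P$ with $\{X: XY=0\ \forall Y\in S\}=\mathcal{M}P$). *)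

theory Defs
  imports Complex_Main
begin

class cstar_algebra = real_normed_algebra_1 + banach +
  fixes cscale :: "complex \<Rightarrow> 'a \<Rightarrow> 'a"
    and cstar :: "'a \<Rightarrow> 'a"
  assumes cscale_add_right: "cscale c (x + y) = cscale c x + cscale c y"
    and cscale_add_left: "cscale (c + d) x = cscale c x + cscale d x"
    and cscale_cscale: "cscale c (cscale d x) = cscale (c * d) x"
    and cscale_of_real: "cscale (of_real r) x = scaleR r x"
    and norm_cscale: "norm (cscale c x) = cmod c * norm x"
    and cscale_mult_left: "cscale c x * y = cscale c (x * y)"
    and cscale_mult_right: "x * cscale c y = cscale c (x * y)"
    and cstar_add: "cstar (x + y) = cstar x + cstar y"
    and cstar_cscale: "cstar (cscale c x) = cscale (cnj c) (cstar x)"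
    and cstar_cstar: "cstar (cstar x) = x"
    and cstar_mult: "cstar (x * y) = cstar y * cstar x"
    and cstar_identity: "norm (cstar x * x) = (norm x)\<^sup>2"

definition cs_invertible :: "'a::cstar_algebra \<Rightarrow> bool" where
  "cs_invertible a \<longleftrightarrow> (\<exists>b. a * b = 1 \<and> b * a = 1)"

definition cs_inv :: "'a::cstar_algebra \<Rightarrow> 'a" where
  "cs_inv a = (THE b. a * b = 1 \<and> b * a = 1)"

definition cs_spectrum :: "'a::cstar_algebra \<Rightarrow> complex set" where
  "cs_spectrum a = {z. \<not> cs_invertible (a - cscale z 1)}"

definition cs_positive :: "'a::cstar_algebra \<Rightarrow> bool" where
  "cs_positive a \<longleftrightarrow> cstar a = a \<and> (\<forall>z\<in>cs_spectrum a. Im z = 0 \<and> Re z \<ge> 0)"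

definition pd_cone :: "'a::cstar_algebra set" where
  "pd_cone = {a. cs_positive a \<and> cs_invertible a}"

definition cs_sqrt :: "'a::cstar_algebra \<Rightarrow> 'a" where
  "cs_sqrt a = (THE x. cs_positive x \<and> x * x = a)"

definition arith_mean :: "'a::cstar_algebra \<Rightarrow> 'a \<Rightarrow> 'a" where
  "arith_mean A B = scaleR (1/2) (A + B)"

definition geom_mean :: "'a::cstar_algebra \<Rightarrow> 'a \<Rightarrow> 'a" where
  "geom_mean A B =
     (let R = cs_sqrt A; Ri = cs_inv (cs_sqrt A) in R * cs_sqrt (Ri * B * Ri) * R)"

definition harm_mean :: "'a::cstar_algebra \<Rightarrow> 'a \<Rightarrow> 'a" where
  "harm_mean A B = scaleR 2 (cs_inv (cs_inv A + cs_inv B))"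

definition jordan_star_iso :: "('a::cstar_algebra \<Rightarrow> 'b::cstar_algebra) \<Rightarrow> bool" where
  "jordan_star_iso J \<longleftrightarrow> bij J
     \<and> (\<forall>x y. J (x + y) = J x + J y)
     \<and> (\<forall>c x. J (cscale c x) = cscale c (J x))
     \<and> (\<forall>x. J (cstar x) = cstar (J x))
     \<and> (\<forall>x. J (x * x) = J x * J x)"

definition cs_projection :: "'a::cstar_algebra \<Rightarrow> bool" where
  "cs_projection p \<longleftrightarrow> p * p = p \<and> cstar p = p"

definition AW_star :: "'a::cstar_algebra itself \<Rightarrow> bool" where
  "AW_star _ \<longleftrightarrow> (\<forall>S::'a set. S \<noteq> {} \<longrightarrow>
      (\<exists>P. cs_projection P \<and> {X. \<forall>Y\<in>S. X * Y = 0} = {M * P | M. True}))"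

definition cs_commutative :: "'a::cstar_algebra itself \<Rightarrow> bool" where
  "cs_commutative _ \<longleftrightarrow> (\<forall>x y::'a. x * y = y * x)"

end

theory Submission
  imports Defs
begin

text \<open>
  For positive \<open>X\<close>, the bound \<open>\<parallel>X\<parallel> \<le> t\<close> means \<open>X \<preceq> t\<close>; hence \<open>\<parallel>A + (t - B)\<parallel> \<le> t\<close> holds exactly if \<open>A \<preceq> B\<close>.
  A surjection preserving the norm of the arithmetic mean is therefore an order isomorphism of the cones with
  \<open>\<phi>(t - B) = t - \<phi>(B)\<close>. It extends to an order isomorphism of the selfadjoint parts that commutes with
  translations by scalars, thus to a surjective isometry, which is linear by the Mazur--Ulam argument. The
  harmonic mean reduces to the same statement with reversed order, for \<open>A \<mapsto> \<phi>(A\<^sup>-\<^sup>1)\<^sup>-\<^sup>1\<close>.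

  A map preserving the norm of the geometric mean is a homogeneous order isomorphism, hence an isometry of the
  Thompson metric. The Mazur--Ulam argument with the reflections \<open>X \<mapsto> G X\<^sup>-\<^sup>1 G\<close> shows that it preserves
  geometric means and therefore satisfies \<open>\<phi>(A B A) = \<phi>(A) \<phi>(B) \<phi>(A)\<close>. This identity makes \<open>\<phi>\<close> differentiable at
  the unit with an additive derivative, and \<open>\<phi>\<close> agrees with its derivative.

  In both cases a unital linear order isomorphism of selfadjoint parts arises; being homogeneous on the cone,
  it also preserves the products \<open>A B A\<close>, hence squares.
\<close>

subsection \<open>Involution, inverses and the Neumann series\<close>

text \<open>For the geometric mean, neither additivity nor a derivative is available at the start:
  the norms reveal only the order and the positive scalings. These are exactly the data from which
  the Thompson metric is built, so that metric takes the place of the norm distance. Its midpoints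
  are not unique in general; \<open>geom_mean A B\<close> is singled out by a reflection that swaps
  \<open>A\<close> and \<open>B\<close>, by the Riccati equation, and moves each point by twice its
  distance from the mean. Products \<open>A * B * A\<close> then linearise:
  \<open>(1 + h) * (1 + k) * (1 + h)\<close> is 1 + 2h + k up to second order. Additivity thus holds
  near the unit up to quadratic errors, and halving the argument makes these errors summable.
  Logarithms and exponentials of algebra elements are never formed; iterated square roots replace
  them. Functional calculus is likewise replaced by square roots which commute with everything that
  commutes with the radicand.\<close>

lemma cstar_one [simp]: "cstar (1::'a::cstar_algebra) = 1"
proof -
  have "cstar (1 * cstar (1::'a)) = cstar (cstar 1) * cstar 1"
    by (rule cstar_mult)
  then show ?thesis by (simp add: cstar_cstar)
qed

lemma cstar_scaleR [simp]: "cstar (scaleR r x) = scaleR r (cstar (x::'a::cstar_algebra))"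
  by (metis cscale_of_real cstar_cscale complex_cnj_complex_of_real)

lemma cstar_zero [simp]: "cstar (0::'a::cstar_algebra) = 0"
  using cstar_scaleR[of 0 "0::'a"] by simp

lemma cstar_minus [simp]: "cstar (- x) = - cstar (x::'a::cstar_algebra)"
  using cstar_scaleR[of "-1" x] by simp

lemma cstar_diff: "cstar (x - y) = cstar x - cstar (y::'a::cstar_algebra)"
  using cstar_add[of x "- y"] by simp

lemma cstar_of_real [simp]: "cstar (of_real r :: 'a::cstar_algebra) = of_real r"
  by (simp add: of_real_def)

lemmas cstar_simps = cstar_add cstar_diff cstar_mult cstar_cstar

text \<open>The C*-identity and submultiplicativity bound \<open>norm y\<close> by the norm of its
  adjoint; applying this to the adjoint too gives equality.\<close>

lemma norm_cstar [simp]: "norm (cstar x) = norm (x::'a::cstar_algebra)"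
proof -
  have *: "norm y \<le> norm (cstar y)" for y :: 'a
  proof (cases "y = 0")
    case False
    have "norm y * norm y \<le> norm (cstar y) * norm y"
      using norm_mult_ineq[of "cstar y" y] by (simp add: cstar_identity power2_eq_square)
    then show ?thesis using False by simp
  qed simp
  show ?thesis using *[of x] *[of "cstar x"] by (simp add: cstar_cstar)
qed

lemma bounded_linear_cstar: "bounded_linear (cstar :: 'a::cstar_algebra \<Rightarrow> 'a)"
  by (rule bounded_linear_intro[where K = 1]) (simp_all add: cstar_add)

lemma norm_square_selfadjoint: "cstar a = a \<Longrightarrow> norm (a * a) = (norm (a::'a::cstar_algebra))\<^sup>2"
  using cstar_identity[of a] by simp

lemma of_real_mult_eq_scaleR:
  fixes x :: "'a::real_algebra_1"
  shows "of_real r * x = scaleR r x" "x * of_real r = scaleR r x"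
  by (simp_all add: of_real_def)

lemma cscale_one [simp]: "cscale 1 (x::'a::cstar_algebra) = x"
  using cscale_of_real[of 1 x] by simp

lemma cscale_zero [simp]: "cscale c (0::'a::cstar_algebra) = 0"
  using cscale_add_right[of c "0::'a" 0] by simp

lemma cscale_minus [simp]: "cscale c (- x) = - cscale c (x::'a::cstar_algebra)"
  using cscale_add_right[of c x "- x"] by (simp add: add_eq_0_iff)

lemma cscale_diff: "cscale c (x - y) = cscale c x - cscale c (y::'a::cstar_algebra)"
  using cscale_add_right[of c x "- y"] by simp

lemma cscale_minus_one [simp]: "cscale (- 1) (x::'a::cstar_algebra) = - x"
  using cscale_of_real[of "-1" x] by simp

lemma cscale_scaleR: "cscale c (scaleR r x) = scaleR r (cscale c (x::'a::cstar_algebra))"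
  by (metis cscale_of_real cscale_cscale mult.commute)

lemma cscale_eq_Re_Im: "cscale c x = scaleR (Re c) x + scaleR (Im c) (cscale \<i> (x::'a::cstar_algebra))"
proof -
  have "cscale c x = cscale (of_real (Re c) + of_real (Im c) * \<i>) x"
    using complex_eq[of c] by (simp add: mult.commute)
  then show ?thesis
    by (simp only: cscale_add_left cscale_of_real flip: cscale_cscale)
qed

lemma cs_inv_unique:
  fixes a :: "'a::cstar_algebra"
  assumes "a * b = 1" "b * a = 1"
  shows "cs_inv a = b"
  unfolding cs_inv_def
proof (rule the_equality)
  fix c assume "a * c = 1 \<and> c * a = 1"
  then have "c = (b * a) * c" "b * (a * c) = b" using assms by simp_all
  then show "c = b" by (simp add: mult.assoc)
qed (use assms in simp)

lemma cs_invertibleI: "a * b = 1 \<Longrightarrow> b * a = 1 \<Longrightarrow> cs_invertible a"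
  unfolding cs_invertible_def by blast

lemma
  fixes a :: "'a::cstar_algebra"
  assumes "cs_invertible a"
  shows cs_inv_right: "a * cs_inv a = 1" and cs_inv_left: "cs_inv a * a = 1"
proof -
  obtain b where "a * b = 1" "b * a = 1" using assms cs_invertible_def by blast
  then show "a * cs_inv a = 1" "cs_inv a * a = 1" using cs_inv_unique by metis+
qed

lemma cs_inv_right_assoc: "cs_invertible (a::'a::cstar_algebra) \<Longrightarrow> a * (cs_inv a * x) = x"
  by (metis cs_inv_right mult.assoc mult_1_left)

lemma cs_inv_left_assoc: "cs_invertible (a::'a::cstar_algebra) \<Longrightarrow> cs_inv a * (a * x) = x"
  by (metis cs_inv_left mult.assoc mult_1_left)

lemmas cs_inv_cancel = cs_inv_right cs_inv_left cs_inv_right_assoc cs_inv_left_assoc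

lemma cs_invertible_inv: "cs_invertible (a::'a::cstar_algebra) \<Longrightarrow> cs_invertible (cs_inv a)"
  by (metis cs_inv_right cs_inv_left cs_invertibleI)

lemma cs_inv_inv: "cs_invertible (a::'a::cstar_algebra) \<Longrightarrow> cs_inv (cs_inv a) = a"
  by (metis cs_inv_right cs_inv_left cs_inv_unique)

lemma cs_invertible_mult:
  "cs_invertible (a::'a::cstar_algebra) \<Longrightarrow> cs_invertible b \<Longrightarrow> cs_invertible (a * b)"
  by (rule cs_invertibleI[where b = "cs_inv b * cs_inv a"]) (simp_all add: mult.assoc cs_inv_cancel)

lemma cs_inv_mult:
  "cs_invertible (a::'a::cstar_algebra) \<Longrightarrow> cs_invertible b \<Longrightarrow> cs_inv (a * b) = cs_inv b * cs_inv a"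
  by (rule cs_inv_unique) (simp_all add: mult.assoc cs_inv_cancel)

lemma cs_inv_one [simp]: "cs_inv (1::'a::cstar_algebra) = 1"
  by (rule cs_inv_unique) simp_all

lemma cs_invertible_scaleR:
  "r \<noteq> 0 \<Longrightarrow> cs_invertible a \<Longrightarrow> cs_invertible (scaleR r (a::'a::cstar_algebra))"
  by (rule cs_invertibleI[where b = "scaleR (1 / r) (cs_inv a)"]) (simp_all add: cs_inv_cancel)

lemma cs_inv_scaleR:
  "r \<noteq> 0 \<Longrightarrow> cs_invertible a \<Longrightarrow> cs_inv (scaleR r (a::'a::cstar_algebra)) = scaleR (1 / r) (cs_inv a)"
  by (rule cs_inv_unique) (simp_all add: cs_inv_cancel)

lemma cstar_cs_inv:
  "cs_invertible (a::'a::cstar_algebra) \<Longrightarrow> cs_inv (cstar a) = cstar (cs_inv a)"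
  by (rule cs_inv_unique) (simp_all add: cs_inv_cancel flip: cstar_mult)

lemma cs_inv_commute:
  fixes a :: "'a::cstar_algebra"
  assumes "cs_invertible a" "z * a = a * z"
  shows "z * cs_inv a = cs_inv a * z"
proof -
  have "cs_inv a * (z * a) * cs_inv a = cs_inv a * (a * z) * cs_inv a" using assms by simp
  then show ?thesis using assms(1) by (simp add: mult.assoc cs_inv_cancel)
qed

text \<open>The inverse \<open>c\<close> of the product commutes with both factors, so
  \<open>b * c\<close> is a two-sided inverse of \<open>a\<close>.\<close>

lemma cs_invertible_commuting_factor:
  fixes a :: "'a::cstar_algebra"
  assumes "cs_invertible (a * b)" "a * b = b * a"
  shows "cs_invertible a"
proof -
  let ?c = "cs_inv (a * b)"
  have "a * (b * ?c) = 1" using cs_inv_right[OF assms(1)] by (simp add: mult.assoc)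
  moreover have "a * ?c = ?c * a"
    by (rule cs_inv_commute[OF assms(1)]) (metis assms(2) mult.assoc)
  moreover have "?c * (b * a) = 1" using cs_inv_left[OF assms(1)] assms(2) by simp
  moreover have "b * ?c = ?c * b"
    by (rule cs_inv_commute[OF assms(1)]) (metis assms(2) mult.assoc)
  ultimately show ?thesis by (metis cs_invertibleI mult.assoc)
qed

lemma cs_invertible_one_minus:
  fixes x :: "'a::cstar_algebra"
  assumes "norm x < 1"
  shows "cs_invertible (1 - x)"
proof -
  have s: "summable (\<lambda>n. x ^ n)" by (rule complete_algebra_summable_geometric[OF assms])
  let ?S = "\<Sum>n. x ^ n"
  have "?S = 1 + (\<Sum>n. x ^ Suc n)" using suminf_split_head[OF s] by simp
  moreover have "(\<Sum>n. x ^ Suc n) = x * ?S" using suminf_mult[OF s] by simp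
  moreover have "(\<Sum>n. x ^ Suc n) = ?S * x"
    using suminf_mult2[OF s, of x] by (simp add: power_Suc2 del: power_Suc)
  ultimately have "?S = 1 + x * ?S" "?S = 1 + ?S * x" by simp_all
  then show ?thesis by (intro cs_invertibleI[where b = ?S]) (simp_all add: algebra_simps)
qed

text \<open>Here \<open>a\<close> is \<open>t\<close> times \<open>1 - x\<close> with
  \<open>norm x < 1\<close>, so the Neumann series applies. The non-strict form of the same bound
  defines \<open>norm_pos\<close>.\<close>

lemma cs_invertible_near_of_real:
  fixes a :: "'a::cstar_algebra"
  assumes "norm (of_real t - a) < t"
  shows "cs_invertible a"
proof -
  have t: "t > 0" using assms norm_ge_zero[of "of_real t - a"] by linarith
  have "1 - scaleR (1 / t) (of_real t - a) = scaleR (1 / t) a"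
    using t by (simp add: algebra_simps of_real_def)
  moreover have "norm (scaleR (1 / t) (of_real t - a)) < 1"
    using assms t by (simp del: scaleR_diff_right scaleR_right_diff_distrib)
  ultimately have "cs_invertible (scaleR (1 / t) a)" using cs_invertible_one_minus by metis
  from cs_invertible_scaleR[OF _ this, of t] t show ?thesis by simp
qed

subsection \<open>Square roots and positivity\<close>

text \<open>A limit \<open>y\<close> of this iteration satisfies \<open>(1 - y)\<^sup>2 = 1 - x\<close>; for \<open>\<parallel>x\<parallel> \<le> 1\<close> it is dominated by the
  scalar iteration at \<open>1\<close>.\<close>

primrec sqrt_iter :: "'a::real_normed_algebra_1 \<Rightarrow> nat \<Rightarrow> 'a" where
  "sqrt_iter x 0 = 0"
| "sqrt_iter x (Suc n) = scaleR (1 / 2) (x + sqrt_iter x n * sqrt_iter x n)"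

lemma sqrt_iter_one_bounds: "0 \<le> sqrt_iter (1::real) n \<and> sqrt_iter (1::real) n \<le> 1"
  by (induction n) (auto simp: mult_le_one)

text \<open>No contraction rate is used, so the boundary case \<open>norm x = 1\<close> is included:
  the scalar increments are summable merely because the scalar iteration is monotone and
  bounded.\<close>

lemma sqrt_iter_bounds:
  fixes x :: "'a::real_normed_algebra_1"
  assumes "norm x \<le> 1"
  shows "norm (sqrt_iter x n) \<le> sqrt_iter 1 n"
    and "norm (sqrt_iter x (Suc n) - sqrt_iter x n) \<le> sqrt_iter 1 (Suc n) - sqrt_iter 1 n"
proof -
  have *: "norm (sqrt_iter x n) \<le> sqrt_iter 1 n" for n
  proof (induction n)
    case (Suc n)
    have "norm (sqrt_iter x n * sqrt_iter x n) \<le> sqrt_iter 1 n * sqrt_iter 1 n"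
      by (rule order_trans[OF norm_mult_ineq mult_mono]) (use Suc sqrt_iter_one_bounds in auto)
    then show ?case using assms norm_triangle_ineq[of x "sqrt_iter x n * sqrt_iter x n"] by simp
  qed simp
  show "norm (sqrt_iter x n) \<le> sqrt_iter 1 n" by (rule *)
  show "norm (sqrt_iter x (Suc n) - sqrt_iter x n) \<le> sqrt_iter 1 (Suc n) - sqrt_iter 1 n"
  proof (induction n)
    case 0 then show ?case using assms by simp
  next
    case (Suc n)
    define a b A B where defs: "a = sqrt_iter x (Suc n)" "b = sqrt_iter x n"
      "A = sqrt_iter (1::real) (Suc n)" "B = sqrt_iter (1::real) n"
    have IH: "norm (a - b) \<le> A - B" and AB: "norm a \<le> A" "norm b \<le> B"
      using Suc * unfolding defs by blast+
    \<comment> \<open>This factorisation needs no commutativity, and its scalar counterpart has the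
      same form, so the estimates match term by term.\<close>
    have "a * a - b * b = a * (a - b) + (a - b) * b" by (simp add: algebra_simps)
    also have "norm \<dots> \<le> norm (a * (a - b)) + norm ((a - b) * b)" by (rule norm_triangle_ineq)
    also have "\<dots> \<le> A * (A - B) + (A - B) * B"
      by (intro add_mono order_trans[OF norm_mult_ineq mult_mono] IH AB norm_ge_zero
          order_trans[OF norm_ge_zero IH] order_trans[OF norm_ge_zero AB(1)])
    finally have "norm (a * a - b * b) \<le> A * A - B * B" by (simp add: algebra_simps)
    moreover have "sqrt_iter x (Suc (Suc n)) - sqrt_iter x (Suc n) = scaleR (1/2) (a * a - b * b)"
    proof -
      have "sqrt_iter x (Suc (Suc n)) = scaleR (1/2) (x + a * a)" "sqrt_iter x (Suc n) = scaleR (1/2) (x + b * b)"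
        unfolding defs by simp_all
      then show ?thesis by (simp only: scaleR_add_right scaleR_diff_right) simp
    qed
    moreover have "sqrt_iter (1::real) (Suc (Suc n)) - sqrt_iter 1 (Suc n) = (1/2) * (A * A - B * B)"
    proof -
      have "sqrt_iter (1::real) (Suc (Suc n)) = (1/2) * (1 + A * A)" "sqrt_iter (1::real) (Suc n) = (1/2) * (1 + B * B)"
        unfolding defs by simp_all
      then show ?thesis by (simp only:) (metis add_diff_cancel_left right_diff_distrib)
    qed
    ultimately show ?case by (simp only: norm_scaleR) simp
  qed
qed

lemma sqrt_iter_commute: "z * x = x * z \<Longrightarrow> z * sqrt_iter x n = sqrt_iter x n * z"
proof (induction n)
  case (Suc n)
  then have "z * (sqrt_iter x n * sqrt_iter x n) = sqrt_iter x n * sqrt_iter x n * z"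
    by (metis mult.assoc)
  then show ?case using Suc.prems by (simp add: algebra_simps)
qed simp

lemma sqrt_iter_selfadjoint: "cstar x = x \<Longrightarrow> cstar (sqrt_iter x n) = sqrt_iter (x::'a::cstar_algebra) n"
  by (induction n) (simp_all add: cstar_simps)

text \<open>The bound on \<open>1 - q\<close> makes \<open>q\<close> positive in the norm sense. The
  commutation property holds because the iterates are polynomials in \<open>x\<close>; uniqueness of
  roots will rest on it.\<close>

lemma ex_sqrt_one_minus:
  fixes x :: "'a::cstar_algebra"
  assumes "norm x \<le> 1" "cstar x = x"
  obtains q where "q * q = 1 - x" "norm (1 - q) \<le> 1" "cstar q = q"
    "\<And>z. z * x = x * z \<Longrightarrow> z * q = q * z"
proof -
  have "incseq (sqrt_iter (1::real))"
    using sqrt_iter_bounds(2)[of "1::real"] order_trans[OF norm_ge_zero] by (intro incseq_SucI) fastforce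
  then have "convergent (sqrt_iter (1::real))"
    using sqrt_iter_one_bounds by (intro Bseq_monoseq_convergent BseqI'[where K = 1]) (auto simp: incseq_imp_monoseq)
  then have "summable (\<lambda>n. sqrt_iter (1::real) (Suc n) - sqrt_iter 1 n)"
    unfolding convergent_def using telescope_summable by blast
  then have "summable (\<lambda>n. sqrt_iter x (Suc n) - sqrt_iter x n)"
    by (rule summable_comparison_test'[where N = 0]) (use sqrt_iter_bounds(2)[OF assms(1)] in blast)
  then have "convergent (\<lambda>n. \<Sum>i<n. sqrt_iter x (Suc i) - sqrt_iter x i)"
    by (simp add: summable_iff_convergent)
  then obtain y where y: "sqrt_iter x \<longlonglongrightarrow> y"
    unfolding sum_lessThan_telescope convergent_def by auto
  have "(\<lambda>n. sqrt_iter x (Suc n)) \<longlonglongrightarrow> scaleR (1/2) (x + y * y)"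
    unfolding sqrt_iter.simps by (intro tendsto_intros y)
  then have "y = scaleR (1/2) (x + y * y)"
    using LIMSEQ_Suc[OF y] LIMSEQ_unique by blast
  then have yy: "scaleR 2 y = x + y * y" by (metis scaleR_scaleR scaleR_one divide_self_if mult_numeral_1_right nonzero_mult_div_cancel_left numeral_One times_divide_eq_right zero_neq_numeral)
  have "(1 - y) * (1 - y) = 1 - x"
    using yy by (simp add: algebra_simps scaleR_2)
  moreover have "norm (1 - (1 - y)) \<le> 1"
  proof -
    have "norm (sqrt_iter x n) \<le> 1" for n
      using sqrt_iter_bounds(1)[OF assms(1), of n] sqrt_iter_one_bounds[of n] by linarith
    then have "norm y \<le> 1" using LIMSEQ_le_const2[OF tendsto_norm[OF y]] by blast
    then show ?thesis by simp
  qed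
  moreover have "cstar (1 - y) = 1 - y"
  proof -
    have "(\<lambda>n. cstar (sqrt_iter x n)) \<longlonglongrightarrow> cstar y"
      by (rule bounded_linear.tendsto[OF bounded_linear_cstar y])
    then have "cstar y = y" using sqrt_iter_selfadjoint[OF assms(2)] y LIMSEQ_unique by auto
    then show ?thesis by (simp add: cstar_simps)
  qed
  moreover have "z * (1 - y) = (1 - y) * z" if "z * x = x * z" for z
  proof -
    have "(\<lambda>n. z * sqrt_iter x n) \<longlonglongrightarrow> z * y" "(\<lambda>n. sqrt_iter x n * z) \<longlonglongrightarrow> y * z"
      by (intro tendsto_intros y)+
    then have "z * y = y * z" using sqrt_iter_commute[OF that] LIMSEQ_unique by auto
    then show ?thesis by (simp add: algebra_simps)
  qed
  ultimately show ?thesis using that by blast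
qed

text \<open>Describing positivity by norms instead of spectra makes the closedness and convexity of the positive
  cone accessible without functional calculus.\<close>

definition norm_pos :: "'a::cstar_algebra \<Rightarrow> bool" where
  "norm_pos a \<longleftrightarrow> cstar a = a \<and> (\<exists>t. norm (of_real t - a) \<le> t)"

lemma norm_pos_sa: "norm_pos a \<Longrightarrow> cstar a = a"
  by (simp add: norm_pos_def)

lemma norm_posI: "cstar a = a \<Longrightarrow> norm (of_real t - a) \<le> t \<Longrightarrow> norm_pos a"
  unfolding norm_pos_def by blast

lemma norm_pos_add: "norm_pos a \<Longrightarrow> norm_pos b \<Longrightarrow> norm_pos (a + b)"
proof -
  assume a: "norm_pos a" and b: "norm_pos b"
  obtain s t where "norm (of_real s - a) \<le> s" "norm (of_real t - b) \<le> t"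
    using a b unfolding norm_pos_def by blast
  moreover have "of_real (s + t) - (a + b) = (of_real s - a) + (of_real t - b)" by simp
  ultimately have "norm (of_real (s + t) - (a + b)) \<le> s + t"
    by (metis add_mono norm_triangle_ineq order_trans)
  then show ?thesis using a b by (intro norm_posI[where t = "s + t"]) (auto simp: norm_pos_sa cstar_simps)
qed

lemma norm_pos_scaleR: "norm_pos a \<Longrightarrow> 0 \<le> r \<Longrightarrow> norm_pos (scaleR r a)"
proof -
  assume a: "norm_pos a" and r: "0 \<le> r"
  obtain s where s: "norm (of_real s - a) \<le> s" using a unfolding norm_pos_def by blast
  have "of_real (r * s) - scaleR r a = scaleR r (of_real s - a)"
    by (simp add: scaleR_conv_of_real algebra_simps)
  then have "norm (of_real (r * s) - scaleR r a) \<le> r * s" using s r by (simp add: mult_left_mono)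
  then show ?thesis using a by (intro norm_posI[where t = "r * s"]) (auto simp: norm_pos_sa)
qed

lemma norm_pos_of_real: "0 \<le> r \<Longrightarrow> norm_pos (of_real r)"
  by (rule norm_posI[where t = r]) auto

lemma norm_pos_of_norm_le: "cstar a = a \<Longrightarrow> norm a \<le> r \<Longrightarrow> norm_pos (of_real r - a)"
  by (rule norm_posI[where t = r]) (auto simp: cstar_simps)

lemma norm_pos_ex_sqrt:
  assumes "norm_pos a"
  obtains q where "norm_pos q" "q * q = a" "\<And>z. z * a = a * z \<Longrightarrow> z * q = q * z"
proof -
  obtain s where s: "norm (of_real s - a) \<le> s" using assms unfolding norm_pos_def by blast
  \<comment> \<open>The radius \<open>s\<close> may be zero, when \<open>a\<close> is zero;
    enlarging it permits the rescaling by \<open>1 / t\<close>.\<close>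
  define t where "t = s + 1"
  have "norm (of_real t - a) \<le> norm (of_real s - a) + norm (1::'a)"
    unfolding t_def by (metis add.commute add_diff_eq norm_triangle_ineq of_real_1 of_real_add)
  then have nt: "norm (of_real t - a) \<le> t" and t: "t > 0"
    using s norm_ge_zero[of "of_real s - a"] by (auto simp: t_def simp del: norm_ge_zero)
  define x where "x = scaleR (1 / t) (of_real t - a)"
  have xa: "1 - x = scaleR (1 / t) a" unfolding x_def using t by (simp add: algebra_simps of_real_def)
  have "norm x \<le> 1" "cstar x = x"
    using nt t norm_pos_sa[OF assms] unfolding x_def
    by (simp_all add: cstar_simps del: scaleR_diff_right scaleR_right_diff_distrib)
  then obtain q where q: "q * q = 1 - x" "norm (1 - q) \<le> 1" "cstar q = q"
    "\<And>z. z * x = x * z \<Longrightarrow> z * q = q * z" using ex_sqrt_one_minus by metis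
  have "norm_pos q" using q(2,3) by (intro norm_posI[where t = 1]) auto
  then have "norm_pos (scaleR (sqrt t) q)" using t by (intro norm_pos_scaleR) auto
  moreover have "scaleR (sqrt t) q * scaleR (sqrt t) q = a"
    using q(1) t xa by simp
  moreover have "z * scaleR (sqrt t) q = scaleR (sqrt t) q * z" if "z * a = a * z" for z
  proof -
    have "z * x = x * z" using that by (simp add: x_def algebra_simps of_real_mult_eq_scaleR)
    then show ?thesis using q(4) by simp
  qed
  ultimately show ?thesis using that by blast
qed

text \<open>\<open>q + \<i> a\<close> is a multiple of a unitary, and \<open>a\<close> is its imaginary part.\<close>

lemma norm_le_of_square_sum:
  fixes a :: "'a::cstar_algebra"
  assumes "cstar a = a" "cstar q = q" "a * q = q * a" "a * a + q * q = of_real (r\<^sup>2)" "0 \<le> r"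
  shows "norm a \<le> r"
proof -
  define u where "u = q + cscale \<i> a"
  have su: "cstar u = q - cscale \<i> a"
    using assms cscale_cscale[of "-1" \<i> a] by (simp add: u_def cstar_simps cstar_cscale)
  have "cscale \<i> (cscale \<i> (a * a)) = - (a * a)" by (simp add: cscale_cscale)
  then have "cstar u * u = a * a + q * q"
    unfolding su unfolding u_def using assms(3)
    by (simp add: algebra_simps cscale_mult_left cscale_mult_right cscale_diff)
  then have "(norm u)\<^sup>2 = r\<^sup>2"
    using assms(4) cstar_identity[of u] norm_of_real[of "r\<^sup>2", where 'a = 'a] by simp
  then have nu: "norm u = r" using assms(5) by simp
  have "u - cstar u = scaleR 2 (cscale \<i> a)" unfolding su unfolding u_def by (simp add: scaleR_2)
  then have "2 * norm a = norm (u - cstar u)" by (simp add: norm_cscale)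
  also have "\<dots> \<le> norm u + norm (cstar u)" by (rule norm_triangle_ineq4)
  finally show ?thesis using nu by simp
qed

text \<open>After rescaling \<open>b\<close> to \<open>c\<close>, a root \<open>q\<close> of
  \<open>1 - c * c\<close> commutes with \<open>c\<close>, and their squares sum to one. Hence
  \<open>norm q \<le> 1\<close>, and \<open>norm (1 - c * c) \<le> 1\<close> is the required bound.
  The 1 added in \<open>t\<close> covers \<open>b = 0\<close>.\<close>

lemma norm_pos_square:
  fixes b :: "'a::cstar_algebra"
  assumes "cstar b = b"
  shows "norm_pos (b * b)"
proof -
  define t where "t = (norm b)\<^sup>2 + 1"
  have t: "t > 0" unfolding t_def by (simp add: add_nonneg_pos)
  define c where "c = scaleR (1 / sqrt t) b"
  have sc: "cstar c = c" using assms by (simp add: c_def)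
  have cc: "c * c = scaleR (1 / t) (b * b)" using t by (simp add: c_def)
  have "norm (c * c) \<le> 1" using norm_square_selfadjoint[OF assms] t by (simp add: cc t_def)
  moreover have "cstar (c * c) = c * c" using sc by (simp add: cstar_simps)
  ultimately obtain q where q: "q * q = 1 - c * c" "cstar q = q"
    "\<And>z. z * (c * c) = c * c * z \<Longrightarrow> z * q = q * z" using ex_sqrt_one_minus by metis
  have "c * q = q * c" by (rule q(3)) (simp add: mult.assoc)
  then have "norm q \<le> 1"
    using q(1,2) sc by (intro norm_le_of_square_sum[of q c 1]) auto
  then have "norm (1 - c * c) \<le> 1"
    using norm_square_selfadjoint[OF q(2)] q(1) by (simp add: power_le_one)
  moreover have "of_real t - b * b = scaleR t (1 - c * c)"
    using t by (simp add: cc algebra_simps of_real_def)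
  ultimately have "norm (of_real t - b * b) \<le> t" using t by simp
  then show ?thesis using assms by (intro norm_posI) (auto simp: cstar_simps)
qed

text \<open>The roots of \<open>a\<close> and \<open>b\<close> commute by their commutation
  property, so the product is the square of a selfadjoint element.\<close>

lemma norm_pos_mult_commuting:
  assumes "norm_pos a" "norm_pos b" "a * b = b * a"
  shows "norm_pos (a * b)"
proof -
  obtain p where p: "norm_pos p" "p * p = a" "\<And>z. z * a = a * z \<Longrightarrow> z * p = p * z"
    using norm_pos_ex_sqrt[OF assms(1)] by blast
  obtain q where q: "norm_pos q" "q * q = b" "\<And>z. z * b = b * z \<Longrightarrow> z * q = q * z"
    using norm_pos_ex_sqrt[OF assms(2)] by blast
  have "p * q = q * p" using p(3)[of b] q(3)[of p] assms(3) by simp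
  then have "cstar (p * q) = p * q"
    using p(1) q(1) norm_pos_sa by (metis cstar_mult)
  moreover have "(p * q) * (p * q) = a * b"
    using p(2) q(2) \<open>p * q = q * p\<close> by (metis mult.assoc)
  ultimately show ?thesis using norm_pos_square[of "p * q"] by simp
qed

text \<open>The commuting product of \<open>r - a\<close> and \<open>r + a\<close> is positive; its
  root \<open>q\<close> satisfies the circle equation of
  \<open>norm_le_of_square_sum\<close>.\<close>

lemma norm_le_of_norm_pos:
  assumes "cstar a = a" "norm_pos (of_real r - a)" "norm_pos (of_real r + a)" "0 \<le> r"
  shows "norm a \<le> r"
proof -
  have "norm_pos ((of_real r - a) * (of_real r + a))"
    by (rule norm_pos_mult_commuting) (use assms in \<open>auto simp: algebra_simps of_real_mult_eq_scaleR\<close>)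
  moreover have "(of_real r - a) * (of_real r + a) = of_real (r\<^sup>2) - a * a"
    by (simp add: algebra_simps power2_eq_square of_real_mult_eq_scaleR)
  ultimately have "norm_pos (of_real (r\<^sup>2) - a * a)" by simp
  then obtain q where q: "norm_pos q" "q * q = of_real (r\<^sup>2) - a * a"
    "\<And>z. z * (of_real (r\<^sup>2) - a * a) = (of_real (r\<^sup>2) - a * a) * z \<Longrightarrow> z * q = q * z"
    by (rule norm_pos_ex_sqrt) blast
  have "a * q = q * a" by (rule q(3)) (simp add: algebra_simps of_real_mult_eq_scaleR del: of_real_power)
  then show ?thesis using assms q(1,2) norm_pos_sa by (intro norm_le_of_square_sum[of a q]) auto
qed

text \<open>The radius hidden in \<open>norm_pos\<close> may be replaced by any bound on the norm. A
  bounded family therefore admits a common radius, which is what closedness needs.\<close>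

lemma norm_pos_norm_bound:
  assumes "norm_pos a" "norm a \<le> t"
  shows "norm (of_real t - a) \<le> t"
proof (rule norm_le_of_norm_pos)
  have t: "0 \<le> t" using assms(2) norm_ge_zero order_trans by blast
  then show "0 \<le> t" .
  show "cstar (of_real t - a) = of_real t - a" using norm_pos_sa[OF assms(1)] by (simp add: cstar_simps)
  show "norm_pos (of_real t - (of_real t - a))" using assms by simp
  have "norm_pos (of_real t + (of_real t - a))"
    by (intro norm_pos_add norm_pos_of_real t norm_pos_of_norm_le norm_pos_sa assms)
  then show "norm_pos (of_real t + (of_real t - a))" .
qed

lemma norm_pos_closed:
  fixes a :: "nat \<Rightarrow> 'a::cstar_algebra"
  assumes "\<And>n. norm_pos (a n)" "a \<longlonglongrightarrow> x"
  shows "norm_pos x"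
proof -
  obtain t where t: "\<And>n. norm (a n) \<le> t"
    using convergent_imp_Bseq[of a] assms(2) unfolding convergent_def Bseq_def by blast
  have "norm (of_real t - x) \<le> t"
    by (rule LIMSEQ_le_const2[OF tendsto_norm[OF tendsto_diff[OF tendsto_const assms(2)]]])
      (use norm_pos_norm_bound[OF assms(1) t] in blast)
  moreover have "(\<lambda>n. cstar (a n)) \<longlonglongrightarrow> cstar x"
    by (rule bounded_linear.tendsto[OF bounded_linear_cstar assms(2)])
  then have "cstar x = x" using norm_pos_sa[OF assms(1)] assms(2) LIMSEQ_unique by auto
  ultimately show ?thesis by (intro norm_posI)
qed

section \<open>Norm positivity, invertibility and the spectrum\<close>

lemma norm_pos_plus_invertible:
  assumes "norm_pos a" "0 < s"
  shows "cs_invertible (a + of_real s)"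
proof -
  obtain t where "norm (of_real t - a) \<le> t" using assms(1) unfolding norm_pos_def by blast
  then have "norm (of_real (t + s) - (a + of_real s)) < t + s" using assms(2) by simp
  then show ?thesis by (rule cs_invertible_near_of_real)
qed

text \<open>For small \<open>e\<close> the factorisation
  \<open>c - e = c * (1 - e * cs_inv c)\<close> is a commuting product of positive elements.\<close>

lemma norm_pos_invertible_ge:
  assumes "norm_pos c" "cs_invertible c"
  obtains e where "0 < e" "norm_pos (c - of_real e)"
proof -
  define e where "e = 1 / (norm (cs_inv c) + 1)"
  have e: "0 < e" "e * norm (cs_inv c) \<le> 1"
    using norm_ge_zero[of "cs_inv c"] unfolding e_def
    by (simp_all add: add_nonneg_pos divide_le_eq_1 del: norm_ge_zero)
  have "cstar (cs_inv c) = cs_inv c" using cstar_cs_inv[OF assms(2)] norm_pos_sa[OF assms(1)] by simp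
  then have "norm_pos (of_real 1 - scaleR e (cs_inv c))"
    using e by (intro norm_pos_of_norm_le) auto
  then have "norm_pos (c * (1 - scaleR e (cs_inv c)))"
    using assms by (intro norm_pos_mult_commuting) (auto simp: algebra_simps cs_inv_cancel)
  moreover have "c * (1 - scaleR e (cs_inv c)) = c - of_real e"
    using assms(2) by (simp add: algebra_simps cs_inv_cancel of_real_def)
  ultimately show ?thesis using that e by simp
qed

text \<open>Let \<open>s0\<close> be the least shift making \<open>a\<close> positive, attained by
  closedness. If \<open>s0\<close> were positive, the shifted element would be positive and
  invertible, hence bounded below by a positive scalar, and a smaller shift would do.\<close>

lemma norm_pos_of_invertible:
  fixes a :: "'a::cstar_algebra"
  assumes sa: "cstar a = a" and inv: "\<And>s. 0 < s \<Longrightarrow> cs_invertible (a + of_real s)"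
  shows "norm_pos a"
proof -
  define S where "S = {s. 0 \<le> s \<and> norm_pos (a + of_real s)}"
  define s0 where "s0 = Inf S"
  have "norm_pos (of_real (norm a) - (- a))" using sa by (intro norm_pos_of_norm_le) auto
  then have "norm a \<in> S" by (simp add: S_def add.commute)
  then have ne: "S \<noteq> {}" by blast
  have bdd: "bdd_below S" unfolding S_def by (auto intro: bdd_belowI[where m = 0])
  have s0: "0 \<le> s0" unfolding s0_def using ne by (intro cInf_greatest) (auto simp: S_def)
  have up: "norm_pos (a + of_real (s0 + e))" if e: "0 < e" for e
  proof -
    obtain s where s: "s \<in> S" "s < s0 + e" using cInf_lessD[OF ne, of "s0 + e"] e by (auto simp: s0_def)
    have "norm_pos ((a + of_real s) + of_real (s0 + e - s))"
      by (rule norm_pos_add[OF _ norm_pos_of_real]) (use s in \<open>auto simp: S_def\<close>)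
    then show ?thesis by simp
  qed
  have "norm_pos (a + of_real s0)"
  proof (rule norm_pos_closed)
    show "norm_pos (a + of_real (s0 + 1 / real (Suc n)))" for n by (rule up) simp
    have "(\<lambda>n. s0 + 1 / real (Suc n)) \<longlonglongrightarrow> s0 + 0"
      using LIMSEQ_inverse_real_of_nat by (intro tendsto_intros) (simp add: inverse_eq_divide)
    from tendsto_add[OF tendsto_const tendsto_of_real[OF this]]
    show "(\<lambda>n. a + of_real (s0 + 1 / real (Suc n))) \<longlonglongrightarrow> a + of_real s0" by simp
  qed
  moreover have "s0 = 0"
  proof (rule ccontr)
    assume "s0 \<noteq> 0"
    then have s0': "0 < s0" using s0 by simp
    obtain e where e: "0 < e" "norm_pos (a + of_real s0 - of_real e)"
      using norm_pos_invertible_ge[OF \<open>norm_pos (a + of_real s0)\<close> inv[OF s0']] by blast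
    \<comment> \<open>The minimum keeps \<open>s0 - d\<close> nonnegative, as membership in
      \<open>S\<close> demands.\<close>
    define d where "d = min e s0"
    have "norm_pos ((a + of_real s0 - of_real e) + of_real (e - d))"
      by (rule norm_pos_add[OF _ norm_pos_of_real]) (use e in \<open>auto simp: d_def\<close>)
    then have "s0 - d \<in> S" by (simp add: S_def d_def add_diff_eq)
    then have "s0 \<le> s0 - d" unfolding s0_def using bdd by (rule cInf_lower)
    then show False using e s0' by (simp add: d_def)
  qed
  ultimately show ?thesis by simp
qed

text \<open>With \<open>b\<close> the shifted selfadjoint element and \<open>c\<close> the imaginary
  scalar, \<open>(b - c) * (b + c)\<close> is a square plus a positive scalar.\<close>

lemma selfadjoint_minus_complex_invertible:
  fixes a :: "'a::cstar_algebra"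
  assumes "cstar a = a" "Im z \<noteq> 0"
  shows "cs_invertible (a - cscale z 1)"
proof -
  define b where "b = a - of_real (Re z)"
  define c where "c = scaleR (Im z) (cscale \<i> (1::'a))"
  have sb: "cstar b = b" using assms by (simp add: b_def cstar_simps)
  have az: "a - cscale z 1 = b - c"
    using cscale_eq_Re_Im[of z "1::'a"] by (simp add: b_def c_def of_real_def)
  have bc: "b * c = c * b" by (simp add: c_def cscale_mult_left cscale_mult_right)
  have cc: "c * c = - of_real ((Im z)\<^sup>2)"
    unfolding c_def
    by (simp add: cscale_scaleR cscale_mult_left cscale_mult_right cscale_cscale power2_eq_square of_real_def)
  have "(b - c) * (b + c) = b * b - c * c" using bc by (simp add: algebra_simps)
  then have prod: "(b - c) * (b + c) = b * b + of_real ((Im z)\<^sup>2)" by (simp add: cc)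
  have "(b + c) * (b - c) = b * b - c * c" using bc by (simp add: algebra_simps)
  then have "(b - c) * (b + c) = (b + c) * (b - c)" using prod by (simp add: cc)
  moreover have "cs_invertible (b * b + of_real ((Im z)\<^sup>2))"
    using assms(2) by (intro norm_pos_plus_invertible norm_pos_square sb) simp
  ultimately show ?thesis unfolding az
    using cs_invertible_commuting_factor[of "b - c" "b + c"] prod by simp
qed

text \<open>Forward, only the absence of negative real spectral points enters. Backward,
  selfadjointness excludes nonreal points and \<open>norm_pos_plus_invertible\<close> excludes
  negative ones.\<close>

lemma cs_positive_iff_norm_pos: "cs_positive a \<longleftrightarrow> norm_pos a"
proof
  assume a: "cs_positive a"
  show "norm_pos a"
  proof (rule norm_pos_of_invertible)
    show "cstar a = a" using a by (simp add: cs_positive_def)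
    fix s :: real assume "0 < s"
    have "complex_of_real (- s) \<notin> cs_spectrum a"
      using a \<open>0 < s\<close> unfolding cs_positive_def by force
    then have "cs_invertible (a - cscale (complex_of_real (- s)) 1)"
      unfolding cs_spectrum_def by blast
    then show "cs_invertible (a + of_real s)" by (simp only: cscale_of_real) (simp add: of_real_def)
  qed
next
  assume a: "norm_pos a"
  have "Im z = 0 \<and> 0 \<le> Re z" if z: "z \<in> cs_spectrum a" for z
  proof -
    have n: "\<not> cs_invertible (a - cscale z 1)" using z by (simp add: cs_spectrum_def)
    then have i: "Im z = 0" using selfadjoint_minus_complex_invertible norm_pos_sa[OF a] by blast
    then have "a - cscale z 1 = a + of_real (- Re z)"
      using cscale_eq_Re_Im[of z "1::'a"] by (simp add: of_real_def)
    then show ?thesis using n i norm_pos_plus_invertible[OF a, of "- Re z"] by (cases "0 \<le> Re z") auto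
  qed
  then show "cs_positive a" using norm_pos_sa[OF a] unfolding cs_positive_def by blast
qed

subsection \<open>The order of selfadjoint elements\<close>

definition cs_le :: "'a::cstar_algebra \<Rightarrow> 'a \<Rightarrow> bool" (infix "\<preceq>" 50) where
  "a \<preceq> b \<longleftrightarrow> cs_positive (b - a)"

lemma cs_positive_sa: "cs_positive a \<Longrightarrow> cstar a = a"
  by (simp add: cs_positive_def)

lemmas cs_positive_add = norm_pos_add[folded cs_positive_iff_norm_pos]
lemmas cs_positive_scaleR = norm_pos_scaleR[folded cs_positive_iff_norm_pos]
lemmas cs_positive_of_real = norm_pos_of_real[folded cs_positive_iff_norm_pos]
lemmas cs_positive_of_norm_le = norm_pos_of_norm_le[folded cs_positive_iff_norm_pos]
lemmas cs_positive_ex_sqrt = norm_pos_ex_sqrt[folded cs_positive_iff_norm_pos]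
lemmas cs_positive_square = norm_pos_square[folded cs_positive_iff_norm_pos]
lemmas cs_positive_mult_commuting = norm_pos_mult_commuting[folded cs_positive_iff_norm_pos]
lemmas cs_positive_closed = norm_pos_closed[folded cs_positive_iff_norm_pos]
lemmas cs_positive_plus_invertible = norm_pos_plus_invertible[folded cs_positive_iff_norm_pos]
lemmas cs_positive_of_invertible = norm_pos_of_invertible[folded cs_positive_iff_norm_pos]

lemma cs_positive_zero [simp]: "cs_positive 0" and cs_positive_one [simp]: "cs_positive 1"
  using cs_positive_of_real[of 0] cs_positive_of_real[of 1] by simp_all

lemma cs_le_refl [simp]: "a \<preceq> a"
  by (simp add: cs_le_def)

lemma cs_le_trans: "a \<preceq> b \<Longrightarrow> b \<preceq> c \<Longrightarrow> a \<preceq> c"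
  unfolding cs_le_def using cs_positive_add[of "b - a" "c - b"] by simp

lemma cs_le_add: "a \<preceq> b \<Longrightarrow> c \<preceq> d \<Longrightarrow> a + c \<preceq> b + d"
  unfolding cs_le_def using cs_positive_add[of "b - a" "d - c"] by (simp add: algebra_simps)

lemma cs_le_add_right_iff [simp]: "a + c \<preceq> b + c \<longleftrightarrow> a \<preceq> b"
  and cs_le_diff_right_iff [simp]: "a - c \<preceq> b - c \<longleftrightarrow> a \<preceq> b"
  by (simp_all add: cs_le_def)

lemma cs_le_scaleR: "a \<preceq> b \<Longrightarrow> 0 \<le> r \<Longrightarrow> scaleR r a \<preceq> scaleR r b"
  unfolding cs_le_def using cs_positive_scaleR[of "b - a" r] by (simp add: algebra_simps)

lemma cs_le_scaleR_iff: "0 < r \<Longrightarrow> scaleR r a \<preceq> scaleR r b \<longleftrightarrow> a \<preceq> b"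
  using cs_le_scaleR[of a b r] cs_le_scaleR[of "scaleR r a" "scaleR r b" "1 / r"] by auto

lemma cs_le_of_real: "r \<le> s \<Longrightarrow> of_real r \<preceq> of_real s"
  unfolding cs_le_def using cs_positive_of_real[of "s - r"] by simp

lemma cs_le_closed:
  "(\<And>n. a n \<preceq> b n) \<Longrightarrow> a \<longlonglongrightarrow> x \<Longrightarrow> b \<longlonglongrightarrow> y \<Longrightarrow> x \<preceq> y"
  unfolding cs_le_def using cs_positive_closed[of "\<lambda>n. b n - a n"] tendsto_diff by blast

lemma norm_le_iff_cs_le:
  assumes "cstar a = a" "0 \<le> r"
  shows "norm a \<le> r \<longleftrightarrow> a \<preceq> of_real r \<and> - of_real r \<preceq> a"
proof
  assume "norm a \<le> r"
  then show "a \<preceq> of_real r \<and> - of_real r \<preceq> a"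
    using cs_positive_of_norm_le[of a r] cs_positive_of_norm_le[of "- a" r] assms
    by (simp add: cs_le_def add.commute)
next
  assume "a \<preceq> of_real r \<and> - of_real r \<preceq> a"
  then show "norm a \<le> r" using norm_le_of_norm_pos[of a r] assms
    by (simp add: cs_le_def cs_positive_iff_norm_pos add.commute)
qed

lemma cs_le_of_real_norm: "cstar a = a \<Longrightarrow> a \<preceq> of_real (norm a)"
  and cs_le_minus_of_real_norm: "cstar a = a \<Longrightarrow> - of_real (norm a) \<preceq> a"
  using norm_le_iff_cs_le[of a "norm a"] by auto

lemma cs_positive_norm_le_iff:
  assumes "cs_positive a" "0 \<le> r"
  shows "norm a \<le> r \<longleftrightarrow> a \<preceq> of_real r"
proof -
  have "- of_real r \<preceq> a"
    using cs_positive_add[OF assms(1) cs_positive_of_real[OF assms(2)]] by (simp add: cs_le_def)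
  then show ?thesis using norm_le_iff_cs_le[OF cs_positive_sa[OF assms(1)] assms(2)] by simp
qed

lemma cs_positive_norm_mono: "cs_positive a \<Longrightarrow> a \<preceq> b \<Longrightarrow> norm a \<le> norm b"
proof -
  assume a: "cs_positive a" and ab: "a \<preceq> b"
  have "cs_positive b" using cs_positive_add[OF a, of "b - a"] ab by (simp add: cs_le_def)
  then show ?thesis
    using cs_positive_norm_le_iff[OF a, of "norm b"] cs_le_trans[OF ab cs_le_of_real_norm]
    by (simp add: cs_positive_sa)
qed

lemma cs_le_antisym: 
  assumes "a \<preceq> b" "b \<preceq> a"
  shows "a = b"
proof -
  have p: "cs_positive (b - a)" using assms(1) by (simp add: cs_le_def)
  have "b - a \<preceq> of_real 0" using assms(2) by (simp add: cs_le_def)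
  then have "norm (b - a) \<le> 0" using cs_positive_norm_le_iff[OF p, of 0] by simp
  then show ?thesis by simp
qed

section \<open>Uniqueness of roots, orthogonal decomposition and positivity of
  \<open>cstar y * y\<close>\<close>

lemma selfadjoint_cube_eq_zero:
  fixes a :: "'a::cstar_algebra"
  assumes "cstar a = a" "a * a * a = 0"
  shows "a = 0"
proof -
  have "norm ((a * a) * (a * a)) = (norm a ^ 2) ^ 2"
    using norm_square_selfadjoint[of "a * a"] norm_square_selfadjoint[OF assms(1)] assms(1)
    by (simp add: cstar_simps)
  moreover have "(a * a) * (a * a) = 0" using assms(2) by (metis mult.assoc mult_zero_left)
  ultimately show ?thesis by simp
qed

text \<open>With \<open>d = x - y\<close>, the elements \<open>d * d * x\<close> and
  \<open>d * d * y\<close> are positive and add up to zero, so both vanish. Their difference is the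
  cube of \<open>d\<close>.\<close>

lemma cs_sqrt_unique:
  assumes "cs_positive x" "cs_positive y" "x * x = y * y" "x * y = y * x"
  shows "x = y"
proof -
  define d where "d = x - y"
  have sd: "cstar d = d" using assms by (simp add: d_def cstar_simps cs_positive_sa)
  have dx: "d * x = x * d" and dy: "d * y = y * d" using assms(4) by (simp_all add: d_def algebra_simps)
  have "d * d * x = x * (d * d)" "d * d * y = y * (d * d)" using dx dy by (metis mult.assoc)+
  then have px: "cs_positive (d * d * x)" and py: "cs_positive (d * d * y)"
    using assms(1,2) sd by (simp_all add: cs_positive_mult_commuting cs_positive_square)
  have "d * (x + y) = 0" using assms(3,4) by (simp add: d_def algebra_simps)
  then have "d * d * x + d * d * y = 0" by (metis distrib_left mult.assoc mult_zero_right)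
  then have "d * d * x = 0"
    using px py cs_le_antisym[of "d * d * x" 0] by (simp add: cs_le_def add_eq_0_iff)
  moreover have "d * d * y = 0" using \<open>d * d * x + d * d * y = 0\<close> calculation by simp
  ultimately have "d * d * d = 0" by (simp add: d_def right_diff_distrib)
  then show ?thesis using selfadjoint_cube_eq_zero[OF sd] by (simp add: d_def)
qed

text \<open>Any positive root commutes with its square, hence with the constructed root
  \<open>q\<close>; thus \<open>cs_sqrt_unique\<close> applies and the description in
  \<open>cs_sqrt\<close> is well defined.\<close>

lemma
  assumes "cs_positive a"
  shows cs_positive_cs_sqrt: "cs_positive (cs_sqrt a)"
    and cs_sqrt_square: "cs_sqrt a * cs_sqrt a = a"
    and cs_sqrt_commute: "z * a = a * z \<Longrightarrow> z * cs_sqrt a = cs_sqrt a * z"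
    and cs_sqrt_eqI: "cs_positive x \<Longrightarrow> x * x = a \<Longrightarrow> cs_sqrt a = x"
proof -
  obtain q where q: "cs_positive q" "q * q = a" "\<And>z. z * a = a * z \<Longrightarrow> z * q = q * z"
    using cs_positive_ex_sqrt[OF assms] by blast
  have u: "x = q" if "cs_positive x \<and> x * x = a" for x
  proof (rule cs_sqrt_unique)
    show "x * q = q * x" using that by (intro q(3)) (metis mult.assoc)
  qed (use that q(1,2) in auto)
  have sq: "cs_sqrt a = q" unfolding cs_sqrt_def by (rule the_equality[OF _ u]) (simp_all add: q(1,2))
  show "cs_positive (cs_sqrt a)" "cs_sqrt a * cs_sqrt a = a" using q(1,2) by (simp_all add: sq)
  show "z * a = a * z \<Longrightarrow> z * cs_sqrt a = cs_sqrt a * z" unfolding sq by (rule q(3))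
  show "cs_positive x \<Longrightarrow> x * x = a \<Longrightarrow> cs_sqrt a = x" using u by (simp add: sq)
qed

text \<open>With \<open>c = |a|\<close> and \<open>e = c + a\<close> one has \<open>e\<^sup>2 = 2 c e\<close>, hence
  \<open>(e + s) (e - 2 c - s) = - s (2 c + s)\<close>, which shows that \<open>e + s\<close> is invertible.\<close>

lemma cs_positive_abs_plus:
  fixes a :: "'a::cstar_algebra"
  assumes "cstar a = a" "cs_positive c" "c * c = a * a" "a * c = c * a"
  shows "cs_positive (c + a)"
proof (rule cs_positive_of_invertible)
  show "cstar (c + a) = c + a" using assms cs_positive_sa by (simp add: cstar_simps)
  fix s :: real assume s: "0 < s"
  define e where "e = c + a"
  have ec: "e * c = c * e" using assms(4) by (simp add: e_def algebra_simps)
  have ee: "e * e = scaleR 2 (c * e)"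
    using assms(3,4) by (simp add: e_def algebra_simps scaleR_2)
  have p: "(e + of_real s) * (e - scaleR 2 c - of_real s) = - scaleR s (scaleR 2 c + of_real s)"
    "(e - scaleR 2 c - of_real s) * (e + of_real s) = - scaleR s (scaleR 2 c + of_real s)"
    using ee ec by (simp_all add: algebra_simps of_real_mult_eq_scaleR)
  have "cs_invertible (scaleR (- s) (scaleR 2 c + of_real s))"
    using s assms(2) by (intro cs_invertible_scaleR cs_positive_plus_invertible cs_positive_scaleR) auto
  then show "cs_invertible (c + a + of_real s)"
    unfolding e_def[symmetric] using cs_invertible_commuting_factor[OF _ p(1)[folded p(2)]] p(1) by simp
qed

text \<open>The parts are half of |a| + a and half of |a| - a; they annihilate each other because
  |a| commutes with \<open>a\<close> and has the same square.\<close>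

lemma ex_positive_negative_part:
  fixes a :: "'a::cstar_algebra"
  assumes "cstar a = a"
  obtains p n where "cs_positive p" "cs_positive n" "a = p - n" "p * n = 0" "n * p = 0"
proof -
  define c where "c = cs_sqrt (a * a)"
  have aa: "cs_positive (a * a)" using assms by (rule cs_positive_square)
  have c: "cs_positive c" "c * c = a * a" "a * c = c * a"
    unfolding c_def using cs_positive_cs_sqrt[OF aa] cs_sqrt_square[OF aa] cs_sqrt_commute[OF aa, of a]
    by (simp_all add: mult.assoc)
  define p where "p = scaleR (1/2) (c + a)"
  define n where "n = scaleR (1/2) (c - a)"
  have "cs_positive (c + a)" "cs_positive (c - a)"
    using assms c cs_positive_abs_plus[of a c] cs_positive_abs_plus[of "- a" c] by simp_all
  then have "cs_positive p" "cs_positive n"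
    unfolding p_def n_def by (auto intro!: cs_positive_scaleR)
  moreover have "a = p - n"
  proof -
    have "p - n = scaleR (1/2) (scaleR 2 a)" unfolding p_def n_def scaleR_diff_right[symmetric] by (simp add: scaleR_2)
    then show ?thesis by simp
  qed
  moreover have "p * n = 0" "n * p = 0" using c unfolding p_def n_def by (simp_all add: algebra_simps)
  ultimately show ?thesis using that by blast
qed

text \<open>Jacobson's identity: if \<open>c\<close> inverts \<open>s - x * y\<close>, then
  \<open>(1 + y * c * x) / s\<close> inverts \<open>s - y * x\<close>, as the formal geometric
  series suggests.\<close>

lemma cs_invertible_swap:
  fixes x :: "'a::cstar_algebra"
  assumes "cs_invertible (of_real s - x * y)" "s \<noteq> 0"
  shows "cs_invertible (of_real s - y * x)"
proof -
  define c where "c = cs_inv (of_real s - x * y)"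
  have "(of_real s - x * y) * c = 1" "c * (of_real s - x * y) = 1"
    unfolding c_def using assms(1) by (simp_all add: cs_inv_cancel)
  then have c: "x * y * c = scaleR s c - 1" "c * (x * y) = scaleR s c - 1"
    by (simp_all add: algebra_simps of_real_mult_eq_scaleR)
  have c': "y * x * y * c * x = y * (scaleR s c - 1) * x" "y * c * x * y * x = y * (scaleR s c - 1) * x"
    by (metis c(1) mult.assoc) (metis c(2) mult.assoc)
  have "(of_real s - y * x) * (1 + y * c * x) = of_real s" "(1 + y * c * x) * (of_real s - y * x) = of_real s"
    using c' by (simp_all add: algebra_simps of_real_mult_eq_scaleR mult.assoc) (simp add: of_real_def)
  then show ?thesis
    using assms(2) by (intro cs_invertibleI[where b = "scaleR (1 / s) (1 + y * c * x)"])
      (simp_all del: scaleR_right_distrib scaleR_add_right add: of_real_def)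
qed

text \<open>For the negative part \<open>n\<close> and \<open>z = y * n\<close>, the element
  \<open>cstar z * z\<close> is minus the cube of \<open>n\<close>. By
  \<open>cs_invertible_swap\<close> also \<open>- (z * cstar z)\<close> is positive. But the sum of
  the two products of \<open>z\<close> with its adjoint is positive, so the cube is both positive
  and negative, hence zero.\<close>

theorem cs_positive_cstar_mult_self: "cs_positive (cstar y * y)"
proof -
  define a where "a = cstar y * y"
  have sa: "cstar a = a" by (simp add: a_def cstar_simps)
  obtain p n where pn: "cs_positive p" "cs_positive n" "a = p - n" "p * n = 0" "n * p = 0"
    using ex_positive_negative_part[OF sa] by blast
  have sn: "cstar n = n" using pn cs_positive_sa by blast
  define z where "z = y * n"
  have zz: "cstar z * z = - (n * n * n)"
  proof -
    have "cstar z * z = n * a * n" by (simp add: z_def a_def sn cstar_simps mult.assoc)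
    then show ?thesis using pn(4,5) by (simp add: pn(3) algebra_simps)
  qed
  have n3: "cs_positive (n * n * n)"
    using pn(2) sn by (intro cs_positive_mult_commuting cs_positive_square) (auto simp: mult.assoc)
  have "cs_positive (- (z * cstar z))"
  proof (rule cs_positive_of_invertible)
    show "cstar (- (z * cstar z)) = - (z * cstar z)" by (simp add: cstar_simps)
    fix s :: real assume s: "0 < s"
    have "cs_invertible (of_real s - cstar z * z)"
      using cs_positive_plus_invertible[OF n3 s] by (simp add: zz add.commute)
    then have "cs_invertible (of_real s - z * cstar z)" by (rule cs_invertible_swap) (use s in simp)
    then show "cs_invertible (- (z * cstar z) + of_real s)" by (simp add: add.commute)
  qed
  moreover have "cs_positive (cstar z * z + z * cstar z)"
  proof -
    \<comment> \<open>Up to sign, \<open>b\<close> and \<open>d\<close> are twice the real and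
      imaginary parts of \<open>z\<close>; in the sum of their squares the terms
      \<open>z * z\<close> and \<open>cstar z * cstar z\<close> cancel.\<close>
    define b where "b = z + cstar z"
    define d where "d = cscale \<i> (z - cstar z)"
    have "cstar b = b" by (simp add: b_def cstar_simps add.commute)
    moreover have "cstar d = d"
      using cscale_cscale[of "-1" \<i> "cstar z - z"] cscale_minus[of "\<i>" "z - cstar z"]
      by (simp add: d_def cstar_cscale cstar_simps)
    ultimately have "cs_positive (scaleR (1/2) (b * b + d * d))"
      by (intro cs_positive_scaleR cs_positive_add cs_positive_square) auto
    moreover have "d * d = - ((z - cstar z) * (z - cstar z))"
      by (simp add: d_def cscale_mult_left cscale_mult_right cscale_cscale)
    then have "b * b + d * d = scaleR 2 (cstar z * z + z * cstar z)"
      by (simp add: b_def algebra_simps scaleR_2)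
    ultimately show ?thesis by simp
  qed
  ultimately have "cs_positive (cstar z * z)" using cs_positive_add by fastforce
  then have "n * n * n = 0" using n3 zz cs_le_antisym[of "n * n * n" 0] by (simp add: cs_le_def)
  then have "n = 0" by (rule selfadjoint_cube_eq_zero[OF sn])
  then show ?thesis using pn by (simp add: a_def)
qed

lemma cs_positive_congruence:
  fixes a :: "'a::cstar_algebra"
  assumes "cs_positive a" "cstar x = x"
  shows "cs_positive (x * a * x)"
proof -
  have r: "cstar (cs_sqrt a) = cs_sqrt a" using cs_positive_cs_sqrt[OF assms(1)] cs_positive_sa by blast
  have "cstar (cs_sqrt a * x) * (cs_sqrt a * x) = x * (cs_sqrt a * cs_sqrt a) * x"
    by (simp add: r assms cstar_simps mult.assoc)
  then show ?thesis using cs_positive_cstar_mult_self[of "cs_sqrt a * x"] cs_sqrt_square[OF assms(1)] by simp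
qed

lemma cs_le_congruence: "a \<preceq> b \<Longrightarrow> cstar x = x \<Longrightarrow> x * a * x \<preceq> x * b * x"
  unfolding cs_le_def using cs_positive_congruence[of "b - a" x] by (simp add: algebra_simps)

subsection \<open>The positive definite cone\<close>

lemma pd_coneD:
  assumes "A \<in> pd_cone"
  shows pd_positive: "cs_positive A" and pd_invertible: "cs_invertible A" and pd_sa: "cstar A = A"
  using assms by (auto simp: pd_cone_def cs_positive_def)

text \<open>A scalar lower bound makes the cone visibly upward closed, and preserved by every order
  isomorphism that fixes the scalars.\<close>

lemma pd_cone_iff: "A \<in> pd_cone \<longleftrightarrow> (\<exists>e>0. of_real e \<preceq> A)"
proof
  assume "A \<in> pd_cone"
  then show "\<exists>e>0. of_real e \<preceq> A"
    using norm_pos_invertible_ge[of A] by (auto simp: pd_cone_def cs_le_def cs_positive_iff_norm_pos)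
next
  assume "\<exists>e>0. of_real e \<preceq> A"
  then obtain e where e: "0 < e" "cs_positive (A - of_real e)" by (auto simp: cs_le_def)
  then show "A \<in> pd_cone"
    using cs_positive_plus_invertible[OF e(2,1)] cs_positive_add[OF e(2) cs_positive_of_real[of e]]
    by (simp add: pd_cone_def)
qed

lemma pd_cone_mono: "A \<in> pd_cone \<Longrightarrow> A \<preceq> B \<Longrightarrow> B \<in> pd_cone"
  unfolding pd_cone_iff using cs_le_trans by blast

lemma pd_add_positive: "A \<in> pd_cone \<Longrightarrow> cs_positive B \<Longrightarrow> A + B \<in> pd_cone"
  by (rule pd_cone_mono[of A]) (simp_all add: cs_le_def)

lemma pd_add: "A \<in> pd_cone \<Longrightarrow> B \<in> pd_cone \<Longrightarrow> A + B \<in> pd_cone"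
  by (intro pd_add_positive pd_positive)

lemma pd_of_real: "0 < r \<Longrightarrow> of_real r \<in> pd_cone"
  unfolding pd_cone_iff using cs_le_refl by blast

lemma pd_one [simp]: "1 \<in> pd_cone"
  using pd_of_real[of 1] by simp

lemma pd_scaleR: "A \<in> pd_cone \<Longrightarrow> 0 < r \<Longrightarrow> scaleR r A \<in> pd_cone"
  by (auto simp: pd_cone_def cs_positive_scaleR cs_invertible_scaleR)

lemma pd_diff_of_norm_less: "cstar A = A \<Longrightarrow> norm A < t \<Longrightarrow> of_real t - A \<in> pd_cone"
  and pd_add_of_norm_less: "cstar A = A \<Longrightarrow> norm A < t \<Longrightarrow> A + of_real t \<in> pd_cone"
proof -
  assume a: "cstar A = A" "norm A < t"
  have "of_real (t - norm A) \<preceq> of_real t - A"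
    using cs_le_of_real_norm[OF a(1)] by (simp add: cs_le_def)
  then show "of_real t - A \<in> pd_cone" unfolding pd_cone_iff using a by (intro exI[of _ "t - norm A"]) auto
  have "of_real (t - norm A) \<preceq> A + of_real t"
    using cs_le_minus_of_real_norm[OF a(1)] by (simp add: cs_le_def)
  then show "A + of_real t \<in> pd_cone" unfolding pd_cone_iff using a by (intro exI[of _ "t - norm A"]) auto
qed

lemma pd_diff_ex_less:
  assumes "of_real t - A \<in> pd_cone"
  obtains s where "s < t" "A \<preceq> of_real s"
proof -
  obtain e where "0 < e" "of_real e \<preceq> of_real t - A" using assms pd_cone_iff by blast
  then show ?thesis by (intro that[of "t - e"]) (simp_all add: cs_le_def algebra_simps)
qed

lemma pd_norm_pos: "A \<in> pd_cone \<Longrightarrow> 0 < norm A"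
  using cs_inv_right[of A] pd_invertible[of A] by auto

lemma pd_congruence:
  "A \<in> pd_cone \<Longrightarrow> cstar X = X \<Longrightarrow> cs_invertible X \<Longrightarrow> X * A * X \<in> pd_cone"
  by (simp add: pd_cone_def cs_positive_congruence cs_invertible_mult)

lemma pd_inv: "A \<in> pd_cone \<Longrightarrow> cs_inv A \<in> pd_cone"
proof -
  assume A: "A \<in> pd_cone"
  have s: "cstar (cs_inv A) = cs_inv A" using cstar_cs_inv pd_invertible[OF A] pd_sa[OF A] by metis
  have "cs_inv A * A * cs_inv A = cs_inv A" using pd_invertible[OF A] by (simp add: cs_inv_cancel)
  then show ?thesis using pd_congruence[OF A s cs_invertible_inv[OF pd_invertible[OF A]]] by simp
qed

lemma pd_inv_sa: "A \<in> pd_cone \<Longrightarrow> cstar (cs_inv A) = cs_inv A"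
  by (intro pd_sa pd_inv)

lemma cs_inv_inv_pd: "A \<in> pd_cone \<Longrightarrow> cs_inv (cs_inv A) = A"
  by (intro cs_inv_inv pd_invertible)

lemma pd_sqrt: "A \<in> pd_cone \<Longrightarrow> cs_sqrt A \<in> pd_cone"
proof -
  assume A: "A \<in> pd_cone"
  have "cs_invertible (cs_sqrt A)"
    using cs_invertible_commuting_factor[of "cs_sqrt A" "cs_sqrt A"] pd_coneD[OF A]
    by (simp add: cs_sqrt_square)
  then show ?thesis using cs_positive_cs_sqrt pd_positive[OF A] by (simp add: pd_cone_def)
qed

lemma pd_sqrt_square: "A \<in> pd_cone \<Longrightarrow> cs_sqrt A * cs_sqrt A = A"
  by (intro cs_sqrt_square pd_positive)

lemma ex_inverse_sqrt:
  assumes "A \<in> pd_cone"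
  obtains R S where "R \<in> pd_cone" "S \<in> pd_cone" "R * S = 1" "S * R = 1" "R * R = A" "S * S = cs_inv A"
    "S * A * S = 1" "R = cs_sqrt A" "S = cs_inv R"
proof -
  define R where "R = cs_sqrt A"
  define S where "S = cs_inv R"
  have R: "R \<in> pd_cone" "R * R = A" unfolding R_def using pd_sqrt[OF assms] pd_sqrt_square[OF assms] by simp_all
  have RS: "R * S = 1" "S * R = 1" "S \<in> pd_cone"
    unfolding S_def using pd_invertible[OF R(1)] pd_inv[OF R(1)] by (simp_all add: cs_inv_cancel)
  have "S * S = cs_inv A"
    unfolding S_def R(2)[symmetric] by (rule cs_inv_mult[symmetric]) (rule pd_invertible[OF R(1)])+
  moreover have "S * A * S = 1" unfolding R(2)[symmetric] using RS by (metis mult.assoc mult_1_left)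
  ultimately show ?thesis using that[OF R(1) RS(3,1,2) R(2) _ _ R_def S_def] by simp
qed

lemma cs_le_congruence_iff:
  assumes "cstar S = S" "cs_invertible S"
  shows "S * A * S \<preceq> S * B * S \<longleftrightarrow> A \<preceq> B"
proof
  assume "S * A * S \<preceq> S * B * S"
  then have "cs_inv S * (S * A * S) * cs_inv S \<preceq> cs_inv S * (S * B * S) * cs_inv S"
    using cstar_cs_inv[OF assms(2)] assms(1) by - (rule cs_le_congruence, simp_all)
  then show "A \<preceq> B" using assms(2) by (simp add: mult.assoc cs_inv_cancel)
qed (rule cs_le_congruence[OF _ assms(1)])

lemma cs_inv_le_one: "A \<in> pd_cone \<Longrightarrow> A \<preceq> 1 \<Longrightarrow> 1 \<preceq> cs_inv A"
proof -
  assume A: "A \<in> pd_cone" "A \<preceq> 1"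
  obtain R S where *: "S \<in> pd_cone" "S * S = cs_inv A" "S * A * S = 1" using ex_inverse_sqrt[OF A(1)] by blast
  show ?thesis using cs_le_congruence[OF A(2) pd_sa[OF *(1)]] * by simp
qed

text \<open>Congruence with the inverse root of \<open>B\<close> reduces to the case where the upper
  element is the unit.\<close>

lemma cs_inv_antimono:
  assumes "A \<in> pd_cone" "B \<in> pd_cone" "A \<preceq> B"
  shows "cs_inv B \<preceq> cs_inv A"
proof -
  obtain R S where *: "R \<in> pd_cone" "S \<in> pd_cone" "R * S = 1" "S * R = 1" "S * S = cs_inv B" "S * B * S = 1"
    using ex_inverse_sqrt[OF assms(2)] by blast
  have iS: "cs_inv S = R" using * by (intro cs_inv_unique)
  have "S * A * S \<preceq> 1" using cs_le_congruence[OF assms(3) pd_sa[OF *(2)]] * by simp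
  then have "1 \<preceq> cs_inv (S * A * S)"
    using * assms by (intro cs_inv_le_one pd_congruence) (auto simp: pd_sa pd_invertible)
  also have "cs_inv (S * A * S) = R * cs_inv A * R"
    using * assms by (simp add: cs_inv_mult cs_invertible_mult pd_invertible iS mult.assoc)
  finally have "S * 1 * S \<preceq> S * (R * cs_inv A * R) * S" using pd_sa[OF *(2)] by (intro cs_le_congruence)
  moreover have "S * (R * cs_inv A * R) * S = cs_inv A"
    using *(3,4) by (metis mult.assoc mult_1_left mult_1_right)
  ultimately show ?thesis using *(5) by simp
qed

lemma cs_inv_le_iff: "A \<in> pd_cone \<Longrightarrow> B \<in> pd_cone \<Longrightarrow> cs_inv B \<preceq> cs_inv A \<longleftrightarrow> A \<preceq> B"
  using cs_inv_antimono[of A B] cs_inv_antimono[of "cs_inv B" "cs_inv A"] by (auto simp: pd_inv cs_inv_inv_pd)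

lemma cs_inv_of_real: "0 < r \<Longrightarrow> cs_inv (of_real r :: 'a::cstar_algebra) = of_real (1 / r)"
  by (rule cs_inv_unique) (simp_all flip: of_real_mult)

text \<open>\<open>Y\<^sup>-\<^sup>1\<^sup>/\<^sup>2 X Y\<^sup>-\<^sup>1\<^sup>/\<^sup>2\<close> is similar to \<open>X Y\<^sup>-\<^sup>1\<close>, whose norm is at most one.\<close>

lemma square_mono_imp_mono:
  assumes X: "cs_positive X" and Y: "Y \<in> pd_cone" and le: "X * X \<preceq> Y * Y"
  shows "X \<preceq> Y"
proof -
  obtain R S where *: "R \<in> pd_cone" "S \<in> pd_cone" "R * S = 1" "S * R = 1" "R * R = Y" "S * S = cs_inv Y" "S * Y * S = 1"
    using ex_inverse_sqrt[OF Y] by blast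
  define Z where "Z = cs_inv Y"
  have sX: "cstar X = X" and sZ: "cstar Z = Z" and sS: "cstar S = S"
    using X Y *(2) by (auto simp: Z_def cs_positive_sa pd_inv_sa pd_sa)
  have ZY: "Z * Y = 1" "Y * Z = 1" unfolding Z_def using pd_invertible[OF Y] by (simp_all add: cs_inv_cancel)
  have "Z * (X * X) * Z \<preceq> Z * (Y * Y) * Z" by (rule cs_le_congruence[OF le sZ])
  also have "Z * (Y * Y) * Z = of_real 1" using ZY by (metis mult.assoc mult_1_right of_real_1)
  finally have "norm (Z * (X * X) * Z) \<le> 1"
    using cs_positive_congruence[OF cs_positive_square[OF sX] sZ] cs_positive_norm_le_iff by fastforce
  moreover have "cstar (X * Z) * (X * Z) = Z * (X * X) * Z" by (simp add: cstar_simps sX sZ mult.assoc)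
  ultimately have nXZ: "norm (X * Z) \<le> 1" using cstar_identity[of "X * Z"] by (simp add: power_le_one_iff)
  have "cs_positive (1 - S * X * S)"
  proof (rule cs_positive_of_invertible)
    show "cstar (1 - S * X * S) = 1 - S * X * S" by (simp add: cstar_simps sX sS mult.assoc)
    fix s :: real assume s: "0 < s"
    have "norm (of_real (1 + s) - (of_real (1 + s) - X * Z)) < 1 + s" using nXZ s by simp
    then have "cs_invertible (of_real (1 + s) - (X * S) * S)"
      using cs_invertible_near_of_real[of "1 + s" "of_real (1 + s) - X * Z"] *(6)
      by (simp add: Z_def mult.assoc del: of_real_add)
    then have "cs_invertible (of_real (1 + s) - S * (X * S))" by (rule cs_invertible_swap) (use s in simp)
    then show "cs_invertible (1 - S * X * S + of_real s)" by (simp add: algebra_simps)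
  qed
  then have "S * X * S \<preceq> S * Y * S" using *(7) by (simp add: cs_le_def)
  then show ?thesis using cs_le_congruence_iff[OF sS pd_invertible[OF *(2)]] by simp
qed

lemma cs_sqrt_mono: "cs_positive A \<Longrightarrow> B \<in> pd_cone \<Longrightarrow> A \<preceq> B \<Longrightarrow> cs_sqrt A \<preceq> cs_sqrt B"
  by (rule square_mono_imp_mono) (simp_all add: cs_positive_cs_sqrt pd_sqrt cs_sqrt_square pd_positive)

subsection \<open>Geometric means as solutions of the Riccati equation\<close>

text \<open>Conjugation by the inverse root of \<open>A\<close> turns the Riccati equation into
  \<open>Q * Q = S * B * S\<close>, which has one positive solution. Being free of roots, the
  equation lets later identities be checked by plain algebra.\<close>

lemma
  assumes "A \<in> pd_cone" "B \<in> pd_cone"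
  shows pd_geom_mean: "geom_mean A B \<in> pd_cone"
    and geom_mean_riccati: "geom_mean A B * cs_inv A * geom_mean A B = B"
    and geom_mean_eqI: "X \<in> pd_cone \<Longrightarrow> X * cs_inv A * X = B \<Longrightarrow> geom_mean A B = X"
proof -
  obtain R S where *: "R \<in> pd_cone" "S \<in> pd_cone" "R * S = 1" "S * R = 1" "R * R = A" "S * S = cs_inv A"
    "S * A * S = 1" "R = cs_sqrt A" "S = cs_inv R"
    using ex_inverse_sqrt[OF assms(1)] by blast
  define Q where "Q = cs_sqrt (S * B * S)"
  have G: "geom_mean A B = R * Q * R"
    unfolding geom_mean_def Let_def Q_def *(9) *(8) by simp
  have pd: "S * B * S \<in> pd_cone" using * assms by (intro pd_congruence) (auto simp: pd_sa pd_invertible)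
  have Q: "Q \<in> pd_cone" "Q * Q = S * B * S" unfolding Q_def using pd by (simp_all add: pd_sqrt pd_sqrt_square)
  have c: "R * (S * x) = x" "S * (R * x) = x" for x by (metis *(3) *(4) mult.assoc mult_1_left)+
  show "geom_mean A B \<in> pd_cone" unfolding G using * Q by (intro pd_congruence) (auto simp: pd_sa pd_invertible)
  have "R * Q * R * (S * S) * (R * Q * R) = R * (Q * Q) * R" by (simp add: mult.assoc c)
  then show "geom_mean A B * cs_inv A * geom_mean A B = B"
    unfolding G Q(2) *(6) by (simp add: mult.assoc c *(4))
  show "geom_mean A B = X" if X: "X \<in> pd_cone" "X * cs_inv A * X = B"
  proof -
    have "S * X * S \<in> pd_cone" using X(1) * by (intro pd_congruence) (auto simp: pd_sa pd_invertible)
    moreover have "(S * X * S) * (S * X * S) = S * B * S"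
      using X(2) *(6) by (metis mult.assoc)
    ultimately have "Q = S * X * S" unfolding Q_def using pd by (intro cs_sqrt_eqI) (auto simp: pd_positive)
    then show ?thesis unfolding G by (simp add: mult.assoc c *(4))
  qed
qed

text \<open>Inverting the Riccati equation for one order of the arguments yields the equation for
  the other.\<close>

lemma geom_mean_commute:
  assumes "A \<in> pd_cone" "B \<in> pd_cone"
  shows "geom_mean A B = geom_mean B A"
proof (rule geom_mean_eqI)
  let ?X = "geom_mean B A"
  have X: "?X \<in> pd_cone" using assms by (intro pd_geom_mean)
  show "?X \<in> pd_cone" by (rule X)
  have "cs_inv A = cs_inv (?X * cs_inv B * ?X)" using assms by (simp add: geom_mean_riccati)
  also have "\<dots> = cs_inv ?X * B * cs_inv ?X"
    using X assms by (simp add: cs_inv_mult cs_invertible_mult pd_invertible pd_inv cs_inv_inv_pd mult.assoc)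
  finally show "?X * cs_inv A * ?X = B" using X by (simp add: mult.assoc cs_inv_cancel pd_invertible)
qed (use assms in auto)

lemma geom_mean_self: "A \<in> pd_cone \<Longrightarrow> geom_mean A A = A"
  by (rule geom_mean_eqI) (auto simp: mult.assoc cs_inv_cancel pd_invertible)

lemma geom_mean_scaleR:
  assumes "A \<in> pd_cone" "B \<in> pd_cone" "0 < t"
  shows "geom_mean (scaleR t A) B = scaleR (sqrt t) (geom_mean A B)"
  using assms
  by (intro geom_mean_eqI)
    (auto simp: pd_scaleR pd_geom_mean cs_inv_scaleR pd_invertible geom_mean_riccati)

lemma geom_mean_mono:
  assumes "A \<in> pd_cone" "B \<in> pd_cone" "C \<in> pd_cone" "B \<preceq> C"
  shows "geom_mean A B \<preceq> geom_mean A C"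
proof -
  obtain R S where *: "R \<in> pd_cone" "S \<in> pd_cone" "R = cs_sqrt A" "S = cs_inv R"
    using ex_inverse_sqrt[OF assms(1)] by blast
  have sS: "cstar S = S" "cs_invertible S" using *(2) by (auto simp: pd_sa pd_invertible)
  have "cs_sqrt (S * B * S) \<preceq> cs_sqrt (S * C * S)"
    using sS assms by (intro cs_sqrt_mono cs_le_congruence pd_congruence pd_positive) auto
  from cs_le_congruence[OF this pd_sa[OF *(1)]]
  show ?thesis unfolding geom_mean_def Let_def *(4) *(3) .
qed

subsection \<open>The Mazur--Ulam theorem for spaces with point reflections\<close>

text \<open>The carrier is explicit because distances live on subsets of the type: the norm distance
  on selfadjoint elements and the Thompson metric on the cone.\<close>

definition metric_on :: "'a set \<Rightarrow> ('a \<Rightarrow> 'a \<Rightarrow> real) \<Rightarrow> bool" where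
  "metric_on P d \<longleftrightarrow> (\<forall>x\<in>P. \<forall>y\<in>P. 0 \<le> d x y \<and> d x y = d y x \<and> (d x y = 0 \<longleftrightarrow> x = y))
     \<and> (\<forall>x\<in>P. \<forall>y\<in>P. \<forall>z\<in>P. d x z \<le> d x y + d y z)"

definition isometry_betw ::
  "'a set \<Rightarrow> ('a \<Rightarrow> 'a \<Rightarrow> real) \<Rightarrow> 'b set \<Rightarrow> ('b \<Rightarrow> 'b \<Rightarrow> real) \<Rightarrow> ('a \<Rightarrow> 'b) \<Rightarrow> bool" where
  "isometry_betw P d Q e f \<longleftrightarrow> bij_betw f P Q \<and> (\<forall>x\<in>P. \<forall>y\<in>P. e (f x) (f y) = d x y)"

text \<open>The last conjunct, displacement equal to twice the distance from \<open>m\<close>,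
  drives the argument; in a normed space it is the familiar property of
  \<open>x \<mapsto> a + b - x\<close>.\<close>

definition point_reflection ::
  "'a set \<Rightarrow> ('a \<Rightarrow> 'a \<Rightarrow> real) \<Rightarrow> 'a \<Rightarrow> 'a \<Rightarrow> 'a \<Rightarrow> ('a \<Rightarrow> 'a) \<Rightarrow> bool" where
  "point_reflection P d a b m \<psi> \<longleftrightarrow> a \<in> P \<and> b \<in> P \<and> m \<in> P \<and> isometry_betw P d P d \<psi>
     \<and> \<psi> a = b \<and> \<psi> b = a \<and> \<psi> m = m \<and> (\<forall>x\<in>P. \<psi> (\<psi> x) = x) \<and> (\<forall>x\<in>P. d (\<psi> x) x = 2 * d x m)"

lemma isometry_betw_mem: "isometry_betw P d Q e f \<Longrightarrow> x \<in> P \<Longrightarrow> f x \<in> Q"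
  unfolding isometry_betw_def bij_betw_def by blast

lemma isometry_betw_comp:
  "isometry_betw P d Q e f \<Longrightarrow> isometry_betw Q e R h g \<Longrightarrow> isometry_betw P d R h (g \<circ> f)"
  using isometry_betw_mem[of P d Q e f] by (auto simp: isometry_betw_def intro: bij_betw_trans)

lemma isometry_betw_inv:
  assumes "isometry_betw P d Q e f"
  shows "isometry_betw Q e P d (inv_into P f)"
proof -
  have b: "bij_betw f P Q" and i: "\<And>x y. x \<in> P \<Longrightarrow> y \<in> P \<Longrightarrow> e (f x) (f y) = d x y"
    using assms by (auto simp: isometry_betw_def)
  have "d (inv_into P f x) (inv_into P f y) = e x y" if "x \<in> Q" "y \<in> Q" for x y
    using that b i[of "inv_into P f x" "inv_into P f y"]
    by (simp add: bij_betw_inv_into_right bij_betw_def inv_into_into)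
  then show ?thesis using bij_betw_inv_into[OF b] by (simp add: isometry_betw_def)
qed

text \<open>The isometry \<open>\<psi> g\<inverse> \<psi> g\<close> again fixes \<open>a\<close> and \<open>b\<close> and moves \<open>m\<close> twice as far as \<open>g\<close>.\<close>

lemma isometry_fixes_midpoint:
  assumes d: "metric_on P d" and r: "point_reflection P d a b m \<psi>"
    and g: "isometry_betw P d P d g" "g a = a" "g b = b"
  shows "g m = m"
proof -
  have P: "a \<in> P" "b \<in> P" "m \<in> P" and \<psi>: "isometry_betw P d P d \<psi>" "\<psi> a = b" "\<psi> b = a" "\<psi> m = m"
    and two: "\<And>x. x \<in> P \<Longrightarrow> d (\<psi> x) x = 2 * d x m"
    using r by (auto simp: point_reflection_def)
  \<comment> \<open>The bound is stated for all isometries fixing \<open>a\<close> and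
    \<open>b\<close>, since the induction passes from \<open>g\<close> to another of them. The base
    case is the triangle inequality through \<open>a\<close>.\<close>
  have "2 ^ n * d (g m) m \<le> 2 * d a m" if "isometry_betw P d P d g" "g a = a" "g b = b" for g and n :: nat
    using that
  proof (induction n arbitrary: g)
    case 0
    have gm: "g m \<in> P" using 0(1) P(3) by (rule isometry_betw_mem)
    have "d (g m) m \<le> d (g m) (g a) + d a m" using d gm P 0(2) by (auto simp: metric_on_def)
    also have "d (g m) (g a) = d a m" using d 0(1) P by (auto simp: isometry_betw_def metric_on_def)
    finally show ?case by simp
  next
    case (Suc n)
    define h where "h = inv_into P g"
    have h: "isometry_betw P d P d h" unfolding h_def by (rule isometry_betw_inv[OF Suc.prems(1)])
    have inj: "inj_on g P" using Suc.prems(1) by (simp add: isometry_betw_def bij_betw_def)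
    have hg: "h (g x) = x" if "x \<in> P" for x unfolding h_def using inj that by (rule inv_into_f_f)
    have hab: "h a = a" "h b = b" using hg[OF P(1)] hg[OF P(2)] Suc.prems by simp_all
    define k where "k = \<psi> \<circ> (h \<circ> (\<psi> \<circ> g))"
    have k: "isometry_betw P d P d k" unfolding k_def
      using isometry_betw_comp \<psi>(1) h Suc.prems(1) by metis
    have "k a = a" "k b = b" unfolding k_def using Suc.prems \<psi> hab by simp_all
    then have "2 ^ n * d (k m) m \<le> 2 * d a m" using Suc.IH[OF k] by simp
    moreover have "d (k m) m = 2 * d (g m) m"
    proof -
      have gm: "g m \<in> P" using Suc.prems(1) P(3) by (rule isometry_betw_mem)
      have pgm: "\<psi> (g m) \<in> P" using \<psi>(1) gm by (rule isometry_betw_mem)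
      have hp: "h (\<psi> (g m)) \<in> P" using h pgm by (rule isometry_betw_mem)
      have "d (k m) m = d (\<psi> (h (\<psi> (g m)))) (\<psi> m)" by (simp add: k_def \<psi>)
      also have "\<dots> = d (h (\<psi> (g m))) (h (g m))"
        using \<psi>(1) hp P(3) hg[OF P(3)] by (simp add: isometry_betw_def)
      also have "\<dots> = d (\<psi> (g m)) (g m)" using h pgm gm by (simp add: isometry_betw_def)
      finally show ?thesis using two[OF gm] by simp
    qed
    ultimately show ?case by simp
  qed
  then have bound: "2 ^ n * d (g m) m \<le> 2 * d a m" for n :: nat using g by blast
  have gm: "g m \<in> P" using g(1) P(3) by (rule isometry_betw_mem)
  have "d (g m) m = 0"
  proof (rule ccontr)
    assume "d (g m) m \<noteq> 0"
    then have pos: "0 < d (g m) m" using d gm P by (metis metric_on_def order_le_less)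
    obtain n :: nat where "2 * d a m / d (g m) m < 2 ^ n"
      using real_arch_pow[of 2 "2 * d a m / d (g m) m"] by auto
    then show False using bound[of n] pos by (simp add: field_simps)
  qed
  then show ?thesis using d gm P by (auto simp: metric_on_def)
qed

text \<open>Conjugating the target reflection by \<open>T\<close> and composing with the source
  reflection fixes \<open>a\<close> and \<open>b\<close>, hence \<open>m\<close>. So
  \<open>T m\<close> is fixed by \<chi>, and the doubling property forces it to be
  \<open>n\<close>.\<close>

theorem isometry_preserves_midpoint:
  assumes d: "metric_on P d" and e: "metric_on Q e" and T: "isometry_betw P d Q e T"
    and r: "point_reflection P d a b m \<psi>" and s: "point_reflection Q e (T a) (T b) n \<chi>"
  shows "T m = n"
proof -
  define h where "h = inv_into P T"
  have h: "isometry_betw Q e P d h" unfolding h_def by (rule isometry_betw_inv[OF T])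
  have b: "bij_betw T P Q" using T by (simp add: isometry_betw_def)
  have hT: "h (T x) = x" if "x \<in> P" for x unfolding h_def using b that by (rule bij_betw_inv_into_left)
  have Th: "T (h y) = y" if "y \<in> Q" for y unfolding h_def using b that by (rule bij_betw_inv_into_right)
  have P: "a \<in> P" "b \<in> P" "m \<in> P" and \<psi>: "isometry_betw P d P d \<psi>" "\<psi> a = b" "\<psi> b = a" "\<psi> m = m"
    "\<And>x. x \<in> P \<Longrightarrow> \<psi> (\<psi> x) = x"
    using r by (auto simp: point_reflection_def)
  have \<chi>: "isometry_betw Q e Q e \<chi>" "\<chi> (T a) = T b" "\<chi> (T b) = T a" "n \<in> Q"
    and two: "\<And>x. x \<in> Q \<Longrightarrow> e (\<chi> x) x = 2 * e x n"
    using s by (auto simp: point_reflection_def)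
  have TQ: "T m \<in> Q" "\<chi> (T m) \<in> Q" using isometry_betw_mem[OF T P(3)] isometry_betw_mem[OF \<chi>(1)] by blast+
  have "isometry_betw P d P d (\<psi> \<circ> (h \<circ> (\<chi> \<circ> T)))"
    using isometry_betw_comp T \<chi>(1) h \<psi>(1) by metis
  then have "(\<psi> \<circ> (h \<circ> (\<chi> \<circ> T))) m = m"
    by (rule isometry_fixes_midpoint[OF d r]) (use \<chi> \<psi> hT P in auto)
  then have "\<psi> (\<psi> (h (\<chi> (T m)))) = \<psi> m" by simp
  then have "h (\<chi> (T m)) = m" using \<psi>(4,5) isometry_betw_mem[OF h TQ(2)] by simp
  then have "\<chi> (T m) = T m" using Th[OF TQ(2)] by simp
  moreover have "e (T m) (T m) = 0" using e TQ by (auto simp: metric_on_def)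
  ultimately have "e (T m) n = 0" using two[OF TQ(1)] by simp
  then show ?thesis using e TQ \<chi>(4) by (auto simp: metric_on_def)
qed

subsection \<open>The Thompson metric\<close>

text \<open>For \<open>A\<close> and \<open>B\<close> in the cone this is the least \<open>r\<close>
  with \<open>A \<preceq> scaleR r B\<close>; as a norm it is attained without an argument about
  infima.\<close>

definition thompson_ratio :: "'a::cstar_algebra \<Rightarrow> 'a \<Rightarrow> real" where
  "thompson_ratio A B = norm (cs_inv (cs_sqrt B) * A * cs_inv (cs_sqrt B))"

definition thompson :: "'a::cstar_algebra \<Rightarrow> 'a \<Rightarrow> real" where
  "thompson A B = max (ln (thompson_ratio A B)) (ln (thompson_ratio B A))"

lemma thompson_ratio_pos:
  assumes "A \<in> pd_cone" "B \<in> pd_cone"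
  shows "0 < thompson_ratio A B"
proof -
  obtain R S where *: "S \<in> pd_cone" "R = cs_sqrt B" "S = cs_inv R"
    using ex_inverse_sqrt[OF assms(2)] by metis
  have "S * A * S \<in> pd_cone" using * assms by (intro pd_congruence) (auto simp: pd_sa pd_invertible)
  then show ?thesis unfolding thompson_ratio_def using pd_norm_pos * by blast
qed

lemma thompson_ratio_le_iff:
  assumes "A \<in> pd_cone" "B \<in> pd_cone" "0 \<le> r"
  shows "thompson_ratio A B \<le> r \<longleftrightarrow> A \<preceq> scaleR r B"
proof -
  obtain R S where *: "S \<in> pd_cone" "S * B * S = 1" "R = cs_sqrt B" "S = cs_inv R"
    using ex_inverse_sqrt[OF assms(2)] by metis
  have "cs_positive (S * A * S)" using * assms by (intro cs_positive_congruence) (auto simp: pd_sa pd_positive)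
  then have "thompson_ratio A B \<le> r \<longleftrightarrow> S * A * S \<preceq> of_real r"
    unfolding thompson_ratio_def using cs_positive_norm_le_iff assms(3) * by blast
  also have "of_real r = S * scaleR r B * S" using *(2) by (simp add: of_real_def)
  finally show ?thesis
    using cs_le_congruence_iff[OF pd_sa[OF *(1)] pd_invertible[OF *(1)], of A "scaleR r B"] by simp
qed

lemma thompson_le_iff:
  assumes "A \<in> pd_cone" "B \<in> pd_cone"
  shows "thompson A B \<le> t \<longleftrightarrow> A \<preceq> scaleR (exp t) B \<and> B \<preceq> scaleR (exp t) A"
proof -
  have "ln (thompson_ratio A B) \<le> t \<longleftrightarrow> A \<preceq> scaleR (exp t) B" if "A \<in> pd_cone" "B \<in> pd_cone" for A B :: 'a
    using thompson_ratio_le_iff[OF that, of "exp t"] thompson_ratio_pos[OF that]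
    by (metis exp_ge_zero exp_le_cancel_iff exp_ln)
  then show ?thesis using assms by (simp add: thompson_def)
qed

lemma thompson_eqI:
  assumes "A \<in> pd_cone" "B \<in> pd_cone" "A' \<in> pd_cone" "B' \<in> pd_cone"
    "\<And>r. 0 < r \<Longrightarrow> A \<preceq> scaleR r B \<and> B \<preceq> scaleR r A \<longleftrightarrow> A' \<preceq> scaleR r B' \<and> B' \<preceq> scaleR r A'"
  shows "thompson A B = thompson A' B'"
  using thompson_le_iff[OF assms(1,2)] thompson_le_iff[OF assms(3,4)] assms(5)[OF exp_gt_zero]
  by (metis order_antisym order_refl)

lemma metric_on_thompson: "metric_on pd_cone thompson"
  unfolding metric_on_def
proof (intro conjI ballI)
  fix A B :: 'a assume A: "A \<in> pd_cone" and B: "B \<in> pd_cone"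
  show "thompson A B = thompson B A" by (simp add: thompson_def max.commute)
  have AB: "A \<preceq> scaleR (exp (thompson A B)) B" "B \<preceq> scaleR (exp (thompson A B)) A"
    using thompson_le_iff[OF A B, of "thompson A B"] by simp_all
  let ?e = "exp (thompson A B)"
  have "A \<preceq> scaleR ?e (scaleR ?e A)" using cs_le_trans[OF AB(1) cs_le_scaleR[OF AB(2)]] by simp
  then have "norm A \<le> ?e * ?e * norm A" using cs_positive_norm_mono[OF pd_positive[OF A]] by fastforce
  then have "1 \<le> exp (thompson A B + thompson A B)" using pd_norm_pos[OF A] unfolding exp_add by simp
  then show "0 \<le> thompson A B" unfolding one_le_exp_iff by simp
  show "thompson A B = 0 \<longleftrightarrow> A = B"
  proof
    assume "thompson A B = 0"
    then show "A = B" using AB cs_le_antisym[of A B] by simp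
  next
    assume "A = B"
    then have "thompson A B \<le> 0" using thompson_le_iff[OF A B] by simp
    then show "thompson A B = 0" using \<open>0 \<le> thompson A B\<close> by simp
  qed
  fix C :: 'a assume C: "C \<in> pd_cone"
  have BC: "B \<preceq> scaleR (exp (thompson B C)) C" "C \<preceq> scaleR (exp (thompson B C)) B"
    using thompson_le_iff[OF B C, of "thompson B C"] by simp_all
  have "A \<preceq> scaleR (exp (thompson A B + thompson B C)) C" "C \<preceq> scaleR (exp (thompson A B + thompson B C)) A"
    using cs_le_trans[OF AB(1) cs_le_scaleR[OF BC(1)]] cs_le_trans[OF BC(2) cs_le_scaleR[OF AB(2)]]
    by (simp_all add: exp_add mult.commute)
  then show "thompson A C \<le> thompson A B + thompson B C" using thompson_le_iff[OF A C] by simp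
qed

text \<open>Congruence with the root of \<open>Y\<close> turns the left side into a bound on
  \<open>Y * Y\<close>. The square of \<open>r\<close> on one side and \<open>r\<close> on the other
  become the factor two in the displacement of the reflection.\<close>

lemma pd_le_scaleR_inv_iff:
  fixes Y :: "'a::cstar_algebra"
  assumes Y: "Y \<in> pd_cone" and r: "0 < r"
  shows "Y \<preceq> scaleR (r\<^sup>2) (cs_inv Y) \<longleftrightarrow> Y \<preceq> of_real r"
proof -
  define R where "R = cs_sqrt Y"
  have R: "R \<in> pd_cone" "R * R = Y" unfolding R_def using Y by (simp_all add: pd_sqrt pd_sqrt_square)
  have "R * Y * R = Y * Y" using R(2) by (metis mult.assoc)
  moreover have "R * scaleR (r\<^sup>2) (cs_inv Y) * R = of_real (r\<^sup>2)"
  proof -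
    have "R * cs_inv Y * R = cs_inv R * R"
      using R pd_invertible[OF R(1)] by (simp add: R(2)[symmetric] cs_inv_mult mult.assoc cs_inv_cancel)
    then show ?thesis using pd_invertible[OF R(1)] by (simp add: cs_inv_cancel of_real_def)
  qed
  ultimately have "Y \<preceq> scaleR (r\<^sup>2) (cs_inv Y) \<longleftrightarrow> Y * Y \<preceq> of_real (r\<^sup>2)"
    using cs_le_congruence_iff[OF pd_sa[OF R(1)] pd_invertible[OF R(1)], of Y "scaleR (r\<^sup>2) (cs_inv Y)"] by simp
  also have "\<dots> \<longleftrightarrow> norm (Y * Y) \<le> r\<^sup>2"
    using cs_positive_norm_le_iff[OF cs_positive_square[OF pd_sa[OF Y]], of "r\<^sup>2"] by simp
  also have "\<dots> \<longleftrightarrow> norm Y \<le> r" using norm_square_selfadjoint[OF pd_sa[OF Y]] r by simp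
  also have "\<dots> \<longleftrightarrow> Y \<preceq> of_real r" using cs_positive_norm_le_iff[OF pd_positive[OF Y]] r by simp
  finally show ?thesis .
qed

lemma scaleR_cs_inv_le_iff:
  assumes "A \<in> pd_cone" "B \<in> pd_cone" "0 < r"
  shows "cs_inv A \<preceq> scaleR r (cs_inv B) \<longleftrightarrow> B \<preceq> scaleR r A"
proof -
  have "scaleR r (cs_inv B) = cs_inv (scaleR (1 / r) B)"
    using assms by (simp add: cs_inv_scaleR pd_invertible)
  then have "cs_inv A \<preceq> scaleR r (cs_inv B) \<longleftrightarrow> scaleR (1 / r) B \<preceq> A"
    using cs_inv_le_iff[of "scaleR (1 / r) B" A] assms by (simp add: pd_scaleR)
  also have "\<dots> \<longleftrightarrow> B \<preceq> scaleR r A"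
    using cs_le_scaleR_iff[OF assms(3), of "scaleR (1 / r) B" A] assms(3) by simp
  finally show ?thesis .
qed

text \<open>The Riccati equation says that the map swaps \<open>A\<close> and \<open>B\<close>. It
  is an isometry because inversion reverses all scaled inequalities and the Thompson metric is
  symmetric in them.\<close>

lemma point_reflection_thompson:
  fixes A B :: "'a::cstar_algebra"
  assumes A: "A \<in> pd_cone" and B: "B \<in> pd_cone"
  defines "G \<equiv> geom_mean A B"
  shows "point_reflection pd_cone thompson A B G (\<lambda>X. G * cs_inv X * G)"
proof -
  have G: "G \<in> pd_cone" "G * cs_inv A * G = B" "G * cs_inv B * G = A"
    unfolding G_def using A B geom_mean_commute[OF A B]
    by (simp_all add: pd_geom_mean geom_mean_riccati) (metis geom_mean_riccati)
  note iG = pd_invertible[OF G(1)] and sG = pd_sa[OF G(1)]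
  define \<psi> where "\<psi> = (\<lambda>X. G * cs_inv X * G)"
  have mem: "\<psi> X \<in> pd_cone" if "X \<in> pd_cone" for X
    unfolding \<psi>_def using that iG sG by (intro pd_congruence pd_inv)
  have inv: "\<psi> (\<psi> X) = X" if X: "X \<in> pd_cone" for X
  proof -
    have "cs_inv (\<psi> X) = cs_inv G * X * cs_inv G"
      unfolding \<psi>_def using X iG
      by (simp add: cs_inv_mult cs_invertible_mult cs_invertible_inv pd_invertible cs_inv_inv_pd mult.assoc)
    then show ?thesis using iG by (simp add: \<psi>_def[THEN fun_cong, of "\<psi> X"] mult.assoc cs_inv_cancel)
  qed
  have ord: "\<psi> X \<preceq> scaleR r (\<psi> Y) \<longleftrightarrow> Y \<preceq> scaleR r X" if "X \<in> pd_cone" "Y \<in> pd_cone" "0 < r" for X Y r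
  proof -
    have "\<psi> X \<preceq> scaleR r (\<psi> Y) \<longleftrightarrow> cs_inv X \<preceq> scaleR r (cs_inv Y)"
      unfolding \<psi>_def using cs_le_congruence_iff[OF sG iG, of "cs_inv X" "scaleR r (cs_inv Y)"] by simp
    then show ?thesis using scaleR_cs_inv_le_iff that by blast
  qed
  have iso: "isometry_betw pd_cone thompson pd_cone thompson \<psi>"
    unfolding isometry_betw_def
  proof (intro conjI ballI)
    show "bij_betw \<psi> pd_cone pd_cone" using mem inv by (intro bij_betw_byWitness[where f' = \<psi>]) auto
    show "thompson (\<psi> X) (\<psi> Y) = thompson X Y" if "X \<in> pd_cone" "Y \<in> pd_cone" for X Y
      using that ord mem by (intro thompson_eqI) auto
  qed
  have two: "thompson (\<psi> X) X = 2 * thompson X G" if X: "X \<in> pd_cone" for X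
  proof -
    obtain R S where *: "R \<in> pd_cone" "S \<in> pd_cone" "R * S = 1" "S * R = 1" "R * R = G" "S * G * S = 1"
      using ex_inverse_sqrt[OF G(1)] by metis
    note cS = cs_le_congruence_iff[OF pd_sa[OF *(2)] pd_invertible[OF *(2)]]
    \<comment> \<open>Congruence by \<open>S\<close> moves \<open>G\<close> to the unit, where the
      reflection becomes plain inversion of \<open>Y\<close>.\<close>
    define Y where "Y = S * X * S"
    have Y: "Y \<in> pd_cone" unfolding Y_def using * X by (intro pd_congruence) (auto simp: pd_sa pd_invertible)
    have iS: "cs_inv S = R" using * by (intro cs_inv_unique)
    have iY: "cs_inv Y = R * cs_inv X * R"
      unfolding Y_def using * X by (simp add: cs_inv_mult cs_invertible_mult pd_invertible iS mult.assoc)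
    have SpS: "S * \<psi> X * S = cs_inv Y"
      unfolding iY \<psi>_def *(5)[symmetric] using *(3,4) by (metis mult.assoc mult_1_left mult_1_right)
    have "thompson (\<psi> X) X \<le> 2 * t \<longleftrightarrow> thompson X G \<le> t" for t
    proof -
      have e: "exp (2 * t) = (exp t)\<^sup>2" by (simp add: power2_eq_square flip: exp_add)
      have 1: "\<psi> X \<preceq> scaleR (exp (2 * t)) X \<longleftrightarrow> G \<preceq> scaleR (exp t) X"
      proof -
        have "\<psi> X \<preceq> scaleR (exp (2 * t)) X \<longleftrightarrow> cs_inv Y \<preceq> scaleR ((exp t)\<^sup>2) (cs_inv (cs_inv Y))"
          using cS[of "\<psi> X" "scaleR (exp (2 * t)) X"] SpS e Y by (simp add: Y_def[symmetric] cs_inv_inv_pd)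
        also have "\<dots> \<longleftrightarrow> cs_inv Y \<preceq> scaleR (exp t) (cs_inv 1)"
          using pd_le_scaleR_inv_iff[OF pd_inv[OF Y], of "exp t"] by (simp add: of_real_def)
        also have "\<dots> \<longleftrightarrow> S * G * S \<preceq> scaleR (exp t) Y"
          using scaleR_cs_inv_le_iff[OF Y pd_one, of "exp t"] *(6) by simp
        also have "\<dots> \<longleftrightarrow> G \<preceq> scaleR (exp t) X" using cS[of G "scaleR (exp t) X"] by (simp add: Y_def)
        finally show ?thesis .
      qed
      have 2: "X \<preceq> scaleR (exp (2 * t)) (\<psi> X) \<longleftrightarrow> X \<preceq> scaleR (exp t) G"
      proof -
        have "X \<preceq> scaleR (exp (2 * t)) (\<psi> X) \<longleftrightarrow> Y \<preceq> scaleR ((exp t)\<^sup>2) (cs_inv Y)"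
          using cS[of X "scaleR (exp (2 * t)) (\<psi> X)"] SpS e by (simp add: Y_def[symmetric])
        also have "\<dots> \<longleftrightarrow> Y \<preceq> scaleR (exp t) (S * G * S)"
          using pd_le_scaleR_inv_iff[OF Y, of "exp t"] *(6) by (simp add: of_real_def)
        also have "\<dots> \<longleftrightarrow> X \<preceq> scaleR (exp t) G" using cS[of X "scaleR (exp t) G"] by (simp add: Y_def)
        finally show ?thesis .
      qed
      show ?thesis using thompson_le_iff[OF mem[OF X] X] thompson_le_iff[OF X G(1)] 1 2 by auto
    qed
    from this[of "thompson X G"] this[of "thompson (\<psi> X) X / 2"] show ?thesis by simp
  qed
  have "\<psi> G = G" unfolding \<psi>_def using iG by (simp add: mult.assoc cs_inv_cancel)
  then show ?thesis
    unfolding point_reflection_def \<psi>_def[symmetric]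
    using A B G iso inv two by (auto simp: \<psi>_def)
qed

definition homogeneous_order_iso :: "('a::cstar_algebra \<Rightarrow> 'b::cstar_algebra) \<Rightarrow> bool" where
  "homogeneous_order_iso \<phi> \<longleftrightarrow> bij_betw \<phi> pd_cone pd_cone
     \<and> (\<forall>A\<in>pd_cone. \<forall>B\<in>pd_cone. \<phi> A \<preceq> \<phi> B \<longleftrightarrow> A \<preceq> B)
     \<and> (\<forall>A\<in>pd_cone. \<forall>t>0. \<phi> (scaleR t A) = scaleR t (\<phi> A)) \<and> \<phi> 1 = 1"

lemma homogeneous_order_iso_mem: "homogeneous_order_iso \<phi> \<Longrightarrow> A \<in> pd_cone \<Longrightarrow> \<phi> A \<in> pd_cone"
  unfolding homogeneous_order_iso_def bij_betw_def by blast

text \<open>Order and scaling determine the Thompson metric, so \<phi> is an isometry and carries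
  reflection midpoints to reflection midpoints.\<close>

lemma homogeneous_order_iso_geom_mean:
  assumes \<phi>: "homogeneous_order_iso \<phi>" and A: "A \<in> pd_cone" and B: "B \<in> pd_cone"
  shows "\<phi> (geom_mean A B) = geom_mean (\<phi> A) (\<phi> B)"
proof (rule isometry_preserves_midpoint[OF metric_on_thompson metric_on_thompson, where T = \<phi> and m = "geom_mean A B"])
  note mem = homogeneous_order_iso_mem[OF \<phi>]
  show "isometry_betw pd_cone thompson pd_cone thompson \<phi>"
    unfolding isometry_betw_def
  proof (intro conjI ballI)
    show "bij_betw \<phi> pd_cone pd_cone" using \<phi> by (simp add: homogeneous_order_iso_def)
    have "\<phi> X \<preceq> scaleR r (\<phi> Y) \<longleftrightarrow> X \<preceq> scaleR r Y" if "X \<in> pd_cone" "Y \<in> pd_cone" "0 < r" for X Y r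
      using \<phi> that pd_scaleR unfolding homogeneous_order_iso_def by metis
    then show "thompson (\<phi> X) (\<phi> Y) = thompson X Y" if "X \<in> pd_cone" "Y \<in> pd_cone" for X Y
      using that mem by (intro thompson_eqI) auto
  qed
qed (use A B homogeneous_order_iso_mem[OF \<phi>] in \<open>auto intro!: point_reflection_thompson\<close>)

text \<open>By the Riccati equation, \<open>A\<close> is the geometric mean of
  \<open>cs_inv B\<close> and \<open>A * B * A\<close>. Inverses are preserved because the mean of
  \<open>B\<close> and \<open>cs_inv B\<close> is the unit.\<close>

lemma homogeneous_order_iso_triple:
  assumes \<phi>: "homogeneous_order_iso \<phi>" and A: "A \<in> pd_cone" and B: "B \<in> pd_cone"
  shows "\<phi> (A * B * A) = \<phi> A * \<phi> B * \<phi> A"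
proof -
  note mem = homogeneous_order_iso_mem[OF \<phi>]
  have one: "\<phi> 1 = 1" using \<phi> by (simp add: homogeneous_order_iso_def)
  have "geom_mean B (cs_inv B) = 1" using B by (intro geom_mean_eqI) (auto simp: pd_inv)
  then have "geom_mean (\<phi> B) (\<phi> (cs_inv B)) = 1"
    using homogeneous_order_iso_geom_mean[OF \<phi> B pd_inv[OF B]] one by simp
  then have "cs_inv (\<phi> B) = \<phi> (cs_inv B)"
    using geom_mean_riccati[OF mem[OF B] mem[OF pd_inv[OF B]]] by simp
  then have i: "cs_inv (\<phi> (cs_inv B)) = \<phi> B" using cs_inv_inv_pd[OF mem[OF B]] by simp
  have ABA: "A * B * A \<in> pd_cone" using A B by (intro pd_congruence) (auto simp: pd_sa pd_invertible)
  have "geom_mean (cs_inv B) (A * B * A) = A"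
    using A B ABA by (intro geom_mean_eqI) (auto simp: pd_inv cs_inv_inv_pd)
  then have "\<phi> A = geom_mean (\<phi> (cs_inv B)) (\<phi> (A * B * A))"
    using homogeneous_order_iso_geom_mean[OF \<phi> pd_inv[OF B] ABA] by simp
  then show ?thesis using geom_mean_riccati[OF mem[OF pd_inv[OF B]] mem[OF ABA]] i by simp
qed

subsection \<open>From order isomorphisms to Jordan isomorphisms\<close>

definition cs_re :: "'a::cstar_algebra \<Rightarrow> 'a" where "cs_re x = scaleR (1/2) (x + cstar x)"
definition cs_im :: "'a::cstar_algebra \<Rightarrow> 'a" where "cs_im x = cscale (- \<i>) (scaleR (1/2) (x - cstar x))"

lemma cs_re_sa [simp]: "cstar (cs_re x) = cs_re x"
  by (simp add: cs_re_def cstar_simps add.commute)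

lemma cscale_minus_ii: "cscale (- \<i>) x = - cscale \<i> (x::'a::cstar_algebra)"
  using cscale_cscale[of "-1" \<i> x] by simp

lemma cs_im_sa [simp]: "cstar (cs_im x) = cs_im x"
  by (simp add: cs_im_def cstar_simps cstar_cscale cscale_minus_ii cscale_scaleR cscale_diff algebra_simps)

lemma cscale_ii_ii [simp]: "cscale \<i> (cscale \<i> x) = - (x::'a::cstar_algebra)"
  by (simp add: cscale_cscale)

lemma cs_re_im: "x = cs_re x + cscale \<i> (cs_im x)"
proof -
  have "cs_re x + cscale \<i> (cs_im x) = scaleR (1/2) ((x + cstar x) + (x - cstar x))"
    unfolding cs_re_def cs_im_def cscale_minus_ii by (simp only: cscale_minus cscale_ii_ii minus_minus scaleR_add_right)
  also have "\<dots> = scaleR (1/2) (scaleR 2 x)" by (simp add: scaleR_2)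
  finally show ?thesis by simp
qed

lemma
  assumes "cstar a = a" "cstar b = b"
  shows cs_re_eq: "cs_re (a + cscale \<i> b) = a" and cs_im_eq: "cs_im (a + cscale \<i> b) = b"
proof -
  have *: "cstar (a + cscale \<i> b) = a - cscale \<i> b"
    using assms by (simp add: cstar_simps cstar_cscale cscale_minus_ii)
  have "(a + cscale \<i> b) + (a - cscale \<i> b) = scaleR 2 a"
    "(a + cscale \<i> b) - (a - cscale \<i> b) = scaleR 2 (cscale \<i> b)"
    by (simp_all add: scaleR_2)
  then show "cs_re (a + cscale \<i> b) = a" "cs_im (a + cscale \<i> b) = b"
    unfolding cs_re_def cs_im_def * by (simp_all add: cscale_minus_ii)
qed

text \<open>Only selfadjoint arguments are constrained; values elsewhere are arbitrary, so the
  complex-linear extension is a separate function.\<close>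

definition unital_order_iso :: "('a::cstar_algebra \<Rightarrow> 'b::cstar_algebra) \<Rightarrow> bool" where
  "unital_order_iso T \<longleftrightarrow> bij_betw T {X. cstar X = X} {X. cstar X = X}
     \<and> (\<forall>X Y. cstar X = X \<longrightarrow> cstar Y = Y \<longrightarrow> T (X + Y) = T X + T Y)
     \<and> (\<forall>r X. cstar X = X \<longrightarrow> T (scaleR r X) = scaleR r (T X))
     \<and> (\<forall>X Y. cstar X = X \<longrightarrow> cstar Y = Y \<longrightarrow> (T X \<preceq> T Y \<longleftrightarrow> X \<preceq> Y)) \<and> T 1 = 1"

text \<open>\<open>T\<close> restricts to a homogeneous order isomorphism of the cones, and the
  triple identity with the unit in the middle preserves squares there. A scalar shift moves
  \<open>X\<close> into the cone; by linearity the additional terms cancel.\<close>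

lemma unital_order_iso_square:
  assumes T: "unital_order_iso T" and X: "cstar X = X"
  shows "T (X * X) = T X * T X"
proof -
  have bij: "bij_betw T {X. cstar X = X} {X. cstar X = X}"
    and add: "\<And>X Y. cstar X = X \<Longrightarrow> cstar Y = Y \<Longrightarrow> T (X + Y) = T X + T Y"
    and sc: "\<And>r X. cstar X = X \<Longrightarrow> T (scaleR r X) = scaleR r (T X)"
    and ord: "\<And>X Y. cstar X = X \<Longrightarrow> cstar Y = Y \<Longrightarrow> T X \<preceq> T Y \<longleftrightarrow> X \<preceq> Y"
    and one: "T 1 = 1"
    using T by (auto simp: unital_order_iso_def)
  have T_of_real: "T (of_real r) = of_real r" for r using sc[of 1 r] one by (simp add: of_real_def)
  have pd: "T Y \<in> pd_cone \<longleftrightarrow> Y \<in> pd_cone" if "cstar Y = Y" for Y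
    unfolding pd_cone_iff using ord[of "of_real _" Y] that T_of_real by simp
  have "bij_betw T pd_cone pd_cone"
    unfolding bij_betw_def
  proof
    show "inj_on T pd_cone" using bij unfolding bij_betw_def by (rule conjE) (auto intro: inj_on_subset simp: pd_sa)
    show "T ` pd_cone = pd_cone"
    proof (intro equalityI subsetI)
      fix Y :: 'b assume Y: "Y \<in> pd_cone"
      then obtain Z where "cstar Z = Z" "Y = T Z" using bij pd_sa[OF Y] unfolding bij_betw_def by blast
      then show "Y \<in> T ` pd_cone" using pd Y by blast
    qed (use pd pd_sa in auto)
  qed
  then have h: "homogeneous_order_iso T"
    unfolding homogeneous_order_iso_def using ord sc one by (auto simp: pd_sa)
  define s where "s = norm X + 1"
  have A: "X + of_real s \<in> pd_cone" using X by (intro pd_add_of_norm_less) (auto simp: s_def)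
  have "T ((X + of_real s) * (X + of_real s)) = T (X + of_real s) * T (X + of_real s)"
    using homogeneous_order_iso_triple[OF h A pd_one] one by simp
  moreover have "(X + of_real s) * (X + of_real s) = X * X + (scaleR (2 * s) X + of_real (s * s))"
    by (simp add: algebra_simps of_real_mult_eq_scaleR scaleR_2[symmetric])
  moreover have "T (X * X + (scaleR (2 * s) X + of_real (s * s))) = T (X * X) + (scaleR (2 * s) (T X) + of_real (s * s))"
    using X by (simp add: add sc T_of_real cstar_simps del: of_real_mult)
  moreover have "T (X + of_real s) * T (X + of_real s) = T X * T X + (scaleR (2 * s) (T X) + of_real (s * s))"
    using X by (simp add: add T_of_real algebra_simps of_real_mult_eq_scaleR scaleR_2[symmetric])
  ultimately show ?thesis by simp
qed

text \<open>The square of \<open>a + cscale \<i> b\<close> involves \<open>a * b + b * a\<close>,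
  which polarisation of the square identity controls.\<close>

theorem jordan_star_iso_of_order_iso:
  assumes T: "unital_order_iso T"
  obtains J where "jordan_star_iso J" "\<And>X. cstar X = X \<Longrightarrow> J X = T X"
proof -
  have bij: "bij_betw T {X. cstar X = X} {X. cstar X = X}"
    and add: "\<And>X Y. cstar X = X \<Longrightarrow> cstar Y = Y \<Longrightarrow> T (X + Y) = T X + T Y"
    and sc: "\<And>r X. cstar X = X \<Longrightarrow> T (scaleR r X) = scaleR r (T X)"
    using T by (auto simp: unital_order_iso_def)
  note sq = unital_order_iso_square[OF T]
  have sa: "cstar (T X) = T X" if "cstar X = X" for X using bij that unfolding bij_betw_def by blast
  have zero: "T 0 = 0" using sc[of 0 0] by simp
  have diff: "T (X - Y) = T X - T Y" if "cstar X = X" "cstar Y = Y" for X Y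
    using add[of X "scaleR (-1) Y"] sc[of Y "-1"] that by simp
  have jordan: "T (a * b + b * a) = T a * T b + T b * T a" if "cstar a = a" "cstar b = b" for a b
  proof -
    have "T ((a + b) * (a + b)) = T (a * a + (a * b + b * a) + b * b)" by (simp add: algebra_simps)
    also have "\<dots> = T a * T a + T (a * b + b * a) + T b * T b"
      using that by (simp add: add sq cstar_simps add.commute)
    finally have "T a * T a + T (a * b + b * a) + T b * T b = (T a + T b) * (T a + T b)"
      using sq[of "a + b"] that by (simp add: add cstar_simps)
    then show ?thesis by (simp add: algebra_simps)
  qed
  define J where "J x = T (cs_re x) + cscale \<i> (T (cs_im x))" for x
  have J: "J (a + cscale \<i> b) = T a + cscale \<i> (T b)" if "cstar a = a" "cstar b = b" for a b
    using that by (simp add: J_def cs_re_eq cs_im_eq)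
  have ex: "\<exists>a b. x = a + cscale \<i> b \<and> cstar a = a \<and> cstar b = b" for x :: "'c::cstar_algebra"
    using cs_re_im cs_re_sa cs_im_sa by blast
  have JT: "J X = T X" if "cstar X = X" for X using J[OF that cstar_zero] by (simp add: zero)
  have Jadd: "J (x + y) = J x + J y" for x y
  proof -
    obtain a b c d where x: "x = a + cscale \<i> b" "cstar a = a" "cstar b = b"
      and y: "y = c + cscale \<i> d" "cstar c = c" "cstar d = d" using ex by metis
    have "x + y = (a + c) + cscale \<i> (b + d)" by (simp add: x y cscale_add_right ac_simps)
    moreover have "J ((a + c) + cscale \<i> (b + d)) = T (a + c) + cscale \<i> (T (b + d))"
      using x y by (intro J) (simp_all add: cstar_simps)
    ultimately have "J (x + y) = T (a + c) + cscale \<i> (T (b + d))" by simp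
    then show ?thesis using x y by (simp add: add J cscale_add_right)
  qed
  moreover have "J (cscale c x) = cscale c (J x)" for c x
  proof -
    obtain a b where x: "x = a + cscale \<i> b" "cstar a = a" "cstar b = b" using ex by metis
    have "cscale c x = (scaleR (Re c) a - scaleR (Im c) b) + cscale \<i> (scaleR (Re c) b + scaleR (Im c) a)"
      unfolding cscale_eq_Re_Im[of c x] by (simp add: x cscale_add_right cscale_scaleR scaleR_add_right scaleR_diff_right)
    then have "J (cscale c x) = T (scaleR (Re c) a - scaleR (Im c) b) + cscale \<i> (T (scaleR (Re c) b + scaleR (Im c) a))"
      using J x by (simp add: cstar_simps)
    also have "\<dots> = cscale c (T a + cscale \<i> (T b))"
      unfolding cscale_eq_Re_Im[of c "T a + cscale \<i> (T b)"]
      using x by (simp add: add diff sc cscale_add_right cscale_scaleR scaleR_add_right scaleR_diff_right)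
    finally show ?thesis using x J by simp
  qed
  moreover have "J (cstar x) = cstar (J x)" for x
  proof -
    obtain a b where x: "x = a + cscale \<i> b" "cstar a = a" "cstar b = b" using ex by metis
    have "cstar x = a + cscale \<i> (- b)" using x by (simp add: cstar_simps cstar_cscale cscale_minus_ii)
    then have "J (cstar x) = T a + cscale \<i> (T (- b))" using J[of a "- b"] x by simp
    moreover have "T (- b) = - T b" using sc[of b "-1"] x by simp
    ultimately show ?thesis using x by (simp add: J sa cstar_simps cstar_cscale cscale_minus_ii)
  qed
  moreover have "J (x * x) = J x * J x" for x
  proof -
    obtain a b where x: "x = a + cscale \<i> b" "cstar a = a" "cstar b = b" using ex by metis
    have e: "(u + cscale \<i> v) * (u + cscale \<i> v) = (u * u - v * v) + cscale \<i> (u * v + v * u)"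
      for u v :: "'c::cstar_algebra"
      by (simp add: algebra_simps cscale_mult_left cscale_mult_right cscale_add_right)
    have "J (x * x) = T (a * a - b * b) + cscale \<i> (T (a * b + b * a))"
      unfolding x(1) e using x by (intro J) (simp_all add: cstar_simps add.commute)
    also have "\<dots> = (T a * T a - T b * T b) + cscale \<i> (T a * T b + T b * T a)"
      using x by (simp add: diff sq jordan cstar_simps)
    also have "\<dots> = J x * J x" using x by (simp add: J e)
    finally show ?thesis .
  qed
  moreover have "bij J"
  proof (rule bijI)
    show "surj J"
      unfolding surj_def
    proof
      fix y :: 'b
      obtain a b where y: "y = a + cscale \<i> b" "cstar a = a" "cstar b = b" using ex by metis
      have "a \<in> T ` {X. cstar X = X}" "b \<in> T ` {X. cstar X = X}" using y bij by (simp_all add: bij_betw_def)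
      then obtain c d where "cstar c = c" "T c = a" "cstar d = d" "T d = b" by auto
      then have "y = J (c + cscale \<i> d)" using J y by simp
      then show "\<exists>x. y = J x" by blast
    qed
    show "inj J"
    proof (rule injI)
      fix x y assume eq: "J x = J y"
      have "T (cs_re x) = T (cs_re y)" "T (cs_im x) = T (cs_im y)"
        using arg_cong[OF eq, of cs_re] arg_cong[OF eq, of cs_im] by (simp_all add: J_def cs_re_eq cs_im_eq sa)
      then have "cs_re x = cs_re y" "cs_im x = cs_im y" using bij unfolding bij_betw_def inj_on_def by simp_all
      then show "x = y" using cs_re_im by metis
    qed
  qed
  ultimately have "jordan_star_iso J" unfolding jordan_star_iso_def by blast
  then show ?thesis using that JT by blast
qed

subsection \<open>Jordan isomorphisms preserve order, norm and means\<close>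

lemma jordan_star_iso_inv:
  assumes "jordan_star_iso J"
  shows "jordan_star_iso (inv J)"
proof -
  have b: "bij J" and J: "\<And>x y. J (x + y) = J x + J y" "\<And>c x. J (cscale c x) = cscale c (J x)"
    "\<And>x. J (cstar x) = cstar (J x)" "\<And>x. J (x * x) = J x * J x"
    using assms by (auto simp: jordan_star_iso_def)
  have i: "inv J (J x) = x" "J (inv J y) = y" for x y
    using b by (simp_all add: bij_is_inj bij_is_surj surj_f_inv_f)
  have eq: "inv J y = x" if "y = J x" for x y using that i by simp
  show ?thesis unfolding jordan_star_iso_def
    by (intro conjI allI bij_imp_bij_inv[OF b]; rule eq) (simp_all add: J i)
qed

context
  fixes J :: "'a::cstar_algebra \<Rightarrow> 'b::cstar_algebra"
  assumes jordan: "jordan_star_iso J"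
begin

lemma jordan_add: "J (x + y) = J x + J y"
  and jordan_cscale: "J (cscale c x) = cscale c (J x)"
  and jordan_cstar: "J (cstar x) = cstar (J x)"
  and jordan_square: "J (x * x) = J x * J x"
  and jordan_bij: "bij J"
  using jordan by (auto simp: jordan_star_iso_def)

lemma jordan_scaleR: "J (scaleR r x) = scaleR r (J x)"
  using jordan_cscale[of "of_real r"] by (simp add: cscale_of_real)

lemma jordan_diff: "J (x - y) = J x - J y"
  using jordan_add[of x "- y"] jordan_scaleR[of "-1" y] by simp

lemma jordan_anticommutator: "J (x * y + y * x) = J x * J y + J y * J x"
proof -
  have "J ((x + y) * (x + y)) = J (x * x) + J (x * y + y * x) + J (y * y)"
    by (simp add: algebra_simps flip: jordan_add)
  moreover have "J ((x + y) * (x + y)) = J x * J x + (J x * J y + J y * J x) + J y * J y"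
    unfolding jordan_square jordan_add by (simp add: algebra_simps)
  ultimately show ?thesis by (simp add: jordan_square)
qed

text \<open>Unitality follows from surjectivity: the anticommutator of the unit with a preimage of
  the unit gives it.\<close>

lemma jordan_one: "J 1 = 1"
proof -
  obtain x where "J x = 1" using jordan_bij by (metis bij_is_surj surjD)
  then have "scaleR 2 1 = scaleR 2 (J 1)" using jordan_anticommutator[of x 1] by (simp add: jordan_add scaleR_2)
  then show ?thesis by simp
qed

lemma jordan_of_real: "J (of_real r) = of_real r"
  using jordan_scaleR[of r 1] by (simp add: of_real_def jordan_one)

lemma jordan_triple: "J (x * y * x) = J x * J y * J x"
proof -
  have eq: "x * (x * y + y * x) + (x * y + y * x) * x = scaleR 2 (x * y * x) + (x * x * y + y * (x * x))"
    for x y :: "'c::cstar_algebra" by (simp add: algebra_simps scaleR_2)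
  have "J (x * (x * y + y * x) + (x * y + y * x) * x) = J x * (J x * J y + J y * J x) + (J x * J y + J y * J x) * J x"
    using jordan_anticommutator by simp
  then have "scaleR 2 (J (x * y * x)) = scaleR 2 (J x * J y * J x)"
    unfolding eq jordan_add[of "scaleR 2 (x * y * x)"] by (simp add: jordan_scaleR jordan_anticommutator jordan_square)
  then show ?thesis by simp
qed

text \<open>The triple identity applied to \<open>a * (b * b) * a = 1\<close> provides one-sided
  inverses of \<open>J a\<close> on both sides; cancelling with them in the image of
  \<open>a * b * a = a\<close> shows that \<open>J b\<close> is the inverse.\<close>

lemma
  assumes "cs_invertible a"
  shows jordan_invertible: "cs_invertible (J a)" and jordan_cs_inv: "J (cs_inv a) = cs_inv (J a)"
proof -
  define b where "b = cs_inv a"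
  have "a * b * a = a" "a * (b * b) * a = 1" using assms by (simp_all add: b_def mult.assoc cs_inv_cancel)
  then have 1: "J a * J b * J a = J a" and 2: "J a * (J b * J b) * J a = 1"
    using jordan_triple[of a b] jordan_triple[of a "b * b"] by (simp_all add: jordan_square jordan_one)
  have l: "J a * (J b * J b * J a) = 1" and r: "(J a * J b * J b) * J a = 1" using 2 by (simp_all add: mult.assoc)
  have "(J a * J b * J b) * (J a * J b * J a) = (J a * J b * J b) * J a"
    "(J a * J b * J a) * (J b * J b * J a) = J a * (J b * J b * J a)" by (simp_all add: 1)
  then have "J b * J a = 1" "J a * J b = 1" using l r by (metis mult.assoc mult_1_left mult_1_right)+
  then show "cs_invertible (J a)" "J (cs_inv a) = cs_inv (J a)"
    unfolding b_def using cs_invertibleI cs_inv_unique by metis+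
qed

lemma jordan_positive: "cs_positive a \<Longrightarrow> cs_positive (J a)"
proof -
  assume a: "cs_positive a"
  have "cstar (J (cs_sqrt a)) = J (cs_sqrt a)"
    using cs_positive_sa[OF cs_positive_cs_sqrt[OF a]] by (simp flip: jordan_cstar)
  from cs_positive_square[OF this] show ?thesis using cs_sqrt_square[OF a] by (simp flip: jordan_square)
qed

lemma jordan_mono: "a \<preceq> b \<Longrightarrow> J a \<preceq> J b"
  unfolding cs_le_def using jordan_positive by (simp flip: jordan_diff)

lemma jordan_pd: "A \<in> pd_cone \<Longrightarrow> J A \<in> pd_cone"
  by (simp add: pd_cone_def jordan_positive jordan_invertible)

end

text \<open>\<open>J\<close> and its inverse both preserve the scalar bounds of \<open>a\<close>
  from above and below, so both are contractive on selfadjoint elements.\<close>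

lemma jordan_norm:
  fixes J :: "'a::cstar_algebra \<Rightarrow> 'b::cstar_algebra"
  assumes J: "jordan_star_iso J" and a: "cstar a = a"
  shows "norm (J a) = norm a"
proof -
  have le: "norm (K b) \<le> norm b" if K: "jordan_star_iso K" and b: "cstar b = b"
    for K :: "'c::cstar_algebra \<Rightarrow> 'd::cstar_algebra" and b
  proof -
    have "K b \<preceq> of_real (norm b)" "- of_real (norm b) \<preceq> K b"
      using jordan_mono[OF K cs_le_of_real_norm[OF b]] jordan_mono[OF K cs_le_minus_of_real_norm[OF b]]
        jordan_scaleR[OF K, of "-1" "of_real (norm b)"]
      by (simp_all add: jordan_of_real[OF K])
    moreover have "cstar (K b) = K b" using jordan_cstar[OF K, of b] b by simp
    ultimately show ?thesis using norm_le_iff_cs_le[of "K b" "norm b"] by simp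
  qed
  have "inv J (J a) = a" using jordan_bij[OF J] by (simp add: bij_is_inj)
  moreover have "cstar (J a) = J a" using jordan_cstar[OF J, of a] a by simp
  ultimately show ?thesis using le[OF J a] le[OF jordan_star_iso_inv[OF J], of "J a"] by simp
qed

lemma jordan_preserves_mean_norms:
  fixes J :: "'a::cstar_algebra \<Rightarrow> 'b::cstar_algebra"
  assumes J: "jordan_star_iso J" and A: "A \<in> pd_cone" and B: "B \<in> pd_cone"
  shows "norm (arith_mean (J A) (J B)) = norm (arith_mean A B)"
    and "norm (geom_mean (J A) (J B)) = norm (geom_mean A B)"
    and "norm (harm_mean (J A) (J B)) = norm (harm_mean A B)"
proof -
  have "arith_mean (J A) (J B) = J (arith_mean A B)"
    by (simp add: arith_mean_def jordan_add[OF J] jordan_scaleR[OF J])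
  then show "norm (arith_mean (J A) (J B)) = norm (arith_mean A B)"
    using A B by (simp add: jordan_norm[OF J] arith_mean_def cstar_simps pd_sa)
  have G: "geom_mean A B \<in> pd_cone" by (rule pd_geom_mean[OF A B])
  have "J (geom_mean A B) * cs_inv (J A) * J (geom_mean A B) = J B"
    using geom_mean_riccati[OF A B] jordan_triple[OF J, of "geom_mean A B" "cs_inv A"] A
    by (simp add: jordan_cs_inv[OF J] pd_invertible)
  then have "geom_mean (J A) (J B) = J (geom_mean A B)"
    by (intro geom_mean_eqI jordan_pd[OF J] A B G)
  then show "norm (geom_mean (J A) (J B)) = norm (geom_mean A B)"
    using G by (simp add: jordan_norm[OF J] pd_sa)
  have S: "cs_inv A + cs_inv B \<in> pd_cone" using A B by (intro pd_add pd_inv)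
  have "harm_mean (J A) (J B) = J (harm_mean A B)"
    using A B S by (simp add: harm_mean_def jordan_scaleR[OF J] jordan_cs_inv[OF J] jordan_add[OF J] pd_invertible)
  then show "norm (harm_mean (J A) (J B)) = norm (harm_mean A B)"
    using S by (simp add: jordan_norm[OF J] harm_mean_def pd_inv_sa)
qed

subsection \<open>Additive order isomorphisms of selfadjoint parts\<close>

text \<open>The defect \<open>g\<close> is additive and vanishes on the integers, hence has period
  one and is bounded; its integer multiples would be unbounded at any point where it does not
  vanish.\<close>

lemma additive_bounded_imp_linear:
  fixes f :: "real \<Rightarrow> 'b::real_normed_vector"
  assumes add: "\<And>x y. f (x + y) = f x + f y" and bdd: "\<And>x. 0 \<le> x \<Longrightarrow> x \<le> 1 \<Longrightarrow> norm (f x) \<le> K"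
  shows "f x = scaleR x (f 1)"
proof -
  define g where "g x = f x - scaleR x (f 1)" for x
  have gadd: "g (x + y) = g x + g y" for x y by (simp add: g_def add algebra_simps)
  have g0: "g 0 = 0" using gadd[of 0 0] by simp
  have gneg: "g (- x) = - g x" for x using gadd[of x "- x"] g0 by (simp add: eq_neg_iff_add_eq_0 add.commute)
  have gn: "g (real n * x) = scaleR (real n) (g x)" for n x
    by (induction n) (simp_all add: g0 gadd algebra_simps)
  have gint: "g (of_int k) = 0" for k
  proof -
    have "g (real n) = 0" for n using gn[of n 1] by (simp add: g_def)
    then show ?thesis using gneg by (cases k rule: int_cases2) auto
  qed
  have bound: "norm (g x) \<le> K + norm (f 1)" for x
  proof -
    have "g x = g (frac x)" using gadd[of "of_int \<lfloor>x\<rfloor>" "frac x"] gint by (simp add: frac_def)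
    moreover have "norm (g (frac x)) \<le> norm (f (frac x)) + norm (scaleR (frac x) (f 1))"
      unfolding g_def by (rule norm_triangle_ineq4)
    moreover have "norm (scaleR (frac x) (f 1)) \<le> norm (f 1)"
      using frac_lt_1[of x] by (simp add: mult_left_le_one_le)
    moreover have "norm (f (frac x)) \<le> K" using bdd[of "frac x"] frac_lt_1[of x] by simp
    ultimately show ?thesis by simp
  qed
  have "norm (g x) = 0"
  proof (rule ccontr)
    assume "norm (g x) \<noteq> 0"
    then have pos: "0 < norm (g x)" by simp
    obtain n :: nat where "(K + norm (f 1)) / norm (g x) < real n" using reals_Archimedean2 by blast
    then have "K + norm (f 1) < real n * norm (g x)" using pos by (simp add: field_simps)
    then have "K + norm (f 1) < norm (g (real n * x))" by (simp add: gn)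
    then show False using bound[of "real n * x"] by simp
  qed
  then show ?thesis by (simp add: g_def)
qed

text \<open>Real homogeneity is a consequence of the order: additivity alone fixes the integers,
  order then bounds \<open>T\<close>, and bounded additive maps on each real line are
  linear.\<close>

lemma unital_order_isoI:
  fixes T :: "'a::cstar_algebra \<Rightarrow> 'b::cstar_algebra"
  assumes surj: "T ` {X. cstar X = X} = {X. cstar X = X}"
    and add: "\<And>X Y. cstar X = X \<Longrightarrow> cstar Y = Y \<Longrightarrow> T (X + Y) = T X + T Y"
    and ord: "\<And>X Y. cstar X = X \<Longrightarrow> cstar Y = Y \<Longrightarrow> T X \<preceq> T Y \<longleftrightarrow> X \<preceq> Y"
    and one: "T 1 = 1"
  shows "unital_order_iso T"
proof -
  have sa: "cstar (T X) = T X" if "cstar X = X" for X using surj that by blast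
  have zero: "T 0 = 0" using add[of 0 0] by simp
  have neg: "T (- X) = - T X" if "cstar X = X" for X
    using add[of X "- X"] that zero by (simp add: eq_neg_iff_add_eq_0 add.commute)
  have nat: "T (of_nat n) = of_nat n" for n
  proof (induction n)
    case (Suc n)
    have "cstar (of_nat n :: 'a) = of_nat n" using cstar_of_real[of "real n", where 'a = 'a] by simp
    then show ?case using Suc add[of 1 "of_nat n"] one by simp
  qed (simp add: zero)
  have bound: "norm (T X) \<le> norm X + 1" if X: "cstar X = X" for X
  proof -
    \<comment> \<open>An integer bound is taken because at this stage \<open>T\<close> is known only
      on integer multiples of the unit.\<close>
    define n where "n = nat \<lceil>norm X\<rceil>"
    have n: "norm X \<le> real n" "real n \<le> norm X + 1"
      unfolding n_def using norm_ge_zero[of X] by linarith+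
    have sn: "cstar (of_nat n :: 'a) = of_nat n" using cstar_of_real[of "real n", where 'a = 'a] by simp
    have "X \<preceq> of_nat n" "- of_nat n \<preceq> X" using norm_le_iff_cs_le[OF X, of "real n"] n by simp_all
    then have "T X \<preceq> of_nat n" "- of_nat n \<preceq> T X"
      using ord[OF X sn] ord[of "- of_nat n" X] X sn neg[OF sn] nat by simp_all
    then have "norm (T X) \<le> real n" using norm_le_iff_cs_le[OF sa[OF X], of "real n"] by simp
    then show ?thesis using n by simp
  qed
  have "T (scaleR r X) = scaleR r (T X)" if X: "cstar X = X" for r X
  proof -
    have "(\<lambda>r. T (scaleR r X)) r = scaleR r (T (scaleR 1 X))"
    proof (rule additive_bounded_imp_linear)
      show "T (scaleR (x + y) X) = T (scaleR x X) + T (scaleR y X)" for x y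
        using X add[of "scaleR x X" "scaleR y X"] by (simp add: scaleR_add_left)
      show "norm (T (scaleR x X)) \<le> norm X + 1" if "0 \<le> x" "x \<le> 1" for x
        using bound[of "scaleR x X"] X that mult_left_le_one_le[of "norm X" x] by simp
    qed
    then show ?thesis by simp
  qed
  moreover have "inj_on T {X. cstar X = X}"
  proof (rule inj_onI)
    fix X Y assume "X \<in> {X. cstar X = X}" "Y \<in> {X. cstar X = X}" "T X = T Y"
    then show "X = Y" using ord[of X Y] ord[of Y X] by (intro cs_le_antisym) auto
  qed
  ultimately show ?thesis using surj add ord one by (auto simp: unital_order_iso_def bij_betw_def)
qed

lemma point_reflection_selfadjoint:
  fixes a b :: "'a::cstar_algebra"
  assumes "cstar a = a" "cstar b = b"
  shows "point_reflection {X. cstar X = X} (\<lambda>x y. norm (x - y)) a b (scaleR (1/2) (a + b)) (\<lambda>x. a + b - x)"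
proof -
  define m where "m = scaleR (1/2) (a + b)"
  have m2: "a + b = scaleR 2 m" by (simp add: m_def)
  have "bij_betw (\<lambda>x. a + b - x) {X. cstar X = X} {X. cstar X = X}"
    using assms by (intro bij_betw_byWitness[where f' = "\<lambda>x. a + b - x"]) (auto simp: cstar_simps)
  moreover have "norm (a + b - x - (a + b - y)) = norm (x - y)" for x y
    by (metis diff_diff_eq2 add_diff_cancel_left' diff_add_cancel diff_right_commute norm_minus_commute)
  moreover have "norm (a + b - x - x) = 2 * norm (x - m)" for x
  proof -
    have "a + b - x - x = scaleR (-2) (x - m)" unfolding m2 by (simp add: algebra_simps scaleR_2)
    then show ?thesis by (simp del: scaleR_minus_left scaleR_right_diff_distrib)
  qed
  moreover have "a + b - m = m" unfolding m2 by (simp add: scaleR_2)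
  moreover have "cstar m = m" using assms by (simp add: m_def cstar_simps)
  ultimately show ?thesis using assms unfolding m_def[symmetric] point_reflection_def isometry_betw_def by simp
qed

text \<open>Compatibility with translations by scalars makes an order isomorphism an isometry.\<close>

lemma unital_order_iso_of_translation:
  fixes T :: "'a::cstar_algebra \<Rightarrow> 'b::cstar_algebra"
  assumes surj: "T ` {X. cstar X = X} = {X. cstar X = X}"
    and ord: "\<And>X Y. cstar X = X \<Longrightarrow> cstar Y = Y \<Longrightarrow> T X \<preceq> T Y \<longleftrightarrow> X \<preceq> Y"
    and tr: "\<And>X r. cstar X = X \<Longrightarrow> T (X + of_real r) = T X + of_real r"
    and zero: "T 0 = 0"
  shows "unital_order_iso T"
proof (rule unital_order_isoI[OF surj _ ord])
  let ?S = "{X::'a. cstar X = X}" and ?S' = "{X::'b. cstar X = X}"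
  let ?d = "\<lambda>x y. norm (x - y)" and ?d' = "\<lambda>x y. norm (x - y)"
  have sa: "cstar (T X) = T X" if "cstar X = X" for X using surj that by blast
  have inj: "inj_on T ?S"
  proof (rule inj_onI)
    fix X Y assume "X \<in> {X. cstar X = X}" "Y \<in> {X. cstar X = X}" "T X = T Y"
    then show "X = Y" using ord[of X Y] ord[of Y X] by (intro cs_le_antisym) auto
  qed
  have le: "norm (X - Y) \<le> r \<longleftrightarrow> X \<preceq> Y + of_real r \<and> Y \<preceq> X + of_real r"
    if "cstar X = X" "cstar Y = Y" "0 \<le> r" for X Y :: "'c::cstar_algebra" and r
    using norm_le_iff_cs_le[of "X - Y" r] that by (simp add: cs_le_def cstar_simps algebra_simps)
  have "norm (T X - T Y) \<le> r \<longleftrightarrow> norm (X - Y) \<le> r" if "cstar X = X" "cstar Y = Y" "0 \<le> r" for X Y r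
    using le[of X Y r] le[of "T X" "T Y" r] that ord[of X "Y + of_real r"] ord[of Y "X + of_real r"]
    by (simp add: sa tr cstar_simps)
  then have iso: "norm (T X - T Y) = norm (X - Y)" if "cstar X = X" "cstar Y = Y" for X Y
    using that by (metis norm_ge_zero order_antisym order_refl)
  have metric: "metric_on {X. cstar X = X} (\<lambda>x y::'c::cstar_algebra. norm (x - y))"
    by (auto simp: metric_on_def norm_minus_commute) (metis diff_add_cancel diff_add_eq diff_diff_eq2 norm_triangle_ineq)
  have mid: "T (scaleR (1/2) (X + Y)) = scaleR (1/2) (T X + T Y)" if "cstar X = X" "cstar Y = Y" for X Y
  proof (rule isometry_preserves_midpoint[OF metric metric, where T = T and m = "scaleR (1/2) (X + Y)"])
    show "isometry_betw ?S ?d ?S' ?d' T" using inj surj iso by (simp add: isometry_betw_def bij_betw_def)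
  qed (use that sa in \<open>auto intro!: point_reflection_selfadjoint\<close>)
  show "T (X + Y) = T X + T Y" if "cstar X = X" "cstar Y = Y" for X Y
  proof -
    \<comment> \<open>Since \<open>T\<close> fixes zero, midpoints with zero give compatibility with
      halving, which turns preservation of midpoints into additivity.\<close>
    have "T (scaleR (1/2) (X + Y)) = scaleR (1/2) (T (X + Y))"
      using mid[of "X + Y" 0] that zero by (simp add: cstar_simps)
    then show ?thesis using mid[OF that] by simp
  qed
  show "T 1 = 1" using tr[of 0 1] zero by simp
qed

section \<open>Maps determined by comparing sums with scalars\<close>

lemma cs_le_double_iff:
  fixes A :: "'a::cstar_algebra"
  shows "A + A \<preceq> of_real (2 * t) \<longleftrightarrow> A \<preceq> of_real t" "of_real (2 * t) \<preceq> A + A \<longleftrightarrow> of_real t \<preceq> A"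
proof -
  have "of_real (2 * t) = scaleR 2 (of_real t :: 'a)" "A + A = scaleR 2 A"
    by (simp_all add: of_real_def scaleR_2)
  then show "A + A \<preceq> of_real (2 * t) \<longleftrightarrow> A \<preceq> of_real t" "of_real (2 * t) \<preceq> A + A \<longleftrightarrow> of_real t \<preceq> A"
    by (simp_all only: cs_le_scaleR_iff[OF zero_less_numeral])
qed

text \<open>Two reflections at different scalars compose to a translation, so \<phi> commutes with
  adding positive scalars and extends to selfadjoint elements. Reflection of the unit at 2 fixes the
  image of the unit.\<close>

theorem jordan_of_reflection:
  fixes \<phi> :: "'a::cstar_algebra \<Rightarrow> 'b::cstar_algebra"
  assumes surj: "\<phi> ` pd_cone = pd_cone"
    and ord: "\<And>A B. A \<in> pd_cone \<Longrightarrow> B \<in> pd_cone \<Longrightarrow> \<phi> A \<preceq> \<phi> B \<longleftrightarrow> A \<preceq> B"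
    and refl: "\<And>t B. B \<in> pd_cone \<Longrightarrow> of_real t - B \<in> pd_cone \<Longrightarrow> \<phi> (of_real t - B) = of_real t - \<phi> B"
  shows "\<exists>J. jordan_star_iso J \<and> (\<forall>A\<in>pd_cone. \<phi> A = J A)"
proof -
  have mem: "\<phi> A \<in> pd_cone" if "A \<in> pd_cone" for A using surj that by blast
  have shift: "\<phi> (A + of_real s) = \<phi> A + of_real s" if A: "A \<in> pd_cone" and s: "0 < s" for A s
  proof -
    \<comment> \<open>Reflecting this \<open>B\<close> at \<open>norm A + 1\<close> returns
      \<open>A\<close>; reflecting it at a scalar larger by \<open>s\<close> returns
      \<open>A + s\<close>.\<close>
    define B where "B = of_real (norm A + 1) - A"
    have B: "B \<in> pd_cone" unfolding B_def using pd_sa[OF A] by (intro pd_diff_of_norm_less) auto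
    have 1: "of_real (norm A + 1) - B = A" and 2: "of_real (norm A + 1 + s) - B = A + of_real s"
      by (simp_all add: B_def)
    have "\<phi> A = of_real (norm A + 1) - \<phi> B" using refl[OF B, of "norm A + 1"] A 1 by simp
    moreover have "\<phi> (A + of_real s) = of_real (norm A + 1 + s) - \<phi> B"
      using refl[OF B, of "norm A + 1 + s"] pd_add[OF A pd_of_real[OF s]] unfolding 2 by simp
    ultimately show ?thesis by simp
  qed
  \<comment> \<open>The chosen shift is merely one that reaches the cone; the next fact shows that
    every admissible shift gives the same value.\<close>
  define T where "T X = \<phi> (X + of_real (norm X + 1)) - of_real (norm X + 1)" for X
  have T: "T X = \<phi> (X + of_real s) - of_real s" if s: "0 < s" "X + of_real s \<in> pd_cone" and X: "cstar X = X" for X s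
  proof -
    define u where "u = norm X + 1"
    have u: "0 < u" "X + of_real u \<in> pd_cone" using pd_add_of_norm_less[OF X, of u] by (auto simp: u_def add_nonneg_pos)
    have "\<phi> (X + of_real s) + of_real u = \<phi> (X + of_real u) + of_real s"
      using shift[OF s(2) u(1)] shift[OF u(2) s(1)] by (simp add: algebra_simps)
    then show ?thesis unfolding T_def u_def[symmetric] by (simp add: algebra_simps)
  qed
  have big: "0 < s \<and> X + of_real s \<in> pd_cone" if "cstar X = X" "norm X < s" for X :: "'c::cstar_algebra" and s
    using that norm_ge_zero[of X] by (auto intro: pd_add_of_norm_less simp del: norm_ge_zero)
  have T\<phi>: "T A = \<phi> A" if A: "A \<in> pd_cone" for A
    using T[of 1 A] shift[OF A, of 1] pd_add[OF A pd_one] pd_sa[OF A] by simp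
  have ordT: "T X \<preceq> T Y \<longleftrightarrow> X \<preceq> Y" if "cstar X = X" "cstar Y = Y" for X Y
  proof -
    define s where "s = norm X + norm Y + 1"
    have s: "0 < s" "X + of_real s \<in> pd_cone" "Y + of_real s \<in> pd_cone"
      using big[of X s] big[of Y s] that by (auto simp: s_def add_nonneg_pos)
    show ?thesis using T[OF s(1,2)] T[OF s(1,3)] that ord[OF s(2,3)] by simp
  qed
  have tr: "T (X + of_real r) = T X + of_real r" if X: "cstar X = X" for X r
  proof -
    define s where "s = norm X + \<bar>r\<bar> + 1"
    have "X + of_real (r + s) \<in> pd_cone" "0 < r + s" "0 < s"
      using big[of X "r + s"] X by (auto simp: s_def add_nonneg_pos)
    then have "of_real s + T (X + of_real r) = of_real s + (of_real r + T X)"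
      using T[of s "X + of_real r"] T[of "r + s" X] X by (simp add: cstar_simps algebra_simps)
    then show ?thesis by (simp add: add.commute)
  qed
  have surjT: "T ` {X. cstar X = X} = {X. cstar X = X}"
  proof (intro equalityI subsetI)
    fix Y assume "Y \<in> T ` {X. cstar X = X}"
    then obtain X where X: "cstar X = X" "Y = T X" by blast
    show "Y \<in> {X. cstar X = X}" using mem[of "X + of_real (norm X + 1)"] big[OF X(1), of "norm X + 1"] X(2)
      by (auto simp: T_def cstar_simps pd_sa)
  next
    fix Y :: 'b assume "Y \<in> {X. cstar X = X}"
    then have Y: "cstar Y = Y" by simp
    define s where "s = norm Y + 1"
    have s: "0 < s" "Y + of_real s \<in> pd_cone" using big[OF Y, of s] by (auto simp: s_def)
    then obtain A where A: "A \<in> pd_cone" "Y + of_real s = \<phi> A" using surj by blast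
    have "T (A - of_real s) = \<phi> A - of_real s"
      using T[OF s(1), of "A - of_real s"] A(1) pd_sa[OF A(1)] by (simp add: cstar_simps)
    also have "\<dots> = Y" unfolding A(2)[symmetric] by simp
    finally have "T (A - of_real s) = Y" .
    moreover have "cstar (A - of_real s) = A - of_real s" using pd_sa[OF A(1)] by (simp add: cstar_simps)
    ultimately show "Y \<in> T ` {X. cstar X = X}" by force
  qed
  have "T 1 = 1"
  proof -
    have "\<phi> 1 = 2 - \<phi> 1" using refl[OF pd_one, of 2] by simp
    then have "scaleR 2 (\<phi> 1) = scaleR 2 1" by (simp add: scaleR_2 eq_diff_eq)
    then show ?thesis using T\<phi>[OF pd_one] by simp
  qed
  then have "T 0 = 0" using tr[of 0 1] by simp
  then have "unital_order_iso T" using unital_order_iso_of_translation[OF surjT ordT tr] by blast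
  then obtain J where "jordan_star_iso J" "\<And>X. cstar X = X \<Longrightarrow> J X = T X"
    using jordan_star_iso_of_order_iso by blast
  then show ?thesis using T\<phi> pd_sa by metis
qed

text \<open>The relation is \<open>\<preceq>\<close> for the arithmetic mean and its converse for the harmonic mean.
  Since \<open>A + (t - B)\<close> is compared with \<open>t\<close> exactly as \<open>A\<close> is compared with \<open>B\<close>,
  the hypothesis determines the order and the map \<open>B \<mapsto> t - B\<close>.\<close>

lemma jordan_of_sum_comparison:
  fixes \<phi> :: "'a::cstar_algebra \<Rightarrow> 'b::cstar_algebra"
    and R :: "'a \<Rightarrow> 'a \<Rightarrow> bool" and R' :: "'b \<Rightarrow> 'b \<Rightarrow> bool"
  assumes R: "(R = cs_le \<and> R' = cs_le) \<or> (R = (\<lambda>a b. cs_le b a) \<and> R' = (\<lambda>a b. cs_le b a))"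
    and surj: "\<phi> ` pd_cone = pd_cone"
    and H: "\<And>A B t. A \<in> pd_cone \<Longrightarrow> B \<in> pd_cone \<Longrightarrow> 0 < t \<Longrightarrow>
        R (A + B) (of_real t) \<longleftrightarrow> R' (\<phi> A + \<phi> B) (of_real t)"
  shows "\<exists>J. jordan_star_iso J \<and> (\<forall>A\<in>pd_cone. \<phi> A = J A)"
proof -
  have mem: "\<phi> A \<in> pd_cone" if "A \<in> pd_cone" for A using surj that by blast
  have tR: "R a b \<Longrightarrow> R b c \<Longrightarrow> R a c" for a b c using R cs_le_trans by auto
  have tR': "R' a b \<Longrightarrow> R' b c \<Longrightarrow> R' a c" for a b c using R cs_le_trans by auto
  have aR: "R a b \<Longrightarrow> R b a \<Longrightarrow> a = b" for a b using R cs_le_antisym by auto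
  have aR': "R' a b \<Longrightarrow> R' b a \<Longrightarrow> a = b" for a b using R cs_le_antisym by auto
  have rR: "R a a" and rR': "R' b b" for a b using R by auto
  have pR: "R (a + c) b \<longleftrightarrow> R a (b - c)" for a b c using R by (auto simp: cs_le_def algebra_simps)
  have pR': "R' (a + c) b \<longleftrightarrow> R' a (b - c)" for a b c using R by (auto simp: cs_le_def algebra_simps)
  \<comment> \<open>The order is expressed solely by comparisons of sums with scalars, which
    \<open>H\<close> transports; surjectivity then lets \<open>C\<close> range over the whole target
    cone.\<close>
  have crit: "R A B \<longleftrightarrow> (\<forall>C\<in>pd_cone. \<forall>t>0. R (B + C) (of_real t) \<longrightarrow> R (A + C) (of_real t))"
    if "A \<in> pd_cone" "B \<in> pd_cone" for A B
  proof
    assume *: "\<forall>C\<in>pd_cone. \<forall>t>0. R (B + C) (of_real t) \<longrightarrow> R (A + C) (of_real t)"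
    define t where "t = norm B + 1"
    have "of_real t - B \<in> pd_cone" "0 < t"
      using pd_diff_of_norm_less[OF pd_sa[OF that(2)], of t] by (auto simp: t_def add_nonneg_pos)
    with * rR have "R (A + (of_real t - B)) (of_real t)" by force
    then show "R A B" by (simp add: pR)
  qed (use tR in \<open>auto simp: pR\<close>)
  have crit': "R' A B \<longleftrightarrow> (\<forall>C\<in>pd_cone. \<forall>t>0. R' (B + C) (of_real t) \<longrightarrow> R' (A + C) (of_real t))"
    if "A \<in> pd_cone" "B \<in> pd_cone" for A B
  proof
    assume *: "\<forall>C\<in>pd_cone. \<forall>t>0. R' (B + C) (of_real t) \<longrightarrow> R' (A + C) (of_real t)"
    define t where "t = norm B + 1"
    have "of_real t - B \<in> pd_cone" "0 < t"
      using pd_diff_of_norm_less[OF pd_sa[OF that(2)], of t] by (auto simp: t_def add_nonneg_pos)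
    with * rR' have "R' (A + (of_real t - B)) (of_real t)" by force
    then show "R' A B" by (simp add: pR')
  qed (use tR' in \<open>auto simp: pR'\<close>)
  have ordR: "R' (\<phi> A) (\<phi> B) \<longleftrightarrow> R A B" if "A \<in> pd_cone" "B \<in> pd_cone" for A B
  proof -
    have "R' (\<phi> A) (\<phi> B) \<longleftrightarrow> (\<forall>C\<in>\<phi> ` pd_cone. \<forall>t>0. R' (\<phi> B + C) (of_real t) \<longrightarrow> R' (\<phi> A + C) (of_real t))"
      unfolding surj using crit' that mem by blast
    then show ?thesis using crit[OF that] H that by simp
  qed
  then have ord: "\<phi> A \<preceq> \<phi> B \<longleftrightarrow> A \<preceq> B" if "A \<in> pd_cone" "B \<in> pd_cone" for A B
    using R that by auto
  \<comment> \<open>Taking equal arguments in \<open>H\<close> shows that \<phi> preserves the set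
    of elements \<open>R\<close>-related to \<open>t\<close>. As \<open>t\<close> is the extreme
    element of that set, it is mapped to its counterpart.\<close>
  have scal: "\<phi> (of_real t) = of_real t" if t: "0 < t" for t
  proof -
    have half: "R A (of_real t) \<longleftrightarrow> R' (\<phi> A) (of_real t)" if "A \<in> pd_cone" for A
    proof -
      have "R A (of_real t) \<longleftrightarrow> R (A + A) (of_real (2 * t))"
        using R cs_le_double_iff[where A = A and t = t] by auto
      moreover have "R' (\<phi> A) (of_real t) \<longleftrightarrow> R' (\<phi> A + \<phi> A) (of_real (2 * t))"
        using R cs_le_double_iff[where A = "\<phi> A" and t = t] by auto
      ultimately show ?thesis using H[OF that that, of "2 * t"] t by simp
    qed
    obtain A where A: "A \<in> pd_cone" "of_real t = \<phi> A" using surj pd_of_real[OF t] by blast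
    have "R' (\<phi> (of_real t)) (of_real t)" using half[OF pd_of_real[OF t]] rR by simp
    moreover have "R' (of_real t) (\<phi> (of_real t))"
      using half[OF A(1)] rR' A ordR[OF A(1) pd_of_real[OF t]] by simp
    ultimately show ?thesis by (rule aR')
  qed
  have "\<phi> (of_real t - B) = of_real t - \<phi> B" if B: "B \<in> pd_cone" and C: "of_real t - B \<in> pd_cone" for t B
  proof -
    \<comment> \<open>The slack \<open>t - s\<close> bounds \<open>t - \<phi> B\<close> from below,
      so this element lies in the cone and has a preimage \<open>D\<close>.\<close>
    obtain s where s: "s < t" "B \<preceq> of_real s" using pd_diff_ex_less[OF C] by blast
    have s0: "0 < s"
    proof (rule ccontr)
      assume "\<not> 0 < s"
      then have "B \<preceq> of_real 0" using cs_le_trans[OF s(2) cs_le_of_real, of 0] by simp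
      then have "norm B \<le> 0" using cs_positive_norm_le_iff[OF pd_positive[OF B], of 0] by simp
      then show False using pd_norm_pos[OF B] by simp
    qed
    have "\<phi> B \<preceq> of_real s" using ord[OF B pd_of_real[OF s0]] s(2) scal[OF s0] by simp
    then have "of_real (t - s) \<preceq> of_real t - \<phi> B" by (simp add: cs_le_def)
    then have "of_real t - \<phi> B \<in> pd_cone" unfolding pd_cone_iff using s(1) by (intro exI[of _ "t - s"]) auto
    then obtain D where D: "D \<in> pd_cone" "of_real t - \<phi> B = \<phi> D" using surj by blast
    have iff: "R A (of_real t - B) \<longleftrightarrow> R A D" if A: "A \<in> pd_cone" for A
    proof -
      have "R A (of_real t - B) \<longleftrightarrow> R' (\<phi> A + \<phi> B) (of_real t)" using H[OF A B, of t] s s0 by (simp add: pR)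
      also have "\<dots> \<longleftrightarrow> R' (\<phi> A) (\<phi> D)" by (simp add: pR' D(2))
      finally show ?thesis using ordR A D by simp
    qed
    have "of_real t - B = D" using iff[OF C] iff[OF D(1)] rR aR by blast
    then show ?thesis using D by simp
  qed
  then show ?thesis using jordan_of_reflection[OF surj ord] by blast
qed

theorem jordan_of_arith_mean_norm:
  fixes \<phi> :: "'a::cstar_algebra \<Rightarrow> 'b::cstar_algebra"
  assumes surj: "\<phi> ` pd_cone = pd_cone"
    and H: "\<forall>A\<in>pd_cone. \<forall>B\<in>pd_cone. norm (arith_mean (\<phi> A) (\<phi> B)) = norm (arith_mean A B)"
  shows "\<exists>J. jordan_star_iso J \<and> (\<forall>A\<in>pd_cone. \<phi> A = J A)"
proof (rule jordan_of_sum_comparison[OF disjI1 surj])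
  fix A B :: 'a and t :: real assume *: "A \<in> pd_cone" "B \<in> pd_cone" "0 < t"
  have mem: "\<phi> A \<in> pd_cone" "\<phi> B \<in> pd_cone" using surj * by blast+
  have iff: "X + Y \<preceq> of_real t \<longleftrightarrow> norm (X + Y) \<le> t" if "X \<in> pd_cone" "Y \<in> pd_cone"
    for X Y :: "'c::cstar_algebra"
    using cs_positive_norm_le_iff[OF pd_positive[OF pd_add[OF that]]] *(3) by simp
  have "norm (\<phi> A + \<phi> B) = norm (A + B)"
    using H * unfolding arith_mean_def norm_scaleR by simp
  then show "A + B \<preceq> of_real t \<longleftrightarrow> \<phi> A + \<phi> B \<preceq> of_real t"
    using iff[OF *(1,2)] iff[OF mem] by simp
qed simp

theorem jordan_of_harm_mean_norm:
  fixes \<phi> :: "'a::cstar_algebra \<Rightarrow> 'b::cstar_algebra"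
  assumes surj: "\<phi> ` pd_cone = pd_cone"
    and H: "\<forall>A\<in>pd_cone. \<forall>B\<in>pd_cone. norm (harm_mean (\<phi> A) (\<phi> B)) = norm (harm_mean A B)"
  shows "\<exists>J. jordan_star_iso J \<and> (\<forall>A\<in>pd_cone. \<phi> A = J A)"
proof -
  define \<psi> where "\<psi> A = cs_inv (\<phi> (cs_inv A))" for A
  have mem: "\<phi> A \<in> pd_cone" if "A \<in> pd_cone" for A using surj that by blast
  have \<phi>\<psi>: "\<phi> A = cs_inv (\<psi> (cs_inv A))" if "A \<in> pd_cone" for A
    using that mem by (simp add: \<psi>_def cs_inv_inv_pd)
  have "\<exists>J. jordan_star_iso J \<and> (\<forall>A\<in>pd_cone. \<psi> A = J A)"
  proof (rule jordan_of_sum_comparison[OF disjI2])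
    show "\<psi> ` pd_cone = pd_cone"
    proof (intro equalityI subsetI)
      fix Y :: 'b assume Y: "Y \<in> pd_cone"
      then obtain A where A: "A \<in> pd_cone" "cs_inv Y = \<phi> A" using surj pd_inv[OF Y] by blast
      then have "Y = \<psi> (cs_inv A)" using Y by (simp add: \<psi>_def cs_inv_inv_pd flip: A(2))
      then show "Y \<in> \<psi> ` pd_cone" using A pd_inv by blast
    qed (auto simp: \<psi>_def mem pd_inv)
    fix A B :: 'a and t :: real assume *: "A \<in> pd_cone" "B \<in> pd_cone" "0 < t"
    have iff: "of_real t \<preceq> X + Y \<longleftrightarrow> norm (cs_inv (X + Y)) \<le> 1 / t" if "X \<in> pd_cone" "Y \<in> pd_cone"
      for X Y :: "'c::cstar_algebra"
    proof -
      have S: "X + Y \<in> pd_cone" by (rule pd_add[OF that])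
      have "of_real t \<preceq> X + Y \<longleftrightarrow> cs_inv (X + Y) \<preceq> of_real (1 / t)"
        using cs_inv_le_iff[OF pd_of_real[OF *(3)] S] *(3) by (simp only: cs_inv_of_real)
      then show ?thesis using cs_positive_norm_le_iff[OF pd_positive[OF pd_inv[OF S]], of "1 / t"] *(3) by simp
    qed
    have "norm (cs_inv (\<psi> A + \<psi> B)) = norm (cs_inv (A + B))"
      using H pd_inv[OF *(1)] pd_inv[OF *(2)] * unfolding harm_mean_def norm_scaleR
      by (simp add: \<psi>_def cs_inv_inv_pd)
    then show "of_real t \<preceq> A + B \<longleftrightarrow> of_real t \<preceq> \<psi> A + \<psi> B"
      using iff[OF *(1,2)] iff[of "\<psi> A" "\<psi> B"] * by (simp add: \<psi>_def mem pd_inv)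
  qed simp
  then obtain J where J: "jordan_star_iso J" "\<And>A. A \<in> pd_cone \<Longrightarrow> \<psi> A = J A" by blast
  have "\<phi> A = J A" if A: "A \<in> pd_cone" for A
    using \<phi>\<psi>[OF A] J(2)[OF pd_inv[OF A]] jordan_cs_inv[OF J(1) pd_invertible[OF A]]
      cs_inv_inv_pd[OF jordan_pd[OF J(1) A]] by simp
  then show ?thesis using J by blast
qed

subsection \<open>Norms of geometric means determine the order\<close>

text \<open>The square of the right side dominates \<open>Z\<close> because the cross term
  \<open>2 * e * cs_sqrt W\<close> is positive. This serves as a continuity estimate for square
  roots.\<close>

lemma cs_sqrt_plus_le:
  assumes W: "W \<in> pd_cone" and Z: "Z \<in> pd_cone" and e: "0 \<le> e" and le: "Z \<preceq> W + of_real (e\<^sup>2)"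
  shows "cs_sqrt Z \<preceq> cs_sqrt W + of_real e"
proof (rule square_mono_imp_mono)
  let ?Q = "cs_sqrt W"
  have Q: "?Q \<in> pd_cone" "?Q * ?Q = W" using W by (simp_all add: pd_sqrt pd_sqrt_square)
  show "cs_positive (cs_sqrt Z)" using Z by (intro pd_positive pd_sqrt)
  show "?Q + of_real e \<in> pd_cone" using Q e by (intro pd_add_positive cs_positive_of_real)
  have "(?Q + of_real e) * (?Q + of_real e) = W + of_real (e\<^sup>2) + scaleR (2 * e) ?Q"
    using Q(2) by (simp add: algebra_simps of_real_mult_eq_scaleR power2_eq_square scaleR_2[symmetric])
  moreover have "cs_positive (scaleR (2 * e) ?Q)" using Q e by (intro cs_positive_scaleR pd_positive) auto
  ultimately have "W + of_real (e\<^sup>2) \<preceq> (?Q + of_real e) * (?Q + of_real e)" by (simp add: cs_le_def)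
  then show "cs_sqrt Z * cs_sqrt Z \<preceq> (?Q + of_real e) * (?Q + of_real e)"
    using le Z cs_le_trans by (simp add: pd_sqrt_square) blast
qed

text \<open>An additive error of size \<open>e\<^sup>2\<close> in one argument costs only order
  \<open>e\<close> in the mean. Normalising \<open>B\<close> to the unit multiplies the error by
  \<open>cs_inv B\<close>, whose norm enters under a root.\<close>

lemma geom_mean_perturb:
  fixes B :: "'a::cstar_algebra"
  assumes B: "B \<in> pd_cone" and U: "U \<in> pd_cone" and C: "C \<in> pd_cone" and e: "0 \<le> e"
    and le: "C \<preceq> U + of_real (e\<^sup>2)"
  shows "geom_mean B C \<preceq> geom_mean B U + scaleR (e * sqrt (norm (cs_inv B))) B"
proof -
  obtain R S where *: "R \<in> pd_cone" "S \<in> pd_cone" "R * R = B" "S * S = cs_inv B" "R = cs_sqrt B" "S = cs_inv R"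
    using ex_inverse_sqrt[OF B] by metis
  define f where "f = e * sqrt (norm (cs_inv B))"
  have f: "0 \<le> f" "f\<^sup>2 = e\<^sup>2 * norm (cs_inv B)" using e by (simp_all add: f_def power_mult_distrib)
  have sS: "cstar S = S" "cs_invertible S" using *(2) by (auto simp: pd_sa pd_invertible)
  have "S * C * S \<preceq> S * (U + of_real (e\<^sup>2)) * S" by (rule cs_le_congruence[OF le sS(1)])
  also have "S * (U + of_real (e\<^sup>2)) * S = S * U * S + scaleR (e\<^sup>2) (cs_inv B)"
    using *(4) by (simp add: algebra_simps of_real_mult_eq_scaleR del: of_real_power)
  finally have 1: "S * C * S \<preceq> S * U * S + scaleR (e\<^sup>2) (cs_inv B)" .
  have "scaleR (e\<^sup>2) (cs_inv B) \<preceq> scaleR (e\<^sup>2) (of_real (norm (cs_inv B)))"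
    using cs_le_of_real_norm[OF pd_inv_sa[OF B]] by (intro cs_le_scaleR) auto
  also have "scaleR (e\<^sup>2) (of_real (norm (cs_inv B))) = (of_real (f\<^sup>2) :: 'a)"
    unfolding f(2) by (simp add: of_real_def)
  finally have "scaleR (e\<^sup>2) (cs_inv B) \<preceq> of_real (f\<^sup>2)" .
  then have "S * C * S \<preceq> S * U * S + of_real (f\<^sup>2)" using cs_le_trans[OF 1 cs_le_add[OF cs_le_refl]] by blast
  then have "cs_sqrt (S * C * S) \<preceq> cs_sqrt (S * U * S) + of_real f"
    using U C sS f(1) by (intro cs_sqrt_plus_le pd_congruence)
  then have "R * cs_sqrt (S * C * S) * R \<preceq> R * (cs_sqrt (S * U * S) + of_real f) * R"
    by (rule cs_le_congruence[OF _ pd_sa[OF *(1)]])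
  also have "R * (cs_sqrt (S * U * S) + of_real f) * R = R * cs_sqrt (S * U * S) * R + scaleR f B"
    using *(3) by (simp add: algebra_simps of_real_mult_eq_scaleR)
  finally show ?thesis unfolding geom_mean_def Let_def f_def[symmetric] *(6) *(5) .
qed

text \<open>If \<open>A \<preceq> B\<close> fails, then \<open>D = B\<^sup>-\<^sup>1 - A\<^sup>-\<^sup>1\<close> exceeds some \<open>\<delta> > 0\<close> on the support of
  \<open>h = (D - \<delta>)\<^sub>+\<close>. The test element is \<open>C = X A\<^sup>-\<^sup>1 X\<close> with \<open>X\<close> a small perturbation of the normalised \<open>h\<close>:
  the geometric mean of \<open>A\<close> and \<open>C\<close> is \<open>X\<close>, whereas the one of \<open>B\<close> and \<open>C\<close> is strictly smaller in norm.\<close>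

lemma geom_mean_norm_imp_le:
  fixes A B :: "'a::cstar_algebra"
  assumes A: "A \<in> pd_cone" and B: "B \<in> pd_cone"
    and H: "\<And>C. C \<in> pd_cone \<Longrightarrow> norm (geom_mean A C) \<le> norm (geom_mean B C)"
  shows "A \<preceq> B"
proof (rule ccontr)
  assume nle: "\<not> A \<preceq> B"
  define P Q D where defs: "P = cs_inv A" "Q = cs_inv B" "D = Q - P"
  have P: "P \<in> pd_cone" and Q: "Q \<in> pd_cone" using A B by (simp_all add: defs pd_inv)
  have sD: "cstar D = D" using P Q by (simp add: defs(3) cstar_simps pd_sa)
  have "\<not> Q \<preceq> P" using nle cs_inv_le_iff[OF A B] by (simp add: defs)
  \<comment> \<open>A quantitative gap: were \<open>D\<close> below every positive scalar,
    closedness of the order would put it below zero.\<close>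
  have "\<exists>d>0. \<not> D \<preceq> of_real d"
  proof (rule ccontr)
    assume "\<not> ?thesis"
    then have "D \<preceq> of_real (inverse (real (Suc n)))" for n by simp
    then have "D \<preceq> of_real 0"
      using cs_le_closed[OF _ tendsto_const tendsto_of_real[OF LIMSEQ_inverse_real_of_nat]] by blast
    then show False using \<open>\<not> Q \<preceq> P\<close> by (simp add: cs_le_def defs(3))
  qed
  then obtain d where d: "0 < d" "\<not> D \<preceq> of_real d" by blast
  define E where "E = D - of_real d"
  have sE: "cstar E = E" using sD by (simp add: E_def cstar_simps)
  obtain p n where pn: "cs_positive p" "cs_positive n" "E = p - n" "p * n = 0" "n * p = 0"
    using ex_positive_negative_part[OF sE] by blast
  have "p \<noteq> 0"
  proof
    assume "p = 0"
    then have "- (D - of_real d) = n" using pn(3) unfolding E_def by simp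
    then have "of_real d - D = n" by simp
    then show False using pn(2) d(2) by (simp add: cs_le_def)
  qed
  define h where "h = scaleR (1 / norm p) p"
  have h: "cs_positive h" "norm h = 1" using pn(1) \<open>p \<noteq> 0\<close> by (simp_all add: h_def cs_positive_scaleR)
  have Eh: "E * h = p * h" "h * E = p * h" unfolding pn(3) using pn(4,5) by (simp_all add: h_def algebra_simps)
  have posE: "cs_positive (p * h)" "cs_positive (h * p * h)"
    using pn(1) h(1) by (auto intro!: cs_positive_mult_commuting[of p h] cs_positive_congruence[of p h] cs_positive_sa)
      (simp add: h_def)
  \<comment> \<open>Since \<open>c * norm Q \<le> d\<close>, the gap \<open>d\<close> pays for
    shrinking \<open>Q\<close> by the factor \<open>1 - c\<close>; the cap 1/2 keeps that factor
    positive.\<close>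
  define c where "c = min (d / norm Q) (1/2)"
  have nQ: "0 < norm Q" using Q by (rule pd_norm_pos)
  have c: "0 < c" "c < 1" "c * norm Q \<le> d" using d nQ by (auto simp: c_def min_def field_simps)
  define K where "K = sqrt (norm E) * sqrt (norm (cs_inv B)) * norm B"
  have key: "1 - sqrt (1 - c) \<le> eta * K" if eta: "0 < eta" for eta
  proof -
    \<comment> \<open>The summand \<open>eta\<close> makes \<open>X\<close> invertible. Because
      \<open>E * h = p * h\<close>, only the part of \<open>X * E * X\<close> of second order in
      \<open>eta\<close> can be negative.\<close>
    define X where "X = h + of_real eta"
    have X: "X \<in> pd_cone" unfolding X_def pd_cone_iff using h(1) eta by (intro exI[of _ eta]) (simp add: cs_le_def)
    note sX = pd_sa[OF X] and iX = pd_invertible[OF X]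
    have nX: "1 \<le> norm X"
      using cs_positive_norm_mono[OF h(1), of X] h(2) cs_positive_of_real[of eta] eta by (simp add: X_def cs_le_def)
    define C where "C = X * P * X"
    have C: "C \<in> pd_cone" unfolding C_def by (rule pd_congruence[OF P sX iX])
    have gA: "geom_mean A C = X" using A C X by (intro geom_mean_eqI) (simp_all add: C_def defs)
    \<comment> \<open>\<open>U\<close> is chosen so that its mean with \<open>B\<close> is exactly
      \<open>sqrt (1 - c)\<close> times \<open>X\<close>; \<open>C\<close> exceeds \<open>U\<close>
      by at most second order in \<open>eta\<close>.\<close>
    define U where "U = scaleR (1 - c) (X * Q * X)"
    have U: "U \<in> pd_cone" unfolding U_def using c(2) by (intro pd_scaleR pd_congruence Q sX iX) simp
    have gU: "geom_mean B U = scaleR (sqrt (1 - c)) X"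
      using B U X c by (intro geom_mean_eqI pd_scaleR) (simp_all add: U_def defs)
    have CU: "C \<preceq> U + of_real ((eta * sqrt (norm E))\<^sup>2)"
    proof -
      have "X * E * X = h * p * h + scaleR (2 * eta) (p * h) + scaleR (eta\<^sup>2) E"
      proof -
        have "X * E * X = h * (E * h) + scaleR eta (E * h) + scaleR eta (h * E) + scaleR (eta\<^sup>2) E"
          by (simp add: X_def algebra_simps of_real_mult_eq_scaleR power2_eq_square)
        then show ?thesis unfolding Eh by (simp add: algebra_simps scaleR_2[symmetric])
      qed
      moreover have "cs_positive (scaleR (eta\<^sup>2) E + of_real (eta\<^sup>2 * norm E))"
        using cs_le_scaleR[OF cs_le_minus_of_real_norm[OF sE], of "eta\<^sup>2"]
        by (simp add: cs_le_def of_real_mult_eq_scaleR[symmetric] scaleR_conv_of_real)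
      ultimately have 1: "cs_positive (X * E * X + of_real (eta\<^sup>2 * norm E))"
        using cs_positive_add[OF cs_positive_add[OF posE(2) cs_positive_scaleR[OF posE(1), of "2 * eta"]]] eta
        by (simp add: add.assoc)
      have "scaleR c Q \<preceq> of_real d"
      proof -
        have "scaleR c Q \<preceq> scaleR c (of_real (norm Q))"
          using cs_le_of_real_norm[OF pd_sa[OF Q]] c by (intro cs_le_scaleR) auto
        also have "scaleR c (of_real (norm Q)) = (of_real (c * norm Q) :: 'a)" by (simp add: of_real_def)
        finally show ?thesis using cs_le_trans cs_le_of_real[OF c(3)] by blast
      qed
      from cs_le_congruence[OF this sX] have 2: "cs_positive (X * of_real d * X - X * scaleR c Q * X)"
        by (simp only: cs_le_def)
      have "U + of_real ((eta * sqrt (norm E))\<^sup>2) - C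
          = (X * E * X + of_real (eta\<^sup>2 * norm E)) + (X * of_real d * X - X * scaleR c Q * X)"
      proof -
        have PQ: "P = Q - (E + of_real d)" by (simp add: E_def defs(3))
        have "(eta * sqrt (norm E))\<^sup>2 = eta\<^sup>2 * norm E" by (simp add: power_mult_distrib)
        then show ?thesis unfolding C_def U_def PQ by (simp add: algebra_simps del: of_real_mult of_real_power)
      qed
      then show ?thesis using cs_positive_add[OF 1 2] by (simp only: cs_le_def)
    qed
    have "norm X \<le> norm (geom_mean B C)" using H[OF C] gA by simp
    also have "\<dots> \<le> norm (geom_mean B U + scaleR (eta * sqrt (norm E) * sqrt (norm (cs_inv B))) B)"
      using eta by (intro cs_positive_norm_mono pd_positive pd_geom_mean B C geom_mean_perturb U CU) simp
    also have "\<dots> \<le> sqrt (1 - c) * norm X + eta * K"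
      using norm_triangle_ineq[of "geom_mean B U" "scaleR (eta * sqrt (norm E) * sqrt (norm (cs_inv B))) B"] c eta
      unfolding gU K_def by (simp add: mult.assoc)
    finally have "(1 - sqrt (1 - c)) * norm X \<le> eta * K" by (simp add: algebra_simps)
    moreover have "(1 - sqrt (1 - c)) * 1 \<le> (1 - sqrt (1 - c)) * norm X"
      using nX c by (intro mult_left_mono) auto
    ultimately show ?thesis by simp
  qed
  have K: "0 \<le> K" by (simp add: K_def)
  \<comment> \<open>In \<open>key\<close> the left side is a fixed positive number while the right
    side shrinks with \<open>eta\<close>; the denominator is built to exceed \<open>K\<close> even
    when \<open>K\<close> is zero.\<close>
  define eta where "eta = (1 - sqrt (1 - c)) / (2 * (K + 1))"
  have pos: "0 < 1 - sqrt (1 - c)" using c by simp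
  have "0 < eta" using pos K by (simp add: eta_def)
  then have "1 - sqrt (1 - c) \<le> eta * K" by (rule key)
  also have "\<dots> < eta * (2 * (K + 1))" using \<open>0 < eta\<close> K by (intro mult_strict_left_mono) auto
  also have "\<dots> = 1 - sqrt (1 - c)" using K by (simp add: eta_def)
  finally show False by simp
qed

lemma geom_mean_norm_iff_le:
  assumes A: "A \<in> pd_cone" and B: "B \<in> pd_cone"
  shows "(\<forall>C\<in>pd_cone. norm (geom_mean A C) \<le> norm (geom_mean B C)) \<longleftrightarrow> A \<preceq> B"
proof
  assume le: "A \<preceq> B"
  show "\<forall>C\<in>pd_cone. norm (geom_mean A C) \<le> norm (geom_mean B C)"
  proof
    fix C :: 'a assume C: "C \<in> pd_cone"
    then show "norm (geom_mean A C) \<le> norm (geom_mean B C)"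
      using geom_mean_mono[OF C A B le] pd_positive[OF pd_geom_mean[OF C A]] geom_mean_commute A B
      by (metis cs_positive_norm_mono)
  qed
qed (use geom_mean_norm_imp_le[OF A B] in blast)

text \<open>Scaling one argument multiplies all mean norms by the same root, and those norms
  determine an element, whence homogeneity. The mean of \<open>A\<close> with itself shows that
  norms are preserved; the unit, the largest cone element of norm at most one, is therefore
  fixed.\<close>

lemma homogeneous_order_iso_of_geom_mean_norm:
  fixes \<phi> :: "'a::cstar_algebra \<Rightarrow> 'b::cstar_algebra"
  assumes surj: "\<phi> ` pd_cone = pd_cone"
    and H: "\<forall>A\<in>pd_cone. \<forall>B\<in>pd_cone. norm (geom_mean (\<phi> A) (\<phi> B)) = norm (geom_mean A B)"
  shows "homogeneous_order_iso \<phi>"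
proof -
  have mem: "\<phi> A \<in> pd_cone" if "A \<in> pd_cone" for A using surj that by blast
  have ord: "\<phi> A \<preceq> \<phi> B \<longleftrightarrow> A \<preceq> B" if "A \<in> pd_cone" "B \<in> pd_cone" for A B
  proof -
    have "\<phi> A \<preceq> \<phi> B \<longleftrightarrow> (\<forall>C\<in>\<phi> ` pd_cone. norm (geom_mean (\<phi> A) C) \<le> norm (geom_mean (\<phi> B) C))"
      unfolding surj using geom_mean_norm_iff_le[OF mem[OF that(1)] mem[OF that(2)]] by simp
    also have "\<dots> \<longleftrightarrow> (\<forall>C\<in>pd_cone. norm (geom_mean A C) \<le> norm (geom_mean B C))" using H that by simp
    finally show ?thesis using geom_mean_norm_iff_le[OF that] by simp
  qed
  have inj: "inj_on \<phi> pd_cone"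
  proof (rule inj_onI)
    fix A B assume *: "A \<in> pd_cone" "B \<in> pd_cone" "\<phi> A = \<phi> B"
    show "A = B" using ord[OF *(1,2)] ord[OF *(2,1)] *(3) by (intro cs_le_antisym) auto
  qed
  have hom: "\<phi> (scaleR t A) = scaleR t (\<phi> A)" if A: "A \<in> pd_cone" and t: "0 < t" for A t
  proof -
    note tA = pd_scaleR[OF A t] and t\<phi>A = pd_scaleR[OF mem[OF A] t]
    have eq: "norm (geom_mean (\<phi> (scaleR t A)) C) = norm (geom_mean (scaleR t (\<phi> A)) C)" if C: "C \<in> pd_cone" for C
    proof -
      obtain B where B: "B \<in> pd_cone" "C = \<phi> B" using surj C by blast
      have "norm (geom_mean (\<phi> (scaleR t A)) C) = norm (geom_mean (scaleR t A) B)" using H tA B by simp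
      also have "\<dots> = sqrt t * norm (geom_mean A B)" using A B t by (simp add: geom_mean_scaleR)
      also have "\<dots> = sqrt t * norm (geom_mean (\<phi> A) C)" using H A B by simp
      also have "\<dots> = norm (geom_mean (scaleR t (\<phi> A)) C)" using mem[OF A] C t by (simp add: geom_mean_scaleR)
      finally show ?thesis .
    qed
    show ?thesis
      using geom_mean_norm_iff_le[OF mem[OF tA] t\<phi>A] geom_mean_norm_iff_le[OF t\<phi>A mem[OF tA]] eq
      by (intro cs_le_antisym) auto
  qed
  have nrm: "norm (\<phi> A) = norm A" if "A \<in> pd_cone" for A
    using H that mem[OF that] geom_mean_self[of A] geom_mean_self[of "\<phi> A"] by metis
  have le1: "A \<preceq> 1 \<longleftrightarrow> norm A \<le> 1" if "A \<in> pd_cone" for A :: "'c::cstar_algebra"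
    using cs_positive_norm_le_iff[OF pd_positive[OF that], of 1] by simp
  obtain A where A: "A \<in> pd_cone" "1 = \<phi> A" using surj pd_one by blast
  have "A \<preceq> 1" using le1[OF A(1)] nrm[OF A(1)] by (simp flip: A(2))
  then have "1 \<preceq> \<phi> 1" using ord[OF A(1) pd_one] A(2) by simp
  moreover have "\<phi> 1 \<preceq> 1" using le1[OF mem[OF pd_one]] nrm[OF pd_one] by simp
  ultimately have "\<phi> 1 = 1" by (intro cs_le_antisym)
  then show ?thesis unfolding homogeneous_order_iso_def bij_betw_def using surj inj ord hom by simp
qed

subsection \<open>The derivative of a homogeneous order isomorphism at the unit\<close>

definition increment :: "('a::cstar_algebra \<Rightarrow> 'b::cstar_algebra) \<Rightarrow> 'a \<Rightarrow> 'b" where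
  "increment \<phi> H = \<phi> (1 + H) - 1"

text \<open>A difference quotient at the unit. The step is halved each time because the squaring
  identity compares the increments at \<open>H\<close> and at twice \<open>H\<close>.\<close>

definition dyadic_quotient :: "('a::cstar_algebra \<Rightarrow> 'b::cstar_algebra) \<Rightarrow> nat \<Rightarrow> 'a \<Rightarrow> 'b" where
  "dyadic_quotient \<phi> k X = scaleR (2 ^ k) (increment \<phi> (scaleR (1 / 2 ^ k) X))"

text \<open>The limit is meaningful for selfadjoint \<open>X\<close>, where convergence is proved
  below.\<close>

definition dyadic_derivative :: "('a::cstar_algebra \<Rightarrow> 'b::cstar_algebra) \<Rightarrow> 'a \<Rightarrow> 'b" where
  "dyadic_derivative \<phi> X = lim (\<lambda>k. dyadic_quotient \<phi> k X)"

lemma norm_near_one_bounds: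
  fixes U :: "'a::cstar_algebra"
  assumes "cstar U = U" "norm (U - 1) \<le> r"
  shows "of_real (1 - r) \<preceq> U" "U \<preceq> of_real (1 + r)"
proof -
  have "0 \<le> r" using assms(2) norm_ge_zero order_trans by blast
  then have "U - 1 \<preceq> of_real r" "- of_real r \<preceq> U - 1"
    using norm_le_iff_cs_le[of "U - 1" r] assms by (simp_all add: cstar_simps)
  then show "of_real (1 - r) \<preceq> U" "U \<preceq> of_real (1 + r)" by (simp_all add: cs_le_def algebra_simps)
qed

lemma pd_near_one: "cstar U = U \<Longrightarrow> norm (U - 1) \<le> 1/2 \<Longrightarrow> U \<in> pd_cone"
  using norm_near_one_bounds(1)[of U "1/2"] unfolding pd_cone_iff by (intro exI[of _ "1/2"]) simp

lemma two_pow_dominates: "\<exists>N. \<forall>k\<ge>N. c \<le> 2 ^ (k::nat) * (e::real)" if "0 < e"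
proof -
  obtain N :: nat where N: "c / e < 2 ^ N" using real_arch_pow[of 2 "c / e"] by auto
  have "c \<le> 2 ^ k * e" if "N \<le> k" for k
  proof -
    have "c / e \<le> 2 ^ k" using order_trans[OF less_imp_le[OF N] power_increasing[OF that]] by simp
    then show ?thesis using \<open>0 < e\<close> by (simp add: field_simps)
  qed
  then show ?thesis by blast
qed

lemma tendsto_inverse_two_pow: "(\<lambda>k. c / 2 ^ k) \<longlonglongrightarrow> (0::real)"
  using tendsto_mult_right_zero[OF LIMSEQ_power_zero[of "1/2::real"], of c]
  by (simp add: power_divide)

lemma norm_scaleR_two_pow_le:
  fixes X :: "'a::real_normed_vector"
  assumes "norm X \<le> 2 ^ k / 4"
  shows "norm (scaleR (1 / 2 ^ k) X) \<le> 1/4"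
  using assms by (simp add: field_simps)

lemma pd_one_plus_scaleR:
  assumes "cstar X = X" "norm X \<le> 2 ^ k / 4"
  shows "1 + scaleR (1 / 2 ^ k) X \<in> pd_cone"
proof (rule pd_near_one)
  show "norm (1 + scaleR (1 / 2 ^ k) X - 1) \<le> 1/2"
    using norm_scaleR_two_pow_le[OF assms(2)] unfolding add_diff_cancel_left' by linarith
qed (simp add: assms(1) cstar_simps)

context
  fixes \<phi> :: "'a::cstar_algebra \<Rightarrow> 'b::cstar_algebra"
  assumes \<phi>: "homogeneous_order_iso \<phi>"
begin

lemma hoi_mono: "A \<in> pd_cone \<Longrightarrow> B \<in> pd_cone \<Longrightarrow> \<phi> A \<preceq> \<phi> B \<longleftrightarrow> A \<preceq> B"
  and hoi_scaleR: "A \<in> pd_cone \<Longrightarrow> 0 < t \<Longrightarrow> \<phi> (scaleR t A) = scaleR t (\<phi> A)"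
  and hoi_one: "\<phi> 1 = 1"
  and hoi_bij: "bij_betw \<phi> pd_cone pd_cone"
  using \<phi> by (auto simp: homogeneous_order_iso_def)

lemma hoi_of_real: "0 < t \<Longrightarrow> \<phi> (of_real t) = of_real t"
  using hoi_scaleR[OF pd_one, of t] by (simp add: of_real_def hoi_one)

lemma hoi_square: "A \<in> pd_cone \<Longrightarrow> \<phi> (A * A) = \<phi> A * \<phi> A"
  using homogeneous_order_iso_triple[OF \<phi> _ pd_one, of A] by (simp add: hoi_one)

text \<open>If \<open>X\<close> is within \<open>e\<close> of \<open>Y\<close> and \<open>Y\<close>
  is at least 1/2, then \<open>X \<preceq> scaleR (1 + 2 * e) Y\<close>, an inequality that \<phi>
  preserves. As the image of \<open>Y\<close> is at most 3/2, the constant is 2 times 3/2.\<close>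

lemma hoi_lipschitz:
  assumes U: "cstar U = U" "norm (U - 1) \<le> 1/2" and V: "cstar V = V" "norm (V - 1) \<le> 1/2"
  shows "norm (\<phi> U - \<phi> V) \<le> 3 * norm (U - V)"
proof -
  have half: "\<phi> X - \<phi> Y \<preceq> of_real (3 * norm (X - Y))"
    if X: "cstar X = X" "norm (X - 1) \<le> 1/2" and Y: "cstar Y = Y" "norm (Y - 1) \<le> 1/2" for X Y
  proof -
    define e where "e = norm (X - Y)"
    have pd: "X \<in> pd_cone" "Y \<in> pd_cone" using X Y by (simp_all add: pd_near_one)
    have "X - Y \<preceq> of_real e" unfolding e_def using X Y by (intro cs_le_of_real_norm) (simp add: cstar_simps)
    then have 1: "X \<preceq> Y + of_real e" by (simp add: cs_le_def algebra_simps)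
    have "scaleR (2 * e) (of_real (1 - 1/2)) \<preceq> scaleR (2 * e) Y"
      by (intro cs_le_scaleR norm_near_one_bounds Y) (simp add: e_def)
    then have "of_real e \<preceq> scaleR (2 * e) Y" by (simp add: of_real_def)
    then have "X \<preceq> Y + scaleR (2 * e) Y" using cs_le_trans[OF 1 cs_le_add[OF cs_le_refl]] by blast
    moreover have Y': "Y + scaleR (2 * e) Y = scaleR (1 + 2 * e) Y" by (simp add: algebra_simps)
    moreover have e: "0 < 1 + 2 * e" by (simp add: e_def add_pos_nonneg)
    ultimately have "\<phi> X \<preceq> scaleR (1 + 2 * e) (\<phi> Y)"
      using hoi_mono[OF pd(1) pd_scaleR[OF pd(2) e]] hoi_scaleR[OF pd(2) e] by simp
    then have 2: "\<phi> X - \<phi> Y \<preceq> scaleR (2 * e) (\<phi> Y)" by (simp add: cs_le_def algebra_simps)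
    have "\<phi> Y \<preceq> \<phi> (of_real (1 + 1/2))"
      using hoi_mono[OF pd(2) pd_of_real[of "1 + 1/2"]] norm_near_one_bounds(2)[OF Y] by simp
    then have "\<phi> Y \<preceq> of_real (1 + 1/2)" using hoi_of_real[of "1 + 1/2"] by simp
    moreover have "0 \<le> 2 * e" by (simp add: e_def)
    ultimately have "scaleR (2 * e) (\<phi> Y) \<preceq> scaleR (2 * e) (of_real (1 + 1/2))"
      by (rule cs_le_scaleR)
    moreover have "scaleR (2 * e) (of_real (1 + 1/2)) = (of_real (3 * e) :: 'b)"
      by (simp add: of_real_def)
    ultimately show ?thesis unfolding e_def[symmetric] using cs_le_trans[OF 2] by metis
  qed
  have sa: "cstar (\<phi> U - \<phi> V) = \<phi> U - \<phi> V"
    using homogeneous_order_iso_mem[OF \<phi>] pd_near_one[OF U] pd_near_one[OF V] by (simp add: cstar_simps pd_sa)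
  have "- of_real (3 * norm (U - V)) \<preceq> \<phi> U - \<phi> V"
    using half[OF V U] by (simp add: norm_minus_commute cs_le_def algebra_simps)
  then show ?thesis using norm_le_iff_cs_le[OF sa, of "3 * norm (U - V)"] half[OF U V] by simp
qed

lemma increment_sa: "cstar H = H \<Longrightarrow> norm H \<le> 1/2 \<Longrightarrow> cstar (increment \<phi> H) = increment \<phi> H"
  using homogeneous_order_iso_mem[OF \<phi>, of "1 + H"] pd_near_one[of "1 + H"]
  by (simp add: increment_def cstar_simps pd_sa)

lemma norm_increment_le:
  assumes H: "cstar H = H" "norm H \<le> 1/2"
  shows "norm (increment \<phi> H) \<le> norm H"
proof -
  have pd: "1 + H \<in> pd_cone" using H by (intro pd_near_one) (simp_all add: cstar_simps)
  have b: "of_real (1 - norm H) \<preceq> 1 + H" "1 + H \<preceq> of_real (1 + norm H)"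
    using norm_near_one_bounds[of "1 + H" "norm H"] H by (simp_all add: cstar_simps)
  have p: "0 < 1 - norm H" "0 < 1 + norm H" using H by (auto simp: add_pos_nonneg)
  have "of_real (1 - norm H) \<preceq> \<phi> (1 + H)" "\<phi> (1 + H) \<preceq> of_real (1 + norm H)"
    using hoi_mono[OF pd_of_real[OF p(1)] pd] hoi_mono[OF pd pd_of_real[OF p(2)]] b hoi_of_real[OF p(1)] hoi_of_real[OF p(2)]
    by simp_all
  then have "increment \<phi> H \<preceq> of_real (norm H)" "- of_real (norm H) \<preceq> increment \<phi> H"
    by (simp_all add: increment_def cs_le_def algebra_simps)
  then show ?thesis using norm_le_iff_cs_le[OF increment_sa[OF H], of "norm H"] by simp
qed

text \<open>Both sides come from the image of the square of \<open>1 + H\<close>. The discarded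
  \<open>H * H\<close> contributes 3 through the Lipschitz bound, the square of the increment
  contributes 1.\<close>

lemma increment_double:
  assumes H: "cstar H = H" "norm H \<le> 1/8"
  shows "norm (scaleR 2 (increment \<phi> H) - increment \<phi> (scaleR 2 H)) \<le> 4 * (norm H)\<^sup>2"
proof -
  define g where "g = increment \<phi> H"
  have pd: "1 + H \<in> pd_cone" using H by (intro pd_near_one) (simp_all add: cstar_simps)
  have sq: "(1 + x) * (1 + x) = 1 + scaleR 2 x + x * x" for x :: "'c::cstar_algebra"
    by (simp add: algebra_simps scaleR_2)
  have nHH: "norm (H * H) = (norm H)\<^sup>2" using H(1) by (rule norm_square_selfadjoint)
  have "norm (scaleR 2 H + H * H) \<le> 2 * norm H + (norm H)\<^sup>2"
    using norm_triangle_ineq[of "scaleR 2 H" "H * H"] nHH by simp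
  also have "(norm H)\<^sup>2 \<le> norm H * 1"
    unfolding power2_eq_square using H(2) by (intro mult_left_mono) auto
  finally have n1: "norm (scaleR 2 H + H * H) \<le> 1/2" using H(2) by simp
  have "norm (\<phi> ((1 + H) * (1 + H)) - \<phi> (1 + scaleR 2 H)) \<le> 3 * (norm H)\<^sup>2"
    using hoi_lipschitz[of "1 + scaleR 2 H + H * H" "1 + scaleR 2 H"] H n1 nHH
    unfolding sq[of H] by (simp add: cstar_simps add.assoc)
  moreover have "\<phi> ((1 + H) * (1 + H)) = 1 + scaleR 2 g + g * g"
    unfolding hoi_square[OF pd] sq[symmetric] by (simp add: g_def increment_def)
  ultimately have 1: "norm (1 + scaleR 2 g + g * g - \<phi> (1 + scaleR 2 H)) \<le> 3 * (norm H)\<^sup>2" by simp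
  have "norm (g * g) \<le> norm H * norm H"
    using norm_mult_ineq[of g g] norm_increment_le[OF H(1)] H(2) mult_mono[of "norm g" "norm H" "norm g" "norm H"]
    by (simp add: g_def)
  then have 2: "norm (g * g) \<le> (norm H)\<^sup>2" by (simp add: power2_eq_square)
  have "scaleR 2 g - increment \<phi> (scaleR 2 H) = (1 + scaleR 2 g + g * g - \<phi> (1 + scaleR 2 H)) - g * g"
    by (simp add: increment_def)
  then have "norm (scaleR 2 g - increment \<phi> (scaleR 2 H))
      \<le> norm (1 + scaleR 2 g + g * g - \<phi> (1 + scaleR 2 H)) + norm (g * g)"
    by (simp only: norm_triangle_ineq4)
  then show ?thesis using 1 2 by (simp add: g_def)
qed

end

lemma product_error_bound:
  fixes x y :: "'a::real_normed_algebra_1"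
  assumes "norm x \<le> m / 2" "norm y \<le> m" "0 \<le> m" "m \<le> 1/8"
  shows "norm ((1 + x) * (1 + y) * (1 + x) - (1 + scaleR 2 x + y)) \<le> 2 * m\<^sup>2"
proof -
  have *: "norm (a * b) \<le> r * s" if "norm a \<le> r" "norm b \<le> s" for a b :: 'a and r s
    using norm_mult_ineq[of a b] mult_mono[OF that] that norm_ge_zero[of a] order_trans by fastforce
  have "(1 + x) * (1 + y) * (1 + x) - (1 + scaleR 2 x + y) = x * x + (x * y + (y * x + x * (y * x)))"
    by (simp add: algebra_simps scaleR_2)
  also have "norm \<dots> \<le> norm (x * x) + (norm (x * y) + (norm (y * x) + norm (x * (y * x))))"
    by (intro order_trans[OF norm_triangle_ineq] add_mono order_refl)
  also have "\<dots> \<le> m/2 * (m/2) + (m/2 * m + (m * (m/2) + m/2 * (m * (m/2))))"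
    by (intro add_mono * assms)
  also have "\<dots> = m\<^sup>2 * (5/4) + m\<^sup>2 * m / 4" by (simp add: power2_eq_square field_simps)
  also have "\<dots> \<le> 2 * m\<^sup>2"
  proof -
    have "m\<^sup>2 * m \<le> m\<^sup>2 * 1" using assms by (intro mult_left_mono) auto
    then show ?thesis using zero_le_power2[of m] by linarith
  qed
  finally show ?thesis .
qed

context
  fixes \<phi> :: "'a::cstar_algebra \<Rightarrow> 'b::cstar_algebra"
  assumes \<phi>: "homogeneous_order_iso \<phi>"
begin

text \<open>With \<open>h\<close> half of \<open>H\<close>, the triple product of
  \<open>1 + h\<close> and \<open>1 + K\<close> approximates \<open>1 + H + K\<close>, and its image
  approximates \<open>1 + 2 * a + b\<close>. The errors are 6 (Lipschitz times 2), 2 for the image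
  product and 1 for doubling \<open>a\<close>.\<close>

lemma increment_add:
  assumes H: "cstar H = H" "norm H \<le> m" and K: "cstar K = K" "norm K \<le> m" and m: "m \<le> 1/8"
  shows "norm (increment \<phi> (H + K) - (increment \<phi> H + increment \<phi> K)) \<le> 9 * m\<^sup>2"
proof -
  define h where "h = scaleR (1/2) H"
  have m0: "0 \<le> m" using H(2) norm_ge_zero order_trans by blast
  have h: "cstar h = h" "norm h \<le> m / 2" "scaleR 2 h = H" using H by (simp_all add: h_def)
  define a where "a = increment \<phi> h"
  define b where "b = increment \<phi> K"
  have a: "norm a \<le> m / 2" and b: "norm b \<le> m"
    unfolding a_def b_def using norm_increment_le[OF \<phi> h(1)] norm_increment_le[OF \<phi> K(1)] h K m m0 by linarith+
  have pd: "1 + h \<in> pd_cone" "1 + K \<in> pd_cone"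
    using h K m m0 by (auto intro!: pd_near_one simp: cstar_simps)
  define W where "W = (1 + h) * (1 + K) * (1 + h)"
  have W1: "norm (W - (1 + (H + K))) \<le> 2 * m\<^sup>2"
    using product_error_bound[OF h(2) K(2) m0 m] by (simp add: W_def h(3) add.assoc)
  have m2: "m\<^sup>2 \<le> 1/64" using power_mono[OF m m0, of 2] by (simp add: power2_eq_square)
  have sW: "cstar W = W" using h K by (simp add: W_def cstar_simps mult.assoc)
  have nHK: "norm (H + K) \<le> 1/4" using norm_triangle_ineq[of H K] H K m by simp
  have "norm (W - 1) \<le> norm (W - (1 + (H + K))) + norm (H + K)"
    using norm_triangle_ineq[of "W - (1 + (H + K))" "H + K"] by simp
  then have "norm (W - 1) \<le> 1/2" using W1 m2 nHK by simp
  then have "norm (\<phi> W - \<phi> (1 + (H + K))) \<le> 3 * norm (W - (1 + (H + K)))"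
    using H K nHK sW by (intro hoi_lipschitz[OF \<phi>]) (simp_all add: cstar_simps)
  then have e1: "norm (\<phi> W - \<phi> (1 + (H + K))) \<le> 6 * m\<^sup>2" using W1 by simp
  have "\<phi> W = (1 + a) * (1 + b) * (1 + a)"
    unfolding W_def using homogeneous_order_iso_triple[OF \<phi> pd] by (simp add: a_def b_def increment_def)
  then have e2: "norm (\<phi> W - (1 + scaleR 2 a + b)) \<le> 2 * m\<^sup>2"
    using product_error_bound[OF a b m0 m] by simp
  have "(norm h)\<^sup>2 \<le> (m / 2)\<^sup>2" using h(2) by (intro power_mono) auto
  then have e3: "norm (scaleR 2 a - increment \<phi> H) \<le> m\<^sup>2"
    using increment_double[OF \<phi> h(1)] h m m0 by (simp add: a_def power_divide)
  have "increment \<phi> (H + K) - (increment \<phi> H + increment \<phi> K)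
      = (\<phi> W - (1 + scaleR 2 a + b)) - (\<phi> W - \<phi> (1 + (H + K))) + (scaleR 2 a - increment \<phi> H)"
    unfolding b_def[symmetric] by (simp add: increment_def)
  also have "norm \<dots> \<le> norm (\<phi> W - (1 + scaleR 2 a + b)) + norm (\<phi> W - \<phi> (1 + (H + K))) + norm (scaleR 2 a - increment \<phi> H)"
    by (intro order_trans[OF norm_triangle_ineq] add_right_mono norm_triangle_ineq4)
  finally show ?thesis using e1 e2 e3 by simp
qed

lemma dyadic_quotient_step:
  assumes X: "cstar X = X" "norm X \<le> 2 ^ k / 4"
  shows "norm (dyadic_quotient \<phi> (Suc k) X - dyadic_quotient \<phi> k X) \<le> (norm X)\<^sup>2 / 2 ^ k"
proof -
  define H where "H = scaleR (1 / 2 ^ Suc k) X"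
  have H: "cstar H = H" "norm H \<le> 1/8" using X by (simp_all add: H_def field_simps)
  have "dyadic_quotient \<phi> (Suc k) X - dyadic_quotient \<phi> k X
      = scaleR (2 ^ k) (scaleR 2 (increment \<phi> H) - increment \<phi> (scaleR 2 H))"
    by (simp add: dyadic_quotient_def H_def scaleR_diff_right mult.commute)
  then have "norm (dyadic_quotient \<phi> (Suc k) X - dyadic_quotient \<phi> k X) \<le> 2 ^ k * (4 * (norm H)\<^sup>2)"
    using increment_double[OF \<phi> H] by simp
  also have "\<dots> = (norm X)\<^sup>2 / 2 ^ k" by (simp add: H_def power2_eq_square field_simps)
  finally show ?thesis .
qed

text \<open>The right side is the exact partial sum of the geometric series of step errors; keeping
  the subtracted remainder lets the induction close.\<close>

lemma dyadic_quotient_bound: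
  assumes X: "cstar X = X" "norm X \<le> 2 ^ k / 4"
  shows "norm (dyadic_quotient \<phi> (k + n) X - dyadic_quotient \<phi> k X) \<le> 2 * (norm X)\<^sup>2 / 2 ^ k - 2 * (norm X)\<^sup>2 / 2 ^ (k + n)"
proof (induction n)
  case (Suc n)
  have "(2::real) ^ k \<le> 2 ^ (k + n)" by (intro power_increasing) auto
  then have "norm X \<le> 2 ^ (k + n) / 4" using X(2) by linarith
  then have 1: "norm (dyadic_quotient \<phi> (Suc (k + n)) X - dyadic_quotient \<phi> (k + n) X) \<le> (norm X)\<^sup>2 / 2 ^ (k + n)"
    by (rule dyadic_quotient_step[OF X(1)])
  have "norm (dyadic_quotient \<phi> (k + Suc n) X - dyadic_quotient \<phi> k X)
      \<le> norm (dyadic_quotient \<phi> (Suc (k + n)) X - dyadic_quotient \<phi> (k + n) X) + norm (dyadic_quotient \<phi> (k + n) X - dyadic_quotient \<phi> k X)"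
    using norm_triangle_ineq[of "dyadic_quotient \<phi> (Suc (k + n)) X - dyadic_quotient \<phi> (k + n) X" "dyadic_quotient \<phi> (k + n) X - dyadic_quotient \<phi> k X"]
    by simp
  moreover have "2 * (norm X)\<^sup>2 / 2 ^ (k + Suc n) = (norm X)\<^sup>2 / 2 ^ (k + n)" by simp
  moreover have "2 * (norm X)\<^sup>2 / 2 ^ (k + n) = (norm X)\<^sup>2 / 2 ^ (k + n) + (norm X)\<^sup>2 / 2 ^ (k + n)" by simp
  ultimately show ?case using 1 Suc by linarith
qed simp

lemma dyadic_quotient_tendsto:
  assumes X: "cstar X = X"
  shows "(\<lambda>k. dyadic_quotient \<phi> k X) \<longlonglongrightarrow> dyadic_derivative \<phi> X"
proof -
  let ?G = "\<lambda>k. dyadic_quotient \<phi> k X"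
  obtain N where N: "\<And>k. N \<le> k \<Longrightarrow> norm X \<le> 2 ^ k * (1/4)"
    using two_pow_dominates[of "1/4" "norm X"] by auto
  have "summable (\<lambda>k. (norm X)\<^sup>2 * (1/2) ^ k)" by (intro summable_mult summable_geometric) simp
  then have "summable (\<lambda>k. (norm X)\<^sup>2 / 2 ^ k)" by (simp add: power_divide)
  then have "summable (\<lambda>k. ?G (Suc k) - ?G k)"
    by (rule summable_comparison_test'[where N = N]) (use dyadic_quotient_step[OF X] N in simp)
  then have "convergent (\<lambda>n. \<Sum>i<n. ?G (Suc i) - ?G i)" by (simp add: summable_iff_convergent)
  then have "convergent (\<lambda>n. ?G n - ?G 0)" unfolding sum_lessThan_telescope[of ?G] .
  then have "convergent ?G" using convergent_diff_const_right_iff by blast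
  then show ?thesis unfolding dyadic_derivative_def by (simp add: convergent_LIMSEQ_iff)
qed

text \<open>The case \<open>k = 0\<close> is a first-order expansion at the unit with quadratic
  remainder; the factor decaying in \<open>k\<close> controls the inverse map.\<close>

lemma dyadic_derivative_approx:
  assumes X: "cstar X = X" "norm X \<le> 2 ^ k / 4"
  shows "norm (dyadic_derivative \<phi> X - dyadic_quotient \<phi> k X) \<le> 2 * (norm X)\<^sup>2 / 2 ^ k"
proof (rule LIMSEQ_le_const2)
  show "(\<lambda>n. norm (dyadic_quotient \<phi> (n + k) X - dyadic_quotient \<phi> k X)) \<longlonglongrightarrow> norm (dyadic_derivative \<phi> X - dyadic_quotient \<phi> k X)"
    by (intro tendsto_intros LIMSEQ_ignore_initial_segment dyadic_quotient_tendsto X)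
  have "norm (dyadic_quotient \<phi> (n + k) X - dyadic_quotient \<phi> k X) \<le> 2 * (norm X)\<^sup>2 / 2 ^ k" for n
    using dyadic_quotient_bound[OF X, of n] zero_le_divide_iff[of "2 * (norm X)\<^sup>2" "2 ^ (k + n)"]
    by (simp add: add.commute) (smt (verit) divide_nonneg_nonneg zero_le_power2 zero_le_power)
  then show "\<exists>N. \<forall>n\<ge>N. norm (dyadic_quotient \<phi> (n + k) X - dyadic_quotient \<phi> k X) \<le> 2 * (norm X)\<^sup>2 / 2 ^ k" by blast
qed

lemma
  assumes X: "cstar X = X" "norm X \<le> 2 ^ k / 4"
  shows dyadic_quotient_sa: "cstar (dyadic_quotient \<phi> k X) = dyadic_quotient \<phi> k X"
    and norm_dyadic_quotient_le: "norm (dyadic_quotient \<phi> k X) \<le> norm X"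
proof -
  have sH: "cstar (scaleR (1 / 2 ^ k) X) = scaleR (1 / 2 ^ k) X" using X(1) by simp
  have nH: "norm (scaleR (1 / 2 ^ k) X) \<le> 1/2" using norm_scaleR_two_pow_le[OF X(2)] by linarith
  note H = sH nH
  show "cstar (dyadic_quotient \<phi> k X) = dyadic_quotient \<phi> k X"
    using increment_sa[OF \<phi> H] by (simp add: dyadic_quotient_def)
  show "norm (dyadic_quotient \<phi> k X) \<le> norm X"
    using norm_increment_le[OF \<phi> H] by (simp add: dyadic_quotient_def field_simps)
qed

lemma dyadic_derivative_sa:
  assumes X: "cstar X = X"
  shows "cstar (dyadic_derivative \<phi> X) = dyadic_derivative \<phi> X"
proof -
  obtain N where N: "\<And>k. N \<le> k \<Longrightarrow> norm X \<le> 2 ^ k * (1/4)"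
    using two_pow_dominates[of "1/4" "norm X"] by auto
  have l: "(\<lambda>k. dyadic_quotient \<phi> (k + N) X) \<longlonglongrightarrow> dyadic_derivative \<phi> X"
    by (intro LIMSEQ_ignore_initial_segment dyadic_quotient_tendsto X)
  then have "(\<lambda>k. cstar (dyadic_quotient \<phi> (k + N) X)) \<longlonglongrightarrow> cstar (dyadic_derivative \<phi> X)"
    by (rule bounded_linear.tendsto[OF bounded_linear_cstar])
  moreover have "cstar (dyadic_quotient \<phi> (k + N) X) = dyadic_quotient \<phi> (k + N) X" for k
    using N[of "k + N"] by (intro dyadic_quotient_sa X) simp
  ultimately show ?thesis using l LIMSEQ_unique by auto
qed

lemma norm_dyadic_derivative_le:
  assumes X: "cstar X = X"
  shows "norm (dyadic_derivative \<phi> X) \<le> norm X"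
proof -
  obtain N where N: "\<And>k. N \<le> k \<Longrightarrow> norm X \<le> 2 ^ k * (1/4)"
    using two_pow_dominates[of "1/4" "norm X"] by auto
  show ?thesis
    by (rule LIMSEQ_le_const2[OF tendsto_norm[OF dyadic_quotient_tendsto[OF X]]])
      (use N norm_dyadic_quotient_le[OF X] in auto)
qed

lemma dyadic_derivative_mono:
  assumes X: "cstar X = X" and Y: "cstar Y = Y" and le: "X \<preceq> Y"
  shows "dyadic_derivative \<phi> X \<preceq> dyadic_derivative \<phi> Y"
proof -
  obtain N where N: "\<And>k. N \<le> k \<Longrightarrow> norm X + norm Y \<le> 2 ^ k * (1/4)"
    using two_pow_dominates[of "1/4" "norm X + norm Y"] by auto
  have mono: "dyadic_quotient \<phi> (k + N) X \<preceq> dyadic_quotient \<phi> (k + N) Y" for k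
  proof -
    let ?c = "1 / 2 ^ (k + N) :: real"
    have b: "norm X \<le> 2 ^ (k + N) / 4" "norm Y \<le> 2 ^ (k + N) / 4"
      using N[of "k + N"] norm_ge_zero[of X] norm_ge_zero[of Y] le_add2[of N k] by linarith+
    have pd: "1 + scaleR ?c X \<in> pd_cone" "1 + scaleR ?c Y \<in> pd_cone"
      by (intro pd_one_plus_scaleR X Y b)+
    have "scaleR ?c X \<preceq> scaleR ?c Y" using le by (intro cs_le_scaleR) auto
    then have "\<phi> (1 + scaleR ?c X) \<preceq> \<phi> (1 + scaleR ?c Y)"
      using hoi_mono[OF \<phi> pd] by (simp add: cs_le_def)
    then have "increment \<phi> (scaleR ?c X) \<preceq> increment \<phi> (scaleR ?c Y)" by (simp add: increment_def)
    then show ?thesis unfolding dyadic_quotient_def by (intro cs_le_scaleR) auto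
  qed
  show ?thesis
    using cs_le_closed[OF mono LIMSEQ_ignore_initial_segment[OF dyadic_quotient_tendsto[OF X]]
        LIMSEQ_ignore_initial_segment[OF dyadic_quotient_tendsto[OF Y]]] .
qed

lemma dyadic_derivative_add:
  assumes X: "cstar X = X" and Y: "cstar Y = Y"
  shows "dyadic_derivative \<phi> (X + Y) = dyadic_derivative \<phi> X + dyadic_derivative \<phi> Y"
proof -
  define M where "M = norm X + norm Y"
  let ?E = "\<lambda>k. dyadic_quotient \<phi> k (X + Y) - (dyadic_quotient \<phi> k X + dyadic_quotient \<phi> k Y)"
  obtain N where N: "\<And>k. N \<le> k \<Longrightarrow> M \<le> 2 ^ k * (1/8)"
    using two_pow_dominates[of "1/8" M] by auto
  have E: "norm (?E k) \<le> (9 * M\<^sup>2) / 2 ^ k" if "N \<le> k" for k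
  proof -
    let ?c = "1 / 2 ^ k :: real"
    have 1: "norm (scaleR ?c X) \<le> M / 2 ^ k" "norm (scaleR ?c Y) \<le> M / 2 ^ k"
      by (simp_all add: M_def divide_right_mono)
    have 2: "M / 2 ^ k \<le> 1/8" using N[OF that] by (simp add: field_simps)
    have "?E k = scaleR (2 ^ k) (increment \<phi> (scaleR ?c X + scaleR ?c Y) - (increment \<phi> (scaleR ?c X) + increment \<phi> (scaleR ?c Y)))"
      by (simp add: dyadic_quotient_def algebra_simps)
    then have "norm (?E k) \<le> 2 ^ k * (9 * (M / 2 ^ k)\<^sup>2)"
      using increment_add[OF _ 1(1) _ 1(2) 2] X Y by simp
    also have "\<dots> = (9 * M\<^sup>2) / 2 ^ k" by (simp add: power2_eq_square field_simps)
    finally show ?thesis .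
  qed
  have "?E \<longlonglongrightarrow> 0"
    by (rule tendsto_0_le[OF tendsto_inverse_two_pow[of "9 * M\<^sup>2"], where K = 1])
      (use E in \<open>auto simp: eventually_sequentially\<close>)
  moreover have "?E \<longlonglongrightarrow> dyadic_derivative \<phi> (X + Y) - (dyadic_derivative \<phi> X + dyadic_derivative \<phi> Y)"
    using X Y by (intro tendsto_intros dyadic_quotient_tendsto) (simp_all add: cstar_simps)
  ultimately show ?thesis using LIMSEQ_unique by fastforce
qed

lemma dyadic_derivative_one: "dyadic_derivative \<phi> 1 = 1"
proof -
  have "dyadic_quotient \<phi> k 1 = 1" for k
  proof -
    have "1 + scaleR (1 / 2 ^ k) 1 = (of_real (1 + 1 / 2 ^ k) :: 'c::cstar_algebra)"
      by (simp add: of_real_def scaleR_add_left)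
    moreover have "0 < 1 + 1 / (2::real) ^ k" by (simp add: add_pos_pos)
    ultimately have "increment \<phi> (scaleR (1 / 2 ^ k) 1) = scaleR (1 / 2 ^ k) 1"
      unfolding increment_def using hoi_of_real[OF \<phi>, of "1 + 1 / 2 ^ k"] by (metis add_diff_cancel_left')
    then show ?thesis by (simp add: dyadic_quotient_def)
  qed
  then have "(\<lambda>k. 1) \<longlonglongrightarrow> dyadic_derivative \<phi> 1" using dyadic_quotient_tendsto[OF cstar_one] by simp
  then show ?thesis by (rule LIMSEQ_unique[OF _ tendsto_const])
qed

end

text \<open>A chain rule in discrete form: at equal step size, the quotient of \<chi> at the
  quotient of \<phi> is exactly \<open>X\<close>. Additivity and contractivity of the derivative of
  \<chi> absorb the approximation errors.\<close>

lemma dyadic_derivative_inverse: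
  fixes \<phi> :: "'a::cstar_algebra \<Rightarrow> 'b::cstar_algebra" and \<chi> :: "'b \<Rightarrow> 'a"
  assumes \<phi>: "homogeneous_order_iso \<phi>" and \<chi>: "homogeneous_order_iso \<chi>"
    and inv: "\<And>A. A \<in> pd_cone \<Longrightarrow> \<chi> (\<phi> A) = A" and X: "cstar X = X"
  shows "dyadic_derivative \<chi> (dyadic_derivative \<phi> X) = X"
proof -
  define Y where "Y = dyadic_derivative \<phi> X"
  let ?F = "dyadic_derivative \<chi>" and ?G = "\<lambda>k. dyadic_quotient \<phi> k X"
  have Y: "cstar Y = Y" unfolding Y_def by (rule dyadic_derivative_sa[OF \<phi> X])
  obtain N where N: "\<And>k. N \<le> k \<Longrightarrow> norm X \<le> 2 ^ k * (1/4)"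
    using two_pow_dominates[of "1/4" "norm X"] by auto
  have E: "norm (?F Y - X) \<le> (4 * (norm X)\<^sup>2) / 2 ^ k" if "N \<le> k" for k
  proof -
    have n: "norm X \<le> 2 ^ k / 4" using N[OF that] by simp
    note G = dyadic_quotient_sa[OF \<phi> X n] norm_dyadic_quotient_le[OF \<phi> X n]
    have pd: "1 + scaleR (1 / 2 ^ k) X \<in> pd_cone" by (rule pd_one_plus_scaleR[OF X n])
    have "dyadic_quotient \<chi> k (?G k) = X"
      unfolding dyadic_quotient_def increment_def using inv[OF pd] by simp
    then have 1: "norm (?F (?G k) - X) \<le> 2 * (norm (?G k))\<^sup>2 / 2 ^ k"
      using dyadic_derivative_approx[OF \<chi> G(1), of k] G(2) n by simp
    also have "\<dots> \<le> 2 * (norm X)\<^sup>2 / 2 ^ k" using G(2) by (intro divide_right_mono mult_left_mono power_mono) auto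
    finally have 1: "norm (?F (?G k) - X) \<le> 2 * (norm X)\<^sup>2 / 2 ^ k" .
    have "?F Y = ?F (?G k) + ?F (Y - ?G k)"
      using dyadic_derivative_add[OF \<chi> G(1), of "Y - ?G k"] Y G(1) by (simp add: cstar_simps)
    then have "norm (?F Y - X) \<le> norm (?F (?G k) - X) + norm (?F (Y - ?G k))"
      using norm_triangle_ineq[of "?F (?G k) - X" "?F (Y - ?G k)"] by (simp add: algebra_simps)
    also have "norm (?F (Y - ?G k)) \<le> norm (Y - ?G k)"
      using Y G(1) by (intro norm_dyadic_derivative_le[OF \<chi>]) (simp add: cstar_simps)
    also have "norm (Y - ?G k) \<le> 2 * (norm X)\<^sup>2 / 2 ^ k"
      unfolding Y_def by (rule dyadic_derivative_approx[OF \<phi> X n])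
    finally show ?thesis using 1 by simp
  qed
  have "norm (?F Y - X) \<le> 0"
    by (rule LIMSEQ_le_const[OF tendsto_inverse_two_pow[of "4 * (norm X)\<^sup>2"]]) (use E in blast)
  then show ?thesis by (simp add: Y_def)
qed

lemma homogeneous_order_iso_inv:
  assumes "homogeneous_order_iso \<phi>"
  shows "homogeneous_order_iso (inv_into pd_cone \<phi>)"
proof -
  let ?i = "inv_into pd_cone \<phi>"
  have b: "bij_betw \<phi> pd_cone pd_cone" by (rule hoi_bij[OF assms])
  have bi: "bij_betw ?i pd_cone pd_cone" by (rule bij_betw_inv_into[OF b])
  have mem: "?i A \<in> pd_cone" and r: "\<phi> (?i A) = A" if "A \<in> pd_cone" for A
    using that bij_betw_apply[OF bi] bij_betw_inv_into_right[OF b] by auto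
  have l: "?i (\<phi> A) = A" if "A \<in> pd_cone" for A by (rule bij_betw_inv_into_left[OF b that])
  have "?i A \<preceq> ?i B \<longleftrightarrow> A \<preceq> B" if "A \<in> pd_cone" "B \<in> pd_cone" for A B
    using hoi_mono[OF assms mem[OF that(1)] mem[OF that(2)]] r that by simp
  moreover have "?i (scaleR t A) = scaleR t (?i A)" if "A \<in> pd_cone" "0 < t" for A t
    using l[OF pd_scaleR[OF mem[OF that(1)] that(2)]] hoi_scaleR[OF assms mem[OF that(1)] that(2)] r that by simp
  moreover have "?i 1 = 1" using l[OF pd_one] hoi_one[OF assms] by simp
  ultimately show ?thesis using bi by (simp add: homogeneous_order_iso_def)
qed

text \<open>Limits only preserve the order; surjectivity and reflection of the order are supplied by
  the derivative of the inverse map.\<close>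

lemma unital_order_iso_dyadic_derivative:
  fixes \<phi> :: "'a::cstar_algebra \<Rightarrow> 'b::cstar_algebra"
  assumes \<phi>: "homogeneous_order_iso \<phi>"
  shows "unital_order_iso (dyadic_derivative \<phi>)"
proof (rule unital_order_isoI)
  let ?F = "dyadic_derivative \<phi>" and ?F' = "dyadic_derivative (inv_into pd_cone \<phi>)"
  note \<chi> = homogeneous_order_iso_inv[OF \<phi>]
  have FF': "?F' (?F X) = X" if "cstar X = X" for X
    using bij_betw_inv_into_left[OF hoi_bij[OF \<phi>]] by (intro dyadic_derivative_inverse \<phi> \<chi> that)
  have F'F: "?F (?F' X) = X" if "cstar X = X" for X
    using bij_betw_inv_into_right[OF hoi_bij[OF \<phi>]] by (intro dyadic_derivative_inverse \<phi> \<chi> that)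
  show "?F ` {X. cstar X = X} = {X. cstar X = X}"
  proof (intro equalityI subsetI)
    fix Y :: 'b assume "Y \<in> {X. cstar X = X}"
    then have "Y = ?F (?F' Y)" "?F' Y \<in> {X. cstar X = X}"
      using F'F dyadic_derivative_sa[OF \<chi>] by simp_all
    then show "Y \<in> ?F ` {X. cstar X = X}" by blast
  qed (use dyadic_derivative_sa[OF \<phi>] in auto)
  show "?F X \<preceq> ?F Y \<longleftrightarrow> X \<preceq> Y" if "cstar X = X" "cstar Y = Y" for X Y
    using dyadic_derivative_mono[OF \<phi> that] dyadic_derivative_mono[OF \<chi>, of "?F X" "?F Y"]
      dyadic_derivative_sa[OF \<phi>] FF' that by auto
qed (use dyadic_derivative_add[OF \<phi>] dyadic_derivative_one[OF \<phi>] in auto)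

section \<open>Recovery of the map from its derivative by dyadic roots\<close>

lemma norm_power_diff_le:
  fixes u v :: "'a::real_normed_algebra_1"
  assumes "norm u \<le> r" "norm v \<le> r" "1 \<le> r"
  shows "norm (u ^ n - v ^ n) \<le> real n * r ^ n * norm (u - v)"
proof (induction n)
  case (Suc n)
  have "u ^ Suc n - v ^ Suc n = u * (u ^ n - v ^ n) + (u - v) * v ^ n" by (simp add: algebra_simps)
  then have "norm (u ^ Suc n - v ^ Suc n) \<le> norm (u * (u ^ n - v ^ n)) + norm ((u - v) * v ^ n)"
    by (metis norm_triangle_ineq)
  also have "norm (u * (u ^ n - v ^ n)) \<le> r * (real n * r ^ n * norm (u - v))"
    using assms Suc by (intro order_trans[OF norm_mult_ineq] mult_mono) auto
  also have "norm ((u - v) * v ^ n) \<le> norm (u - v) * r ^ n"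
    using assms order_trans[OF norm_power_ineq power_mono[of "norm v" r n]]
    by (intro order_trans[OF norm_mult_ineq] mult_left_mono) auto
  also have "norm (u - v) * r ^ n \<le> norm (u - v) * r ^ Suc n"
    using assms by (intro mult_left_mono power_increasing) auto
  finally show ?case by (simp add: algebra_simps)
qed simp

text \<open>Taking a root halves the excess over one, as the root of \<open>1 + y\<close> is at most
  \<open>1 + y / 2\<close>. The same bound for the inverse gives
  \<open>1 / (1 + z) \<ge> 1 - z\<close> as a lower bound, hence a norm estimate.\<close>

lemma ex_dyadic_roots:
  assumes A: "A \<in> pd_cone"
  obtains M where "0 \<le> M" "\<And>k. \<exists>R\<in>pd_cone. R ^ (2 ^ k) = A \<and> norm (R - 1) \<le> M / 2 ^ k"
proof -
  define M where "M = norm A + norm (cs_inv A)"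
  have M0: "0 \<le> M" by (simp add: M_def)
  have step: "cs_sqrt R \<preceq> of_real (1 + y / 2)" if "R \<in> pd_cone" "R \<preceq> of_real (1 + y)" "0 \<le> y" for R :: 'a and y
  proof (rule square_mono_imp_mono)
    show "cs_positive (cs_sqrt R)" using that by (intro pd_positive pd_sqrt)
    show "of_real (1 + y / 2) \<in> (pd_cone :: 'a set)" using that by (intro pd_of_real) simp
    have "1 + y \<le> (1 + y / 2) * (1 + y / 2)" using that by (simp add: field_simps)
    then have "R \<preceq> of_real ((1 + y / 2) * (1 + y / 2))" using cs_le_trans[OF that(2) cs_le_of_real] by blast
    then show "cs_sqrt R * cs_sqrt R \<preceq> of_real (1 + y / 2) * of_real (1 + y / 2)"
      using that by (simp add: pd_sqrt_square)
  qed
  have roots: "\<exists>R\<in>pd_cone. R ^ (2 ^ k) = A \<and> R \<preceq> of_real (1 + M / 2 ^ k) \<and> cs_inv R \<preceq> of_real (1 + M / 2 ^ k)" for k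
  proof (induction k)
    case 0
    have "of_real (norm A) \<preceq> (of_real (1 + M) :: 'a)" "of_real (norm (cs_inv A)) \<preceq> (of_real (1 + M) :: 'a)"
      by (intro cs_le_of_real; simp add: M_def)+
    then have "A \<preceq> of_real (1 + M)" "cs_inv A \<preceq> of_real (1 + M)"
      using cs_le_of_real_norm[OF pd_sa[OF A]] cs_le_of_real_norm[OF pd_inv_sa[OF A]] cs_le_trans by blast+
    then show ?case using A by auto
  next
    case (Suc k)
    then obtain R where R: "R \<in> pd_cone" "R ^ (2 ^ k) = A" "R \<preceq> of_real (1 + M / 2 ^ k)" "cs_inv R \<preceq> of_real (1 + M / 2 ^ k)"
      by blast
    have S: "cs_sqrt R \<in> pd_cone" "cs_sqrt R * cs_sqrt R = R" using R by (simp_all add: pd_sqrt pd_sqrt_square)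
    have "cs_inv (cs_sqrt R) = cs_sqrt (cs_inv R)"
      using cs_sqrt_eqI[OF pd_positive[OF pd_inv[OF R(1)]] pd_positive[OF pd_inv[OF S(1)]]]
        cs_inv_mult[OF pd_invertible[OF S(1)] pd_invertible[OF S(1)]] S(2) by simp
    moreover have "M / 2 ^ k / 2 = M / 2 ^ Suc k" by simp
    moreover have "0 \<le> M / 2 ^ k" using M0 by simp
    ultimately have "cs_sqrt R \<preceq> of_real (1 + M / 2 ^ Suc k)" "cs_inv (cs_sqrt R) \<preceq> of_real (1 + M / 2 ^ Suc k)"
      using step[OF R(1,3)] step[OF pd_inv[OF R(1)] R(4)] by metis+
    moreover have "cs_sqrt R ^ (2 ^ Suc k) = A"
      using R(2) S(2) by (simp add: power_mult power2_eq_square)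
    ultimately show ?case using S(1) by blast
  qed
  have "\<exists>R\<in>pd_cone. R ^ (2 ^ k) = A \<and> norm (R - 1) \<le> M / 2 ^ k" for k
  proof -
    obtain R where R: "R \<in> pd_cone" "R ^ (2 ^ k) = A" "R \<preceq> of_real (1 + M / 2 ^ k)" "cs_inv R \<preceq> of_real (1 + M / 2 ^ k)"
      using roots by blast
    define z where "z = M / 2 ^ k"
    have z: "0 \<le> z" using M0 by (simp add: z_def)
    then have z1: "0 < 1 + z" by simp
    have "of_real (1 / (1 + z)) \<preceq> R"
      using cs_inv_le_iff[OF pd_of_real[of "1 / (1 + z)"] R(1)] R(4) z1 cs_inv_of_real[of "1 / (1 + z)", where 'a = 'a]
      by (simp add: z_def[symmetric])
    moreover have "1 - z \<le> 1 / (1 + z)" using z z1 by (simp add: field_simps)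
    ultimately have "of_real (1 - z) \<preceq> R" using cs_le_trans[OF cs_le_of_real] by blast
    then have "- of_real z \<preceq> R - 1" "R - 1 \<preceq> of_real z"
      using R(3) by (simp_all add: z_def[symmetric] cs_le_def algebra_simps)
    then have "norm (R - 1) \<le> z"
      using norm_le_iff_cs_le[of "R - 1" z] pd_sa[OF R(1)] z by (simp add: cstar_simps)
    then show ?thesis using R z_def by blast
  qed
  then show ?thesis using that M0 by blast
qed

lemma power_two_pow_of_square:
  fixes f :: "'a::cstar_algebra \<Rightarrow> 'b::cstar_algebra"
  assumes "\<And>A. A \<in> pd_cone \<Longrightarrow> f (A * A) = f A * f A" "R \<in> pd_cone"
  shows "f (R ^ (2 ^ k)) = f R ^ (2 ^ k)"
  using assms(2)
proof (induction k arbitrary: R)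
  case (Suc k)
  have "R * R \<in> pd_cone"
    using pd_congruence[OF pd_one pd_sa[OF Suc.prems] pd_invertible[OF Suc.prems]] by simp
  then have "f ((R * R) ^ (2 ^ k)) = f (R * R) ^ (2 ^ k)" by (rule Suc.IH)
  then show ?case using assms(1)[OF Suc.prems] by (simp add: power_mult power2_eq_square)
qed simp

text \<open>The derivative extends to a Jordan isomorphism \<open>J\<close>. At \<open>R = A\<^bsup>1/2^k\<^esup>\<close> the maps \<open>\<phi>\<close> and \<open>J\<close> differ by
  \<open>O(4\<^sup>-\<^sup>k)\<close>, and both commute with \<open>2^k\<close>-th powers, so they differ by \<open>O(2\<^sup>-\<^sup>k)\<close> at \<open>A\<close>.\<close>

theorem jordan_of_homogeneous_order_iso:
  fixes \<phi> :: "'a::cstar_algebra \<Rightarrow> 'b::cstar_algebra"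
  assumes \<phi>: "homogeneous_order_iso \<phi>"
  shows "\<exists>J. jordan_star_iso J \<and> (\<forall>A\<in>pd_cone. \<phi> A = J A)"
proof -
  let ?F = "dyadic_derivative \<phi>"
  obtain J where J: "jordan_star_iso J" "\<And>X. cstar X = X \<Longrightarrow> J X = ?F X"
    using jordan_star_iso_of_order_iso[OF unital_order_iso_dyadic_derivative[OF \<phi>]] by blast
  have "\<phi> A = J A" if A: "A \<in> pd_cone" for A
  proof -
    obtain M where M: "0 \<le> M" "\<And>k. \<exists>R\<in>pd_cone. R ^ (2 ^ k) = A \<and> norm (R - 1) \<le> M / 2 ^ k"
      using ex_dyadic_roots[OF A] by blast
    obtain N where N: "\<And>k. N \<le> k \<Longrightarrow> M \<le> 2 ^ k * (1/4)" using two_pow_dominates[of "1/4" M] by auto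
    have E: "norm (\<phi> A - J A) \<le> (2 * exp M * M\<^sup>2) / 2 ^ k" if "N \<le> k" for k
    proof -
      obtain R where R: "R \<in> pd_cone" "R ^ (2 ^ k) = A" "norm (R - 1) \<le> M / 2 ^ k" using M(2) by blast
      define H where "H = R - 1"
      define r where "r = 1 + M / 2 ^ k"
      have r: "1 \<le> r" using M(1) by (simp add: r_def)
      have H: "cstar H = H" "norm H \<le> M / 2 ^ k" using R pd_sa[OF R(1)] by (simp_all add: H_def cstar_simps)
      have "M / 2 ^ k \<le> 1/4" using N[OF that] by (simp add: field_simps)
      then have H4: "norm H \<le> 1/4" using H(2) by linarith
      have u: "\<phi> R = 1 + increment \<phi> H" by (simp add: increment_def H_def)
      have v: "J R = 1 + ?F H"
        using J(2)[OF H(1)] jordan_add[OF J(1), of 1 H] jordan_one[OF J(1)] by (simp add: H_def)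
      have nu: "norm (\<phi> R) \<le> r" "norm (J R) \<le> r"
        using norm_triangle_ineq[of 1 "increment \<phi> H"] norm_triangle_ineq[of 1 "?F H"] H H4
          norm_increment_le[OF \<phi> H(1)] norm_dyadic_derivative_le[OF \<phi> H(1)]
        unfolding u v r_def by simp_all
      have "norm (\<phi> R - J R) = norm (?F H - dyadic_quotient \<phi> 0 H)"
        unfolding u v by (simp add: dyadic_quotient_def norm_minus_commute)
      also have "\<dots> \<le> 2 * (norm H)\<^sup>2" using dyadic_derivative_approx[OF \<phi> H(1), of 0] H4 by simp
      also have "\<dots> \<le> 2 * (M / 2 ^ k)\<^sup>2" using H(2) by (intro mult_left_mono power_mono) auto
      finally have uv: "norm (\<phi> R - J R) \<le> 2 * (M / 2 ^ k)\<^sup>2" .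
      \<comment> \<open>A side condition of the bound of \<open>(1 + M / n) ^ n\<close> by
        \<open>exp M\<close>. Hence powers of \<open>r\<close> stay bounded in \<open>k\<close>, and
        the error is amplified only by \<open>2 ^ k\<close> times a constant.\<close>
      have "- (2 ^ k) \<le> M" using M(1) order_trans[of "- (2 ^ k)" 0 M] by simp
      then have "r ^ (2 ^ k) \<le> exp M"
        unfolding r_def using exp_ge_one_plus_x_over_n_power_n[where x = M and n = "2 ^ k"] M(1) by simp
      then have "real (2 ^ k) * r ^ (2 ^ k) * norm (\<phi> R - J R) \<le> 2 ^ k * exp M * (2 * (M / 2 ^ k)\<^sup>2)"
        using uv r by (intro mult_mono) auto
      also have "\<dots> = (2 * exp M * M\<^sup>2) / 2 ^ k" by (simp add: power2_eq_square field_simps)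
      finally have "norm (\<phi> R ^ (2 ^ k) - J R ^ (2 ^ k)) \<le> (2 * exp M * M\<^sup>2) / 2 ^ k"
        using norm_power_diff_le[OF nu r, of "2 ^ k"] by simp
      moreover have "\<phi> R ^ (2 ^ k) = \<phi> A" "J R ^ (2 ^ k) = J A"
        using power_two_pow_of_square[of \<phi> R k] power_two_pow_of_square[of J R k]
          hoi_square[OF \<phi>] jordan_square[OF J(1)] R by simp_all
      ultimately show ?thesis by simp
    qed
    have "norm (\<phi> A - J A) \<le> 0"
      by (rule LIMSEQ_le_const[OF tendsto_inverse_two_pow[of "2 * exp M * M\<^sup>2"]]) (use E in blast)
    then show ?thesis by simp
  qed
  then show ?thesis using J(1) by blast
qed

theorem theoremT:
  fixes \<phi> :: "'a::cstar_algebra \<Rightarrow> 'b::cstar_algebra"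
  assumes "\<phi> ` pd_cone = pd_cone"
  shows "((\<forall>A\<in>pd_cone. \<forall>B\<in>pd_cone. norm (arith_mean (\<phi> A) (\<phi> B)) = norm (arith_mean A B))
            \<longleftrightarrow> (\<exists>J. jordan_star_iso J \<and> (\<forall>A\<in>pd_cone. \<phi> A = J A)))
       \<and> ((\<forall>A\<in>pd_cone. \<forall>B\<in>pd_cone. norm (geom_mean (\<phi> A) (\<phi> B)) = norm (geom_mean A B))
            \<longleftrightarrow> (\<exists>J. jordan_star_iso J \<and> (\<forall>A\<in>pd_cone. \<phi> A = J A)))
       \<and> ((AW_star TYPE('a) \<and> AW_star TYPE('b)) \<or> (cs_commutative TYPE('a) \<and> cs_commutative TYPE('b))
            \<longrightarrow> ((\<forall>A\<in>pd_cone. \<forall>B\<in>pd_cone. norm (harm_mean (\<phi> A) (\<phi> B)) = norm (harm_mean A B))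
                 \<longleftrightarrow> (\<exists>J. jordan_star_iso J \<and> (\<forall>A\<in>pd_cone. \<phi> A = J A))))"
proof -
  have "\<exists>J. jordan_star_iso J \<and> (\<forall>A\<in>pd_cone. \<phi> A = J A)"
    if "\<forall>A\<in>pd_cone. \<forall>B\<in>pd_cone. norm (geom_mean (\<phi> A) (\<phi> B)) = norm (geom_mean A B)"
    using jordan_of_homogeneous_order_iso[OF homogeneous_order_iso_of_geom_mean_norm[OF assms that]] .
  moreover have "norm (arith_mean (\<phi> A) (\<phi> B)) = norm (arith_mean A B)"
    "norm (geom_mean (\<phi> A) (\<phi> B)) = norm (geom_mean A B)"
    "norm (harm_mean (\<phi> A) (\<phi> B)) = norm (harm_mean A B)"
    if J: "\<exists>J. jordan_star_iso J \<and> (\<forall>A\<in>pd_cone. \<phi> A = J A)" and A: "A \<in> pd_cone" and B: "B \<in> pd_cone" for A B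
  proof -
    obtain J where "jordan_star_iso J" "\<phi> A = J A" "\<phi> B = J B" using J A B by blast
    then show "norm (arith_mean (\<phi> A) (\<phi> B)) = norm (arith_mean A B)"
      "norm (geom_mean (\<phi> A) (\<phi> B)) = norm (geom_mean A B)"
      "norm (harm_mean (\<phi> A) (\<phi> B)) = norm (harm_mean A B)"
      using jordan_preserves_mean_norms[of J A B] A B by simp_all
  qed
  ultimately show ?thesis
    using jordan_of_arith_mean_norm[OF assms] jordan_of_harm_mean_norm[OF assms] by blast
qed

end
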